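(* Let $k$ be a field, $\Gamma$ a finite graph and $R(\Gamma)$ its cographic ring over $k$. Then: (a) $R(\Gamma)=\varprojlim_{(T,\phi)\in\mathcal{OP}_\Gamma}R(\Gamma\setminus T,\phi)$, the inverse limit of the affine semigroup rings $R(\Gamma\setminus T,\phi)$ along the projection maps $R(\Gamma\setminus T,\phi)\to R(\Gamma\setminus T',\phi')$ for $(T',\phi')\le(T,\phi)$. (b) The $k$-algebra homomorphism $k[V_\gamma : \gamma\in\overset{\rightarrow}{\rm Cir}(\Gamma)]\to R(\Gamma)$, $V_\gamma\mapsto X^{[\gamma]}$, is surjective, and its kernel $I_\Gamma$ is $$I_\Gamma=(V_\gamma V_{\gamma'} : \gamma\not\asymp\gamma')+\sum_{(T,\phi)\in\mathcal{OP}_\Gamma}I_{(\Gamma\setminus T,\phi)}=(V_\gamma V_{\gamma'} : \gamma\not\asymp\gamma')+\sum_{(E(\Gamma)_{\rm sep},\phi)\in\mathcal{OP}_\Gamma}I_{(\Gamma\setminus E(\Gamma)_{\rm sep},\phi)},$$ so that $R(\Gamma)=k[V_\gamma : \gamma\in\overset{\rightarrow}{\rm Cir}(\Gamma)]/I_\Gamma$.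
   Context: Graphs. A finite graph $\Gamma$ consists of finite sets $V(\Gamma)$ (vertices) and $\overset{\rightarrow}{E}(\Gamma)$ (oriented edges), a fixed-point-free involution $\iota$ of $\overset{\rightarrow}{E}(\Gamma)$, and source and target maps $s,t:\overset{\rightarrow}{E}(\Gamma)\to V(\Gamma)$ with $s(\vec e)=t(\iota(\vec e))$ (loops and multiple edges allowed). $E(\Gamma):=\overset{\rightarrow}{E}(\Gamma)/\iota$; the two orientations of an edge $e$ are $\overset{\rightarrow}{e}$ and $\overset{\leftarrow}{e}$. An orientation of $\Gamma$ is a section $\phi:E(\Gamma)\to\overset{\rightarrow}{E}(\Gamma)$ of the quotient map. For $S\subseteq E(\Gamma)$, $\Gamma\setminus S$ is obtained by removing the edges in $S$ and keeping all vertices. An edge $e$ is separating if $\Gamma\setminus\{e\}$ has more connected components than $\Gamma$; $E(\Gamma)_{\rm sep}$ is the set of separating edges. Totally cyclic orientations and circuits. If $\Gamma$ is connected, an orientation $\phi$ is totally cyclic if there is no non-empty proper subset $W\subset V(\Gamma)$ such that every edge between $W$ and $V(\Gamma)\setminus W$ is oriented from $W$ to $V(\Gamma)\setminus W$; in general $\phi$ is totally cyclic if its restriction to each connected component is. $\mathcal{OP}_\Gamma$ is the set of pairs $(T,\phi)$ with $T\subseteq E(\Gamma)$ and $\phi$ a totally cyclic orientation of $\Gamma\setminus T$, with $(T',\phi')\le(T,\phi)$ iff $T\subseteq T'$ and $\phi'=\phi|_{E(\Gamma\setminus T')}$. An oriented circuit $\gamma=(\Delta,\phi_\Delta)$ on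 $\Gamma$ is a cyclic subgraph $\Delta\subseteq\Gamma$ (connected, without separating edges, $b_1(\Delta)=1$) with a totally cyclic orientation $\phi_\Delta$ of $\Delta$; $[\gamma]=\sum_{e\in E(\Delta)}\phi_\Delta(e)\in H_1(\Gamma,\mathbb Z)$. $\overset{\rightarrow}{\rm Cir}(\Gamma)$ is the set of oriented circuits on $\Gamma$; for $(T,\phi)\in\mathcal{OP}_\Gamma$, $\operatorname{Cir}_\phi(\Gamma\setminus T)$ is the set of oriented circuits on $\Gamma\setminus T$ of the form $(\Delta,\phi|_\Delta)$. Oriented circuits $\gamma=(\Delta,\phi_\Delta)$, $\gamma'=(\Delta',\phi_{\Delta'})$ are concordant, $\gamma\asymp\gamma'$, if $\phi_\Delta(e)=\phi_{\Delta'}(e)$ for all $e\in E(\Delta)\cap E(\Delta')$; otherwise $\gamma\not\asymp\gamma'$. Homology. $\overset{\rightarrow}{C}_1(\Gamma,A)$ is the $A$-module generated by $\overset{\rightarrow}{E}(\Gamma)$ with relations $\overset{\leftarrow}{e}=-\overset{\rightarrow}{e}$; $\partial(\overset{\rightarrow}{e})=t(\overset{\rightarrow}{e})-s(\overset{\rightarrow}{e})$; $H_1(\Gamma,A)=\ker\partial$. The bilinear form on $\overset{\rightarrow}{C}_1(\Gamma,\mathbb R)$ is determined by $(\overset{\rightarrow}{e},\overset{\rightarrow}{e})=1$, $(\overset{\rightarrow}{e},\overset{\leftarrow}{e})=-1$, $(\overset{\rightarrow}{e},\overset{\rightarrow}{f})=0$ for $f\ne e$. Cographic ring. The cographic arrangement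 is the set of hyperplanes $\{v\in H_1(\Gamma,\mathbb R):(v,e)=0\}$ for those $e\in E(\Gamma)$ with $(\cdot,e)\not\equiv0$ on $H_1(\Gamma,\mathbb R)$. The cographic fan $\mathcal F_\Gamma^\perp$ consists of the closures of the connected components of its complement in $H_1(\Gamma,\mathbb R)$ and all their faces. $R(\Gamma)$ is the $k$-algebra with $k$-basis $\{X^c:c\in H_1(\Gamma,\mathbb Z)\}$ and multiplication $X^cX^{c'}=X^{c+c'}$ if $c,c'$ lie in a common cone of $\mathcal F_\Gamma^\perp$, and $X^cX^{c'}=0$ otherwise. Affine semigroup rings. For $(T,\phi)\in\mathcal{OP}_\Gamma$, $\sigma(T,\phi)=\{v\in H_1(\Gamma,\mathbb R):(v,\phi(e))\ge0\ \forall e\notin T,\ (v,e)=0\ \forall e\in T\}$, $C(\Gamma\setminus T,\phi)=\sigma(T,\phi)\cap H_1(\Gamma,\mathbb Z)$, $R(\Gamma\setminus T,\phi)=k[C(\Gamma\setminus T,\phi)]$. For $(T',\phi')\le(T,\phi)$ the projection $R(\Gamma\setminus T,\phi)\to R(\Gamma\setminus T',\phi')$ sends $X^c$ to $X^c$ if $c\in\sigma(T',\phi')$ and to $0$ otherwise; likewise $R(\Gamma)\to R(\Gamma\setminus T,\phi)$ sends $X^c$ to $X^c$ if $c\in\sigma(T,\phi)$ and to $0$ otherwise. $I_{(\Gamma\setminus T,\phi)}$ is the kernel of $k[V_\gamma:\gamma\in\operatorname{Cir}_\phi(\Gamma\setminus T)]\to R(\Gamma\setminus T,\phi)$, $V_\gamma\mapsto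 X^{[\gamma]}$; in the formula for $I_\Gamma$ it denotes the ideal it generates in $k[V_\gamma:\gamma\in\overset{\rightarrow}{\rm Cir}(\Gamma)]$. *)

theory Defs
  imports
    "HOL-Analysis.Analysis"
    "HOL-Algebra.Module"
    "HOL-Algebra.QuotRing"
    "HOL-Library.Poly_Mapping"
begin

section \<open>Finite graphs\<close>

text \<open>
  Oriented edges are called darts; they are drawn from a type of class \<^class>\<open>finite\<close>, so that
  1-chains are vectors indexed by that type. The carrier \<open>darts\<close> may be any (possibly empty)
  subset of the type, and nothing is required of the maps outside the carriers.
\<close>

record ('v, 'd) graph =
  verts :: "'v set"
  darts :: "'d set"
  flip :: "'d \<Rightarrow> 'd"
  src :: "'d \<Rightarrow> 'v"
  tgt :: "'d \<Rightarrow> 'v"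

definition finite_graph :: "('v, 'd::finite) graph \<Rightarrow> bool" where
  "finite_graph G \<longleftrightarrow> finite (verts G) \<and>
     (\<forall>d\<in>darts G. flip G d \<in> darts G \<and> flip G d \<noteq> d \<and> flip G (flip G d) = d \<and>
        src G d \<in> verts G \<and> tgt G d \<in> verts G \<and> src G d = tgt G (flip G d))"

definition edges :: "('v, 'd) graph \<Rightarrow> 'd set set" where
  "edges G = (\<lambda>d. {d, flip G d}) ` darts G"

text \<open>A section of the quotient map from darts to edges picks an element of each edge;
  orientations are extensional so that equality of orientations is equality on the edges.\<close>

definition orientations :: "('v, 'd) graph \<Rightarrow> ('d set \<Rightarrow> 'd) set" where
  "orientations G = (\<Pi>\<^sub>E e\<in>edges G. e)"

definition delete_edges :: "('v, 'd) graph \<Rightarrow> 'd set set \<Rightarrow> ('v, 'd) graph" where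
  "delete_edges G S = G\<lparr>darts := darts G - \<Union>S\<rparr>"

definition reachable :: "('v, 'd) graph \<Rightarrow> ('v \<times> 'v) set" where
  "reachable G = {(u, v). u \<in> verts G \<and> v \<in> verts G \<and>
     (u, v) \<in> {(src G d, tgt G d) | d. d \<in> darts G}\<^sup>*}"

definition graph_components :: "('v, 'd) graph \<Rightarrow> 'v set set" where
  "graph_components G = verts G // reachable G"

definition connected_graph :: "('v, 'd) graph \<Rightarrow> bool" where
  "connected_graph G \<longleftrightarrow> card (graph_components G) = 1"

definition separating_edges :: "('v, 'd) graph \<Rightarrow> 'd set set" where
  "separating_edges G =
     {e \<in> edges G. card (graph_components (delete_edges G {e})) > card (graph_components G)}"

definition induced_subgraph :: "('v, 'd) graph \<Rightarrow> 'v set \<Rightarrow> ('v, 'd) graph" where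
  "induced_subgraph G W = G\<lparr>verts := W, darts := {d \<in> darts G. src G d \<in> W \<and> tgt G d \<in> W}\<rparr>"

text \<open>The maps of a subgraph are those of the ambient graph, so that a subgraph is determined by
  its vertices and darts, and a subgraph of \<open>delete_edges G S\<close> is a subgraph of \<open>G\<close>.\<close>

definition subgraph :: "('v, 'd::finite) graph \<Rightarrow> ('v, 'd) graph \<Rightarrow> bool" where
  "subgraph D G \<longleftrightarrow> finite_graph D \<and> verts D \<subseteq> verts G \<and> darts D \<subseteq> darts G \<and>
     flip D = flip G \<and> src D = src G \<and> tgt D = tgt G"


section \<open>Homology\<close>

text \<open>
  The module generated by the darts with relations \<open>flip d = - d\<close> is realised as the module of
  antisymmetric functions on the darts; the generator \<open>d\<close> is \<open>dart_chain G d\<close>, and the coefficient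
  of a chain \<open>c\<close> at the generator \<open>d\<close> is \<open>c $ d\<close>. The lemmas \<open>dart_chain_flip\<close> and
  \<open>chain_decomposition\<close> below give the relations and, for any orientation, the resulting basis.
\<close>

definition chains :: "('v, 'd::finite) graph \<Rightarrow> ('a::comm_ring_1 ^ 'd) set" where
  "chains G = {c. (\<forall>d\<in>darts G. c $ flip G d = - (c $ d)) \<and> (\<forall>d. d \<notin> darts G \<longrightarrow> c $ d = 0)}"

definition dart_chain :: "('v, 'd::finite) graph \<Rightarrow> 'd \<Rightarrow> 'a::comm_ring_1 ^ 'd" where
  "dart_chain G d = axis d 1 - axis (flip G d) 1"

text \<open>The coefficient of the boundary at a vertex: each edge occurs through both of its darts, and
  the dart leaving the vertex is accounted for by its flip, which enters it with opposite sign.\<close>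

definition boundary :: "('v, 'd::finite) graph \<Rightarrow> 'a::comm_ring_1 ^ 'd \<Rightarrow> 'v \<Rightarrow> 'a" where
  "boundary G c v = (\<Sum>d | d \<in> darts G \<and> tgt G d = v. c $ d)"

definition H1 :: "('v, 'd::finite) graph \<Rightarrow> ('a::comm_ring_1 ^ 'd) set" where
  "H1 G = {c \<in> chains G. \<forall>v\<in>verts G. boundary G c v = 0}"

text \<open>Each edge is counted twice in the Euclidean inner product, once for each of its darts.\<close>

definition chain_form :: "real ^ 'd::finite \<Rightarrow> real ^ 'd \<Rightarrow> real" where
  "chain_form c c' = (c \<bullet> c') / 2"

definition betti1 :: "('v, 'd::finite) graph \<Rightarrow> nat" where
  "betti1 G = dim (H1 G :: (real ^ 'd) set)"

definition to_real :: "int ^ 'd::finite \<Rightarrow> real ^ 'd" where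
  "to_real c = (\<chi> d. real_of_int (c $ d))"

lemma dart_chain_flip:
  assumes "finite_graph G" "d \<in> darts G"
  shows "dart_chain G (flip G d) = - dart_chain G d"
  using assms by (auto simp: dart_chain_def finite_graph_def)

lemma dart_chain_in_chains:
  assumes "finite_graph G" "d \<in> darts G"
  shows "dart_chain G d \<in> chains G"
proof -
  have G: "flip G x \<in> darts G" "flip G (flip G x) = x" if "x \<in> darts G" for x
    using that assms(1) by (auto simp: finite_graph_def)
  have "flip G x = d \<longleftrightarrow> x = flip G d" "flip G x = flip G d \<longleftrightarrow> x = d" if "x \<in> darts G" for x
    using G that assms(2) by metis+
  then show ?thesis
    using G(1)[OF assms(2)] assms(2) by (auto simp: dart_chain_def chains_def axis_def)
qed

lemma chain_decomposition:
  fixes c :: "'a::comm_ring_1 ^ 'd::finite"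
  assumes G: "finite_graph G" and c: "c \<in> chains G" and phi: "\<phi> \<in> orientations G"
  shows "c = (\<Sum>e\<in>edges G. c $ \<phi> e *s dart_chain G (\<phi> e))"
    and "\<And>e e'. e \<in> edges G \<Longrightarrow> e' \<in> edges G \<Longrightarrow>
           (dart_chain G (\<phi> e) :: 'a ^ 'd) $ \<phi> e' = (if e = e' then 1 else 0)"
proof -
  have edge: "e = {d, flip G d}" if "e \<in> edges G" "d \<in> e" for e d
    using that G by (auto simp: edges_def finite_graph_def)
  have sub: "d \<in> darts G" if "e \<in> edges G" "d \<in> e" for e d
    using that G by (auto simp: edges_def finite_graph_def)
  have sec: "\<phi> e \<in> e" if "e \<in> edges G" for e
    using that phi by (auto simp: orientations_def)
  have coeff: "c $ \<phi> e * (dart_chain G (\<phi> e) :: 'a ^ 'd) $ d = (if d \<in> e then c $ d else 0)"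
    if e: "e \<in> edges G" for e d
  proof -
    have "flip G (\<phi> e) \<noteq> \<phi> e" "c $ flip G (\<phi> e) = - (c $ \<phi> e)"
      using sub[OF e sec[OF e]] G c by (auto simp: finite_graph_def chains_def)
    then show ?thesis
      using edge[OF e sec[OF e]] by (auto simp: dart_chain_def axis_def)
  qed
  show "c = (\<Sum>e\<in>edges G. c $ \<phi> e *s dart_chain G (\<phi> e))"
  proof (rule vec_eq_iff[THEN iffD2], rule allI)
    fix d
    have "(\<Sum>e\<in>edges G. c $ \<phi> e *s dart_chain G (\<phi> e)) $ d =
          (\<Sum>e\<in>edges G. if d \<in> e then c $ d else 0)"
      by (auto simp: coeff intro!: sum.cong)
    also have "\<dots> = c $ d"
    proof (cases "d \<in> darts G")
      case True
      then have 1: "{d, flip G d} \<in> edges G" by (auto simp: edges_def)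
      have "(\<Sum>e\<in>edges G. if d \<in> e then c $ d else 0) =
            (\<Sum>e\<in>edges G. if e = {d, flip G d} then c $ d else 0)"
      proof (rule sum.cong)
        fix e assume "e \<in> edges G"
        then have "d \<in> e \<longleftrightarrow> e = {d, flip G d}" using edge[of e d] by blast
        then show "(if d \<in> e then c $ d else 0) = (if e = {d, flip G d} then c $ d else 0)"
          by (simp only:)
      qed simp
      also have "\<dots> = c $ d"
        using 1 by simp
      finally show ?thesis .
    next
      case False
      then have "c $ d = 0" using c by (auto simp: chains_def)
      then show ?thesis by (simp cong: if_cong)
    qed
    finally show "c $ d = (\<Sum>e\<in>edges G. c $ \<phi> e *s dart_chain G (\<phi> e)) $ d" by simp
  qed
  fix e e' assume ee: "e \<in> edges G" "e' \<in> edges G"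
  have "flip G (\<phi> e) \<noteq> \<phi> e"
    using sub[OF ee(1) sec[OF ee(1)]] G by (auto simp: finite_graph_def)
  moreover have "\<phi> e' \<noteq> \<phi> e \<and> \<phi> e' \<noteq> flip G (\<phi> e)" if "e \<noteq> e'"
  proof -
    have "\<phi> e' \<notin> e"
    proof
      assume "\<phi> e' \<in> e"
      then have "e = e'"
        by (rule trans[OF edge[OF ee(1)] edge[OF ee(2) sec[OF ee(2)], symmetric]])
      with that show False ..
    qed
    then show ?thesis
      using equalityD2[OF edge[OF ee(1) sec[OF ee(1)]]] by blast
  qed
  ultimately show "(dart_chain G (\<phi> e) :: 'a ^ 'd) $ \<phi> e' = (if e = e' then 1 else 0)"
    by (cases "e = e'") (auto simp: dart_chain_def axis_def)
qed

lemma boundary_dart_chain: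
  assumes "finite_graph G" "d \<in> darts G"
  shows "boundary G (dart_chain G d) v = of_bool (v = tgt G d) - of_bool (v = src G d)"
proof -
  have d: "flip G d \<in> darts G" "flip G d \<noteq> d" "tgt G (flip G d) = src G d"
    using assms by (auto simp: finite_graph_def)
  have "boundary G (dart_chain G d) v =
        (\<Sum>x | x \<in> darts G \<and> tgt G x = v. (if x = d then 1 else 0) - (if x = flip G d then 1 else 0))"
    by (auto simp: boundary_def dart_chain_def axis_def intro!: sum.cong)
  then show ?thesis
    using d assms(2) by (auto simp: sum_subtractf)
qed

lemma chain_form_dart:
  assumes "finite_graph G" "d \<in> darts G" "c \<in> chains G"
  shows "chain_form c (dart_chain G d) = c $ d"
  using assms by (simp add: chain_form_def dart_chain_def inner_diff_right inner_axis chains_def)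


section \<open>Totally cyclic orientations and circuits\<close>

definition no_directed_cut :: "('v, 'd) graph \<Rightarrow> ('d set \<Rightarrow> 'd) \<Rightarrow> bool" where
  "no_directed_cut G \<phi> \<longleftrightarrow>
     \<not> (\<exists>W. W \<noteq> {} \<and> W \<subset> verts G \<and>
          (\<forall>e\<in>edges G. (\<exists>d\<in>e. src G d \<in> W \<and> tgt G d \<in> verts G - W) \<longrightarrow>
             src G (\<phi> e) \<in> W \<and> tgt G (\<phi> e) \<in> verts G - W))"

definition totally_cyclic :: "('v, 'd) graph \<Rightarrow> ('d set \<Rightarrow> 'd) \<Rightarrow> bool" where
  "totally_cyclic G \<phi> \<longleftrightarrow> \<phi> \<in> orientations G \<and>
     (\<forall>W\<in>graph_components G.
        no_directed_cut (induced_subgraph G W) (restrict \<phi> (edges (induced_subgraph G W))))"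

definition OP :: "('v, 'd) graph \<Rightarrow> ('d set set \<times> ('d set \<Rightarrow> 'd)) set" where
  "OP G = {(T, \<phi>). T \<subseteq> edges G \<and> totally_cyclic (delete_edges G T) \<phi>}"

definition OP_le :: "('v, 'd) graph \<Rightarrow> 'd set set \<times> ('d set \<Rightarrow> 'd)
    \<Rightarrow> 'd set set \<times> ('d set \<Rightarrow> 'd) \<Rightarrow> bool" where
  "OP_le G = (\<lambda>(T', \<phi>') (T, \<phi>). T \<subseteq> T' \<and> \<phi>' = restrict \<phi> (edges (delete_edges G T')))"

type_synonym ('v, 'd) circuit = "('v, 'd) graph \<times> ('d set \<Rightarrow> 'd)"

definition cyclic_subgraph :: "('v, 'd::finite) graph \<Rightarrow> ('v, 'd) graph \<Rightarrow> bool" where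
  "cyclic_subgraph D G \<longleftrightarrow> subgraph D G \<and> connected_graph D \<and> separating_edges D = {} \<and>
     betti1 D = 1"

definition Cir :: "('v, 'd::finite) graph \<Rightarrow> ('v, 'd) circuit set" where
  "Cir G = {(D, \<psi>). cyclic_subgraph D G \<and> totally_cyclic D \<psi>}"

definition Cir_of :: "('v, 'd::finite) graph \<Rightarrow> 'd set set \<times> ('d set \<Rightarrow> 'd)
    \<Rightarrow> ('v, 'd) circuit set" where
  "Cir_of G = (\<lambda>(T, \<phi>). {(D, \<psi>) \<in> Cir (delete_edges G T). \<psi> = restrict \<phi> (edges D)})"

definition circuit_class :: "('v, 'd::finite) circuit \<Rightarrow> int ^ 'd" where
  "circuit_class = (\<lambda>(D, \<psi>). \<Sum>e\<in>edges D. dart_chain D (\<psi> e))"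

definition concordant :: "('v, 'd) circuit \<Rightarrow> ('v, 'd) circuit \<Rightarrow> bool" where
  "concordant = (\<lambda>(D, \<psi>) (D', \<psi>'). \<forall>e \<in> edges D \<inter> edges D'. \<psi> e = \<psi>' e)"


section \<open>The cographic fan\<close>

text \<open>The linear form attached to an edge is determined up to sign by either of its darts.\<close>

definition cographic_arrangement :: "('v, 'd::finite) graph \<Rightarrow> (real ^ 'd) set set" where
  "cographic_arrangement G =
     {{v \<in> H1 G. chain_form v (dart_chain G d) = 0} | d.
        d \<in> darts G \<and> (\<exists>v\<in>H1 G. chain_form v (dart_chain G d) \<noteq> 0)}"

text \<open>Closures may be taken in the ambient space because \<open>H1 G\<close> is a linear subspace of it.
  The empty face, which \<open>face_of\<close> admits, is not a cone.\<close>

definition cographic_fan :: "('v, 'd::finite) graph \<Rightarrow> (real ^ 'd) set set" where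
  "cographic_fan G =
     {F. F \<noteq> {} \<and> (\<exists>U \<in> components (H1 G - \<Union>(cographic_arrangement G)). F face_of closure U)}"

definition cone_of :: "('v, 'd::finite) graph \<Rightarrow> 'd set set \<times> ('d set \<Rightarrow> 'd)
    \<Rightarrow> (real ^ 'd) set" where
  "cone_of G = (\<lambda>(T, \<phi>). {v \<in> H1 G.
     (\<forall>e\<in>edges G - T. chain_form v (dart_chain G (\<phi> e)) \<ge> 0) \<and>
     (\<forall>e\<in>T. \<forall>d\<in>e. chain_form v (dart_chain G d) = 0)})"

definition lattice_cone :: "('v, 'd::finite) graph \<Rightarrow> 'd set set \<times> ('d set \<Rightarrow> 'd)
    \<Rightarrow> (int ^ 'd) set" where
  "lattice_cone G i = {c \<in> H1 G. to_real c \<in> cone_of G i}"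


section \<open>Algebras over a field\<close>

text \<open>The base field is a type of class \<^class>\<open>field\<close>; algebras over it are records of type
  \<^typ>\<open>('k, 'a) module\<close>.\<close>

definition alg_hom :: "('k::field, 'a) module \<Rightarrow> ('k, 'b) module \<Rightarrow> ('a \<Rightarrow> 'b) set" where
  "alg_hom A B = {h \<in> ring_hom A B.
     \<forall>r. \<forall>x\<in>carrier A. h (r \<odot>\<^bsub>A\<^esub> x) = r \<odot>\<^bsub>B\<^esub> h x}"

definition alg_iso :: "('k::field, 'a) module \<Rightarrow> ('k, 'b) module \<Rightarrow> ('a \<Rightarrow> 'b) set" where
  "alg_iso A B = {h \<in> alg_hom A B. bij_betw h (carrier A) (carrier B)}"

definition quotient_algebra :: "('k::field, 'a) module \<Rightarrow> 'a set \<Rightarrow> ('k, 'a set) module" where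
  "quotient_algebra A I =
     ring.extend (A Quot I) (module.fields (\<lambda>r X. \<Union>x\<in>X. I +>\<^bsub>A\<^esub> (r \<odot>\<^bsub>A\<^esub> x)))"

text \<open>The inverse limit of the algebras \<open>A i\<close> over the index set \<open>J\<close> ordered by \<open>below\<close>, along the maps
  \<open>\<rho> j i\<close> from \<open>A j\<close> to \<open>A i\<close> for \<open>below i j\<close>: compatible families with pointwise operations.\<close>

definition inverse_limit :: "'i set \<Rightarrow> ('i \<Rightarrow> 'i \<Rightarrow> bool) \<Rightarrow> ('i \<Rightarrow> ('k::field, 'a) module)
    \<Rightarrow> ('i \<Rightarrow> 'i \<Rightarrow> 'a \<Rightarrow> 'a) \<Rightarrow> ('k, 'i \<Rightarrow> 'a) module" where
  "inverse_limit J below A \<rho> = \<lparr>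
     carrier = {x \<in> (\<Pi>\<^sub>E i\<in>J. carrier (A i)). \<forall>i\<in>J. \<forall>j\<in>J. below i j \<longrightarrow> \<rho> j i (x j) = x i},
     mult = (\<lambda>x y. \<lambda>i\<in>J. x i \<otimes>\<^bsub>A i\<^esub> y i),
     one = (\<lambda>i\<in>J. \<one>\<^bsub>A i\<^esub>),
     zero = (\<lambda>i\<in>J. \<zero>\<^bsub>A i\<^esub>),
     add = (\<lambda>x y. \<lambda>i\<in>J. x i \<oplus>\<^bsub>A i\<^esub> y i),
     smult = (\<lambda>r x. \<lambda>i\<in>J. r \<odot>\<^bsub>A i\<^esub> x i)\<rparr>"

definition ideal_sum :: "('k::field, 'a) module \<Rightarrow> 'i set \<Rightarrow> ('i \<Rightarrow> 'a set) \<Rightarrow> 'a set" where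
  "ideal_sum A J I = {finsum A x J | x. \<forall>i\<in>J. x i \<in> I i}"

definition poly_algebra :: "'x set \<Rightarrow> ('k::field, ('x \<Rightarrow>\<^sub>0 nat) \<Rightarrow>\<^sub>0 'k) module" where
  "poly_algebra S = \<lparr>
     carrier = {p. \<forall>m\<in>Poly_Mapping.keys p. Poly_Mapping.keys m \<subseteq> S},
     mult = (*), one = 1, zero = 0, add = (+),
     smult = (\<lambda>r. Poly_Mapping.map ((*) r))\<rparr>"

definition Var :: "'x \<Rightarrow> ('x \<Rightarrow>\<^sub>0 nat) \<Rightarrow>\<^sub>0 'k::field" where
  "Var x = Poly_Mapping.single (Poly_Mapping.single x 1) 1"

text \<open>The algebra homomorphism from a polynomial algebra to \<open>A\<close> with \<open>Var x \<mapsto> f x\<close>.\<close>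

definition poly_eval :: "('k::field, 'a) module \<Rightarrow> ('x \<Rightarrow> 'a)
    \<Rightarrow> (('x \<Rightarrow>\<^sub>0 nat) \<Rightarrow>\<^sub>0 'k) \<Rightarrow> 'a" where
  "poly_eval A f p = (\<Oplus>\<^bsub>A\<^esub>m\<in>Poly_Mapping.keys p. Poly_Mapping.lookup p m \<odot>\<^bsub>A\<^esub>
     (\<Otimes>\<^bsub>A\<^esub>x\<in>Poly_Mapping.keys m. f x [^]\<^bsub>A\<^esub> Poly_Mapping.lookup m x))"


section \<open>The cographic ring and the affine semigroup rings\<close>

definition Xpow :: "int ^ 'd::finite \<Rightarrow> (int ^ 'd) \<Rightarrow>\<^sub>0 'k::field" where
  "Xpow c = Poly_Mapping.single c 1"

definition common_cone :: "('v, 'd::finite) graph \<Rightarrow> int ^ 'd \<Rightarrow> int ^ 'd \<Rightarrow> bool" where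
  "common_cone G c c' \<longleftrightarrow> (\<exists>\<sigma>\<in>cographic_fan G. to_real c \<in> \<sigma> \<and> to_real c' \<in> \<sigma>)"

definition cographic_ring :: "('v, 'd::finite) graph \<Rightarrow> ('k::field, (int ^ 'd) \<Rightarrow>\<^sub>0 'k) module" where
  "cographic_ring G = \<lparr>
     carrier = {p. Poly_Mapping.keys p \<subseteq> H1 G},
     mult = (\<lambda>p q. \<Sum>c\<in>Poly_Mapping.keys p. \<Sum>c'\<in>Poly_Mapping.keys q.
        if common_cone G c c'
        then Poly_Mapping.single (c + c') (Poly_Mapping.lookup p c * Poly_Mapping.lookup q c')
        else 0),
     one = Xpow 0, zero = 0, add = (+),
     smult = (\<lambda>r. Poly_Mapping.map ((*) r))\<rparr>"

text \<open>The product of the type is convolution, i.e. \<open>Xpow c * Xpow c' = Xpow (c + c')\<close>.\<close>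

definition semigroup_ring :: "('v, 'd::finite) graph \<Rightarrow> 'd set set \<times> ('d set \<Rightarrow> 'd)
    \<Rightarrow> ('k::field, (int ^ 'd) \<Rightarrow>\<^sub>0 'k) module" where
  "semigroup_ring G i = \<lparr>
     carrier = {p. Poly_Mapping.keys p \<subseteq> lattice_cone G i},
     mult = (*), one = 1, zero = 0, add = (+),
     smult = (\<lambda>r. Poly_Mapping.map ((*) r))\<rparr>"

text \<open>The linear map fixing \<open>Xpow c\<close> for \<open>c\<close> in the cone of \<open>i\<close> and killing the other monomials;
  it serves for the projections from the cographic ring and from the semigroup rings alike.\<close>

definition cone_proj :: "('v, 'd::finite) graph \<Rightarrow> 'd set set \<times> ('d set \<Rightarrow> 'd)
    \<Rightarrow> ((int ^ 'd) \<Rightarrow>\<^sub>0 'k::field) \<Rightarrow> (int ^ 'd) \<Rightarrow>\<^sub>0 'k" where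
  "cone_proj G i p =
     (\<Sum>c | c \<in> Poly_Mapping.keys p \<and> to_real c \<in> cone_of G i.
        Poly_Mapping.single c (Poly_Mapping.lookup p c))"

definition toric_ideal :: "('v, 'd::finite) graph \<Rightarrow> 'd set set \<times> ('d set \<Rightarrow> 'd)
    \<Rightarrow> ((('v, 'd) circuit \<Rightarrow>\<^sub>0 nat) \<Rightarrow>\<^sub>0 'k::field) set" where
  "toric_ideal G i =
     a_kernel (poly_algebra (Cir_of G i)) (semigroup_ring G i)
       (poly_eval (semigroup_ring G i) (\<lambda>\<gamma>. Xpow (circuit_class \<gamma>)))"

definition discordant_ideal :: "('v, 'd::finite) graph
    \<Rightarrow> ((('v, 'd) circuit \<Rightarrow>\<^sub>0 nat) \<Rightarrow>\<^sub>0 'k::field) set" where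
  "discordant_ideal G = genideal (poly_algebra (Cir G))
     {Var \<gamma> * Var \<gamma>' | \<gamma> \<gamma>'. \<gamma> \<in> Cir G \<and> \<gamma>' \<in> Cir G \<and> \<not> concordant \<gamma> \<gamma>'}"

text \<open>The sum of the ideals of the polynomial algebra on all oriented circuits that are generated
  by the toric ideals with index in \<open>J\<close>.\<close>

definition toric_ideal_sum :: "('v, 'd::finite) graph \<Rightarrow> ('d set set \<times> ('d set \<Rightarrow> 'd)) set
    \<Rightarrow> ((('v, 'd) circuit \<Rightarrow>\<^sub>0 nat) \<Rightarrow>\<^sub>0 'k::field) set" where
  "toric_ideal_sum G J = ideal_sum (poly_algebra (Cir G)) J
     (\<lambda>i. genideal (poly_algebra (Cir G)) (toric_ideal G i))"

end

theory Submission
  imports Defs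
begin

text \<open>
  A circulation is determined by its signs up to the position inside an open cone of the fan, so
  everything reduces to sets of darts: two lattice points share a cone of the cographic fan iff no
  dart is positive on one and negative on the other, and a point lies in \<open>\<sigma>(T, \<phi>)\<close> iff the darts
  on which it is positive are among those chosen by \<open>\<phi>\<close>. The signs of a circulation always give a
  totally cyclic orientation off its zero set; this yields a smallest index containing the point,
  and, after a generic perturbation, one whose \<open>T\<close> consists of the separating edges.

  Hence the projections of \<open>R(\<Gamma>)\<close> to the semigroup rings are multiplicative and jointly injective,
  and the coefficient of \<open>X\<^sup>c\<close> in an element of the limit can be read off at the smallest index of
  \<open>c\<close>. Surjectivity from the polynomial ring holds because every lattice point is a sum of circuits
  contained in its positive darts: follow positive darts until they close up, and subtract.
\<close>

section \<open>Edges, deletion and components\<close>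

text \<open>The fan is defined topologically, by closures of connected components and their faces,
  but the product of \<open>cographic_ring\<close> only asks whether two points share a cone.
  \<open>common_cone_iff\<close> removes the topology once; afterwards only \<open>pos_darts\<close>
  and \<open>oriented_darts\<close> are compared. Positive darts suffice because chains are
  antisymmetric: a negative coefficient is a positive one at the flipped dart. The main obstacle is
  that sharing a cone and pairwise concordance are not conditions on each factor separately, so
  neither associativity of the product nor multiplicativity of the evaluation can be read off. Both
  are checked after projection to each cone, where the condition does split. Separating edges enter
  because an edge separates exactly when every real circulation vanishes on it. The clauses defining
  a circuit (connected, no separating edge, first Betti number 1) are matched with directed cycles
  by \<open>circuit_of_cycle\<close> and \<open>circuit_class_H1_subgraph\<close>. Both formulas for
  the kernel are instances of one lemma about families of indices whose cones cover the
  lattice.\<close>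

lemma finite_graphD:
  assumes "finite_graph G" "d \<in> darts G"
  shows "flip G d \<in> darts G" "flip G d \<noteq> d" "flip G (flip G d) = d"
    "src G d \<in> verts G" "tgt G d \<in> verts G" "tgt G (flip G d) = src G d" "src G (flip G d) = tgt G d"
  using assms unfolding finite_graph_def by metis+

lemma edge_of_dart: "d \<in> darts G \<Longrightarrow> {d, flip G d} \<in> edges G"
  by (auto simp: edges_def)

lemma edgeD:
  assumes "finite_graph G" "e \<in> edges G" "d \<in> e"
  shows "e = {d, flip G d}" "d \<in> darts G" "flip G d \<in> e"
  using assms by (auto simp: edges_def finite_graph_def)

lemma orientations_memD: "\<phi> \<in> orientations G \<Longrightarrow> e \<in> edges G \<Longrightarrow> \<phi> e \<in> e"
  by (auto simp: orientations_def)

text \<open>Each edge contributes exactly one of its two darts, so a dart in the image names its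
  edge and excludes its flip. This is what allows an orientation to be replaced by its set of
  darts.\<close>

lemma orientation_image_flip:
  assumes "finite_graph G" "\<phi> \<in> orientations G" "d \<in> \<phi> ` edges G"
  shows "d \<in> darts G" "\<phi> {d, flip G d} = d" "flip G d \<notin> \<phi> ` edges G"
proof -
  obtain e where e: "e \<in> edges G" "d = \<phi> e" using assms(3) by auto
  have de: "d \<in> e" using orientations_memD[OF assms(2) e(1)] e by auto
  show d: "d \<in> darts G" using edgeD[OF assms(1) e(1) de] by auto
  have e': "e = {d, flip G d}" using edgeD[OF assms(1) e(1) de] by auto
  show "\<phi> {d, flip G d} = d" using e(2) e' by simp
  show "flip G d \<notin> \<phi> ` edges G"
  proof
    assume "flip G d \<in> \<phi> ` edges G"
    then obtain f where f: "f \<in> edges G" "flip G d = \<phi> f" by auto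
    have "flip G d \<in> f" using orientations_memD[OF assms(2) f(1)] f by auto
    then have "f = {flip G d, flip G (flip G d)}" using edgeD[OF assms(1) f(1)] by auto
    then have "f = e" using e' finite_graphD[OF assms(1) d] by auto
    then show False using f e finite_graphD[OF assms(1) d] by auto
  qed
qed

lemma
  assumes "finite_graph G" "T \<subseteq> edges G"
  shows darts_delete: "darts (delete_edges G T) = {d \<in> darts G. {d, flip G d} \<notin> T}"
    and finite_graph_delete: "finite_graph (delete_edges G T)"
    and edges_delete: "edges (delete_edges G T) = edges G - T"
proof -
  have mem: "d \<in> \<Union>T \<longleftrightarrow> {d, flip G d} \<in> T" for d
  proof
    assume "d \<in> \<Union>T"
    then obtain e where e: "e \<in> T" "d \<in> e" by auto
    then have "e = {d, flip G d}" using edgeD(1)[OF assms(1), of e d] assms(2) by auto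
    with e show "{d, flip G d} \<in> T" by simp
  qed auto
  show d: "darts (delete_edges G T) = {d \<in> darts G. {d, flip G d} \<notin> T}"
    using mem by (auto simp: delete_edges_def)
  have "{flip G d, d} = {d, flip G d}" for d by auto
  then show "finite_graph (delete_edges G T)"
    unfolding finite_graph_def d using assms(1)
    by (auto simp: finite_graph_def delete_edges_def)
  have flip: "flip (delete_edges G T) = flip G" by (simp add: delete_edges_def)
  show "edges (delete_edges G T) = edges G - T"
    unfolding edges_def d flip by auto
qed

abbreviation adj :: "('v, 'd) graph \<Rightarrow> ('v \<times> 'v) set" where
  "adj G \<equiv> {(src G d, tgt G d) | d. d \<in> darts G}"

lemma equiv_reachable:
  assumes "finite_graph G"
  shows "equiv (verts G) (reachable G)"
proof -
  have "sym (adj G)"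
  proof (rule symI)
    fix u v assume "(u, v) \<in> adj G"
    then obtain d where "d \<in> darts G" "u = src G d" "v = tgt G d" by auto
    then have "flip G d \<in> darts G" "v = src G (flip G d)" "u = tgt G (flip G d)"
      using finite_graphD[OF assms, of d] by simp_all
    then show "(v, u) \<in> adj G" by blast
  qed
  then have "sym ((adj G)\<^sup>*)" by (rule sym_rtrancl)
  then show ?thesis
    by (auto simp: equiv_def reachable_def refl_on_def sym_def trans_def)
qed

lemma component_subset: "W \<in> graph_components G \<Longrightarrow> W \<subseteq> verts G"
  by (auto simp: graph_components_def quotient_def reachable_def)

lemma component_closed:
  assumes G: "finite_graph G" and W: "W \<in> graph_components G" and d: "d \<in> darts G"
  shows "src G d \<in> W \<longleftrightarrow> tgt G d \<in> W"
proof -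
  have "(src G d, tgt G d) \<in> adj G" using d by blast
  then have "(src G d, tgt G d) \<in> reachable G"
    using finite_graphD[OF G d] unfolding reachable_def by blast
  then show ?thesis
    using W in_quotient_imp_closed[OF equiv_reachable[OF G]] equiv_reachable[OF G]
    unfolding graph_components_def by (meson equivE symD)
qed

text \<open>A reachability path never leaves a set closed under outgoing darts. Connectivity is
  needed in this form because the cut and cycle arguments produce closed sets rather than
  paths.\<close>

lemma component_minimal:
  assumes G: "finite_graph G" and W: "W \<in> graph_components G" and X: "X \<subseteq> W" "X \<noteq> {}"
    and closed: "\<And>d. d \<in> darts G \<Longrightarrow> src G d \<in> X \<Longrightarrow> tgt G d \<in> X"
  shows "X = W"
proof -
  obtain u where u: "u \<in> X" using X by auto
  have "v \<in> X" if "v \<in> W" for v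
  proof -
    have "(u, v) \<in> reachable G"
      using in_quotient_imp_in_rel[OF equiv_reachable[OF G]] W u X that
      unfolding graph_components_def by blast
    then have "(u, v) \<in> (adj G)\<^sup>*" by (simp add: reachable_def)
    then show ?thesis by induction (use u closed in auto)
  qed
  with X show ?thesis by auto
qed

lemma connected_graphD:
  assumes G: "finite_graph G" and "connected_graph G"
  shows "graph_components G = {verts G}" "verts G \<noteq> {}"
proof -
  obtain W where W: "graph_components G = {W}"
    using assms(2) unfolding connected_graph_def by (auto simp: card_1_singleton_iff)
  have "\<Union>(graph_components G) = verts G"
    unfolding graph_components_def by (rule Union_quotient[OF equiv_reachable[OF G]])
  then have *: "W = verts G" using W by auto
  with W show "graph_components G = {verts G}" by auto
  have "W \<noteq> {}" using W in_quotient_imp_non_empty[OF equiv_reachable[OF G]]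
    unfolding graph_components_def by blast
  then show "verts G \<noteq> {}" using * by auto
qed

text \<open>A component is itself closed under darts, so \<open>min\<close> forces it to be the
  whole vertex set; \<open>ne\<close> provides at least one component.\<close>

lemma connected_graphI:
  assumes G: "finite_graph G" and ne: "verts G \<noteq> {}"
    and min: "\<And>X. X \<subseteq> verts G \<Longrightarrow> X \<noteq> {} \<Longrightarrow>
      (\<And>d. d \<in> darts G \<Longrightarrow> src G d \<in> X \<Longrightarrow> tgt G d \<in> X) \<Longrightarrow> X = verts G"
  shows "connected_graph G"
proof -
  have "W = verts G" if W: "W \<in> graph_components G" for W
    using min[OF component_subset[OF W]] component_closed[OF G W]
      in_quotient_imp_non_empty[OF equiv_reachable[OF G]] W
    unfolding graph_components_def by blast
  moreover have "graph_components G \<noteq> {}"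
    using ne unfolding graph_components_def by auto
  ultimately have "graph_components G = {verts G}" by blast
  then show ?thesis by (simp add: connected_graph_def)
qed


section \<open>Circulations\<close>

lemma chainsD:
  assumes "c \<in> chains G"
  shows "d \<in> darts G \<Longrightarrow> c $ flip G d = - (c $ d)" "d \<notin> darts G \<Longrightarrow> c $ d = 0"
  using assms by (auto simp: chains_def)

lemma H1_chains: "c \<in> H1 G \<Longrightarrow> c \<in> chains G"
  by (simp add: H1_def)

lemma chains_add: "a \<in> chains G \<Longrightarrow> b \<in> chains G \<Longrightarrow> a + b \<in> chains G"
  by (auto simp: chains_def)

lemma sum_in_chains: "(\<And>i. i \<in> A \<Longrightarrow> f i \<in> chains G) \<Longrightarrow> sum f A \<in> chains G"
  by (induction A rule: infinite_finite_induct) (auto intro: chains_add simp: chains_def)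

lemma boundary_add: "boundary G (a + b) v = boundary G a v + boundary G b v"
  by (simp add: boundary_def sum.distrib)

lemma boundary_minus: "boundary G (a - b) v = boundary G a v - boundary G b v"
  by (simp add: boundary_def sum_subtractf)

lemma H1_0 [simp]: "0 \<in> H1 G"
  by (auto simp: H1_def chains_def boundary_def)

lemma H1_add: "a \<in> H1 G \<Longrightarrow> b \<in> H1 G \<Longrightarrow> a + b \<in> H1 G"
  by (auto simp: H1_def chains_add boundary_add)

lemma H1_minus: "a \<in> H1 G \<Longrightarrow> b \<in> H1 G \<Longrightarrow> a - b \<in> H1 G"
  by (auto simp: H1_def boundary_minus) (auto simp: chains_def)

lemma H1_sum: "(\<And>i. i \<in> A \<Longrightarrow> f i \<in> H1 G) \<Longrightarrow> sum f A \<in> H1 G"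
  by (induction A rule: infinite_finite_induct) (auto intro: H1_add)

lemma H1_scale: "a \<in> H1 G \<Longrightarrow> r *s a \<in> H1 G"
  by (auto simp: H1_def chains_def boundary_def simp flip: sum_distrib_left)

lemma subspace_H1: "subspace (H1 G :: (real ^ 'd::finite) set)"
  by (auto simp: subspace_def H1_add H1_scale simp flip: scalar_mult_eq_scaleR)

lemma to_real_H1 [simp]: "to_real c \<in> H1 G \<longleftrightarrow> c \<in> H1 G"
proof -
  have "boundary G (to_real c) v = of_int (boundary G c v)" for v
    by (simp add: boundary_def to_real_def)
  moreover have "to_real c \<in> chains G \<longleftrightarrow> c \<in> chains G"
  proof -
    have "real_of_int a = - real_of_int b \<longleftrightarrow> a = - b" for a b by linarith
    then show ?thesis unfolding chains_def to_real_def by simp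
  qed
  ultimately show ?thesis by (simp add: H1_def)
qed

lemma to_real_nth [simp]: "to_real c $ d = of_int (c $ d)"
  by (simp add: to_real_def)

text \<open>Summing the boundary over \<open>X\<close>, the darts inside \<open>X\<close> cancel in pairs.\<close>

lemma circulation_cut:
  fixes c :: "'a::linordered_idom ^ 'd::finite"
  assumes G: "finite_graph G" and c: "c \<in> H1 G" and X: "X \<subseteq> verts G"
  shows "(\<Sum>d | d \<in> darts G \<and> tgt G d \<in> X \<and> src G d \<notin> X. c $ d) = 0"
proof -
  let ?A = "{d \<in> darts G. tgt G d \<in> X \<and> src G d \<in> X}"
  let ?B = "{d \<in> darts G. tgt G d \<in> X \<and> src G d \<notin> X}"
  have fin: "finite X" using X G by (auto simp: finite_graph_def intro: finite_subset)
  have "bij_betw (flip G) ?A ?A"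
    by (rule bij_betw_byWitness[where f' = "flip G"]) (use finite_graphD[OF G] in auto)
  then have "(\<Sum>d\<in>?A. c $ d) = (\<Sum>d\<in>?A. c $ flip G d)"
    by (rule sum.reindex_bij_betw[symmetric])
  also have "\<dots> = - (\<Sum>d\<in>?A. c $ d)"
    by (simp add: chainsD[OF H1_chains[OF c]] sum_negf)
  finally have A: "(\<Sum>d\<in>?A. c $ d) = 0" by simp
  have "0 = (\<Sum>v\<in>X. boundary G c v)"
    using c X by (subst sum.neutral) (auto simp: H1_def)
  also have "\<dots> = (\<Sum>v\<in>X. \<Sum>d | d \<in> {d \<in> darts G. tgt G d \<in> X} \<and> tgt G d = v. c $ d)"
    unfolding boundary_def by (intro sum.cong refl) auto
  also have "\<dots> = (\<Sum>d | d \<in> darts G \<and> tgt G d \<in> X. c $ d)"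
    by (rule sum.group) (use fin in auto)
  also have "{d. d \<in> darts G \<and> tgt G d \<in> X} = ?A \<union> ?B" by auto
  also have "(\<Sum>d\<in>?A \<union> ?B. c $ d) = (\<Sum>d\<in>?A. c $ d) + (\<Sum>d\<in>?B. c $ d)"
    by (rule sum.union_disjoint) auto
  finally show ?thesis using A by simp
qed

text \<open>Across a directed cut all flow would go one way, while the net flow of a circulation
  into any vertex set is zero. So no dart crosses the cut at all, and the set is a whole
  component.\<close>

lemma positive_circulation_totally_cyclic:
  fixes c :: "'a::linordered_idom ^ 'd::finite"
  assumes G: "finite_graph G" and c: "c \<in> H1 G" and phi: "\<phi> \<in> orientations G"
    and pos: "\<And>e. e \<in> edges G \<Longrightarrow> c $ \<phi> e > 0"
  shows "totally_cyclic G \<phi>"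
  unfolding totally_cyclic_def
proof (intro conjI ballI phi)
  fix W assume W: "W \<in> graph_components G"
  let ?I = "induced_subgraph G W"
  show "no_directed_cut ?I (restrict \<phi> (edges ?I))"
    unfolding no_directed_cut_def
  proof (intro notI, elim exE conjE)
    fix X assume ne: "X \<noteq> {}" and XW: "X \<subset> verts ?I"
      and cut: "\<forall>e\<in>edges ?I. (\<exists>d\<in>e. src ?I d \<in> X \<and> tgt ?I d \<in> verts ?I - X) \<longrightarrow>
        src ?I (restrict \<phi> (edges ?I) e) \<in> X \<and> tgt ?I (restrict \<phi> (edges ?I) e) \<in> verts ?I - X"
    have XW': "X \<subset> W" using XW by (simp add: induced_subgraph_def)
    let ?B = "{d \<in> darts G. tgt G d \<in> X \<and> src G d \<notin> X}"
    \<comment> \<open>A dart of \<open>?B\<close> enters \<open>X\<close>, so its flip leaves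
      \<open>X\<close>; by the cut hypothesis \<open>\<phi>\<close> picks the flip, where
      \<open>c\<close> is positive.\<close>
    have neg: "c $ d < 0" if d: "d \<in> ?B" for d
    proof -
      note fd = finite_graphD[OF G, of d]
      have dW: "d \<in> darts G" "tgt G d \<in> W" "src G d \<in> W - X"
        using d XW' component_closed[OF G W, of d] by auto
      let ?e = "{d, flip G d}"
      have e: "?e \<in> edges ?I" "?e \<in> edges G"
        using dW by (auto simp: edges_def induced_subgraph_def)
      have "\<exists>f\<in>?e. src ?I f \<in> X \<and> tgt ?I f \<in> verts ?I - X"
        by (rule bexI[of _ "flip G d"]) (use d dW fd in \<open>auto simp: induced_subgraph_def\<close>)
      then have "src G (\<phi> ?e) \<in> X" using cut e by (auto simp: induced_subgraph_def)
      then have "\<phi> ?e = flip G d" using orientations_memD[OF phi e(2)] d by auto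
      then show ?thesis using pos[OF e(2)] chainsD(1)[OF H1_chains[OF c] dW(1)] by simp
    qed
    have "(\<Sum>d\<in>?B. c $ d) = 0"
      by (rule circulation_cut[OF G c]) (use XW' component_subset[OF W] in auto)
    then have "(\<Sum>d\<in>?B. - (c $ d)) = 0" by (simp add: sum_negf)
    moreover have "?B \<noteq> {} \<Longrightarrow> (\<Sum>d\<in>?B. - (c $ d)) > 0"
      by (rule sum_pos) (use neg in auto)
    ultimately have "?B = {}" by (metis less_irrefl)
    then have "tgt G d \<in> X" if "d \<in> darts G" "src G d \<in> X" for d
      using finite_graphD[OF G that(1)] that(2) by force
    then have "X = W"
      using component_minimal[OF G W] XW' ne by blast
    with XW' show False by simp
  qed
qed

section \<open>Separating edges\<close>

text \<open>Telescoping sum of the dart chains along the path. Keeping the support inside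
  \<open>F\<close> makes a path that avoids an edge give a chain that vanishes on it;
  \<open>F\<close> is closed under flips because \<open>dart_chain\<close> also has a coefficient at
  the flip.\<close>

lemma path_chain:
  fixes u v :: 'v and G :: "('v, 'd::finite) graph"
  assumes G: "finite_graph G" and F: "F \<subseteq> darts G" "\<And>d. d \<in> F \<Longrightarrow> flip G d \<in> F"
    and path: "(u, v) \<in> {(src G d, tgt G d) | d. d \<in> F}\<^sup>*"
  shows "\<exists>c :: 'a::comm_ring_1 ^ 'd. c \<in> chains G \<and> (\<forall>d. d \<notin> F \<longrightarrow> c $ d = 0) \<and>
    (\<forall>w. boundary G c w = of_bool (w = v) - of_bool (w = u))"
  using path
proof induction
  case base
  show ?case by (rule exI[of _ 0]) (simp add: chains_def boundary_def)
next
  case (step v v')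
  then obtain c :: "'a ^ 'd" and d where c: "c \<in> chains G" "\<forall>d. d \<notin> F \<longrightarrow> c $ d = 0"
    "\<forall>w. boundary G c w = of_bool (w = v) - of_bool (w = u)"
    and d: "d \<in> F" "v = src G d" "v' = tgt G d" by blast
  have dG: "d \<in> darts G" using d F by auto
  have "(dart_chain G d :: 'a ^ 'd) \<in> chains G" by (rule dart_chain_in_chains[OF G dG])
  moreover have "(dart_chain G d :: 'a ^ 'd) $ f = 0" if "f \<notin> F" for f
    using that d F by (auto simp: dart_chain_def axis_def)
  ultimately show ?case
    using c d F
    by (intro exI[of _ "c + dart_chain G d"])
      (auto simp: chains_add boundary_add boundary_dart_chain[OF G dG])
qed

text \<open>If the ends of the edge remain joined after its deletion, a path between them closes up
  with the edge to a circulation that is nonzero there. Otherwise the edge is the only one across a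
  cut, and zero net flow forces its coefficient to vanish.\<close>

lemma separating_edge_iff:
  fixes G :: "('v, 'd::finite) graph"
  assumes G: "finite_graph G" and d: "d \<in> darts G"
  shows "{d, flip G d} \<in> separating_edges G \<longleftrightarrow> (\<forall>x \<in> H1 G :: (real ^ 'd) set. x $ d = 0)"
proof -
  let ?e = "{d, flip G d}"
  let ?G' = "delete_edges G {?e}"
  have sub: "{?e} \<subseteq> edges G" using edge_of_dart[OF d] by simp
  have G': "finite_graph ?G'" by (rule finite_graph_delete[OF G sub])
  have vG': "verts ?G' = verts G" and maps: "src ?G' = src G" "tgt ?G' = tgt G"
    by (simp_all add: delete_edges_def)
  have dG': "darts ?G' = darts G - ?e" by (simp add: delete_edges_def)
  have adj_sub: "adj ?G' \<subseteq> adj G" unfolding maps dG' by blast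
  note fd = finite_graphD[OF G d]
  note E = equiv_reachable[OF G] and E' = equiv_reachable[OF G', unfolded vG']
  show ?thesis
  proof (cases "(src G d, tgt G d) \<in> (adj ?G')\<^sup>*")
    case True
    have "adj G \<subseteq> (adj ?G')\<^sup>*"
    proof clarify
      fix f assume f: "f \<in> darts G"
      consider "f \<in> darts ?G'" | "f = d" | "f = flip G d" using f dG' by blast
      then show "(src G f, tgt G f) \<in> (adj ?G')\<^sup>*"
      proof cases
        case 1
        then have "(src G f, tgt G f) \<in> adj ?G'" unfolding maps by blast
        then show ?thesis by (rule r_into_rtrancl)
      next
        case 3
        have "(src G d, tgt G d) \<in> reachable ?G'"
          using True fd by (simp add: reachable_def vG')
        then have "(tgt G d, src G d) \<in> reachable ?G'" using E' by (meson equivE symD)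
        then show ?thesis using 3 fd by (simp add: reachable_def)
      qed (use True in simp)
    qed
    then have "(adj ?G')\<^sup>* = (adj G)\<^sup>*"
      by (rule rtrancl_subset[OF adj_sub, symmetric])
    then have "reachable ?G' = reachable G" by (simp add: reachable_def vG')
    then have "?e \<notin> separating_edges G"
      by (simp add: separating_edges_def graph_components_def vG')
    moreover have "\<exists>x \<in> H1 G :: (real ^ 'd) set. x $ d \<noteq> 0"
    proof -
      obtain c :: "real ^ 'd" where c: "c \<in> chains G" "\<forall>f. f \<notin> darts ?G' \<longrightarrow> c $ f = 0"
        "\<forall>w. boundary G c w = of_bool (w = tgt G d) - of_bool (w = src G d)"
        using path_chain[OF G, of "darts ?G'" "src G d" "tgt G d", where 'a = real] True
          finite_graphD(1)[OF G'] unfolding maps dG' by (auto simp: delete_edges_def)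
      have "c - dart_chain G d \<in> chains G"
        using c(1) dart_chain_in_chains[OF G d] by (auto simp: chains_def)
      then have "c - dart_chain G d \<in> H1 G"
        using c(3) by (simp add: H1_def boundary_minus boundary_dart_chain[OF G d])
      moreover have "(c - dart_chain G d) $ d = - 1"
        using c(2) fd by (simp add: dG' dart_chain_def axis_def)
      ultimately show ?thesis by force
    qed
    ultimately show ?thesis by blast
  next
    case False
    have "x $ d = 0" if x: "x \<in> H1 G" for x :: "real ^ 'd"
    proof -
      \<comment> \<open>The component of the source of \<open>d\<close> after the deletion:
        \<open>flip G d\<close> is the only dart of \<open>G\<close> that enters it.\<close>
      let ?X = "{v \<in> verts G. (src G d, v) \<in> (adj ?G')\<^sup>*}"
      have "{f. f \<in> darts G \<and> tgt G f \<in> ?X \<and> src G f \<notin> ?X} = {flip G d}"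
      proof (intro equalityI subsetI)
        fix f assume f: "f \<in> {f. f \<in> darts G \<and> tgt G f \<in> ?X \<and> src G f \<notin> ?X}"
        then have ff: "f \<in> darts G" by auto
        have "f \<notin> darts ?G'"
        proof
          assume "f \<in> darts ?G'"
          then have g: "flip G f \<in> darts ?G'"
            using finite_graphD(1)[OF G'] by (simp add: delete_edges_def)
          have "(src G (flip G f), tgt G (flip G f)) \<in> adj ?G'" unfolding maps using g by blast
          then have "(tgt G f, src G f) \<in> adj ?G'" using finite_graphD[OF G ff] by simp
          moreover have "(src G d, tgt G f) \<in> (adj ?G')\<^sup>*" using f by simp
          ultimately have "(src G d, src G f) \<in> (adj ?G')\<^sup>*" by (rule rtrancl_into_rtrancl[rotated])
          then show False using f finite_graphD[OF G ff] by simp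
        qed
        then have "f = d \<or> f = flip G d" using ff dG' by blast
        then show "f \<in> {flip G d}" using f False by auto
      qed (use fd False in auto)
      then have "x $ flip G d = 0"
        using circulation_cut[OF G x, of ?X] by simp
      then show ?thesis using chainsD(1)[OF H1_chains[OF x] d] by simp
    qed
    moreover have "?e \<in> separating_edges G"
    proof -
      \<comment> \<open>\<open>?f\<close> sends a component of the smaller graph to the component of
        \<open>G\<close> that contains it. It is onto and identifies the components of the two ends
        of \<open>d\<close>, so the deletion strictly increases the number of components.\<close>
      let ?f = "\<lambda>W. reachable G `` W"
      have rsub: "reachable ?G' \<subseteq> reachable G"
        using rtrancl_mono[OF adj_sub] by (auto simp: reachable_def vG')
      have cls: "?f (reachable ?G' `` {v}) = reachable G `` {v}" if "v \<in> verts G" for v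
      proof -
        have "v \<in> reachable ?G' `` {v}" by (rule equiv_class_self[OF E' that])
        moreover have "trans (reachable G)" using E by (simp add: equiv_def)
        ultimately show ?thesis using rsub by (auto dest: transD)
      qed
      have img: "?f ` graph_components ?G' = graph_components G"
        unfolding graph_components_def vG' quotient_def using cls by auto
      have fin: "finite (graph_components ?G')"
        unfolding graph_components_def vG' quotient_def
        using G by (simp add: finite_graph_def)
      let ?s = "reachable ?G' `` {src G d}" and ?t = "reachable ?G' `` {tgt G d}"
      have st: "?s \<in> graph_components ?G'" "?t \<in> graph_components ?G'"
        unfolding graph_components_def vG' using fd by (auto intro: quotientI)
      have "(src G d, tgt G d) \<in> adj G" using d by blast
      then have "(src G d, tgt G d) \<in> reachable G" using fd unfolding reachable_def by blast
      then have "?f ?s = ?f ?t"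
        using cls fd E by (simp add: equiv_class_eq)
      moreover have "?s \<noteq> ?t"
      proof
        assume "?s = ?t"
        then have "(src G d, tgt G d) \<in> reachable ?G'"
          using eq_equiv_class[OF _ E'] fd by metis
        with False show False by (simp add: reachable_def)
      qed
      ultimately have "\<not> inj_on ?f (graph_components ?G')"
        using st by (meson inj_onD)
      then have "card (?f ` graph_components ?G') < card (graph_components ?G')"
        using fin card_image_le[OF fin, of ?f] eq_card_imp_inj_on[OF fin, of ?f] by linarith
      then show ?thesis
        using img sub by (simp add: separating_edges_def)
    qed
    ultimately show ?thesis by blast
  qed
qed

section \<open>Circuits\<close>

text \<open>A minimal non-empty set of vertices closed under the successor map is a directed cycle.\<close>

lemma directed_cycle_exists:
  fixes G :: "('v, 'd::finite) graph"
  assumes G: "finite_graph G" and P: "P \<subseteq> darts G" "P \<noteq> {}"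
    and out: "\<And>d. d \<in> P \<Longrightarrow> \<exists>d'\<in>P. src G d' = tgt G d"
  obtains W nx where "W \<noteq> {}" "W \<subseteq> verts G" "\<And>v. v \<in> W \<Longrightarrow> nx v \<in> P \<and> src G (nx v) = v"
    "(\<lambda>v. tgt G (nx v)) ` W = W"
    "\<And>X. X \<subseteq> W \<Longrightarrow> X \<noteq> {} \<Longrightarrow> (\<And>v. v \<in> X \<Longrightarrow> tgt G (nx v) \<in> X) \<Longrightarrow> X = W"
proof -
  have "\<exists>d. v \<in> tgt G ` P \<longrightarrow> d \<in> P \<and> src G d = v" for v
    using out by blast
  then obtain nx where nx: "\<And>v. v \<in> tgt G ` P \<Longrightarrow> nx v \<in> P \<and> src G (nx v) = v"
    by metis
  define closed where "closed X \<longleftrightarrow> X \<subseteq> tgt G ` P \<and> X \<noteq> {} \<and> (\<forall>v\<in>X. tgt G (nx v) \<in> X)" for X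
  have "closed (tgt G ` P)" using P nx by (auto simp: closed_def)
  moreover have "finite {X. closed X}"
    by (rule finite_subset[of _ "Pow (tgt G ` P)"]) (auto simp: closed_def)
  ultimately obtain W where W: "closed W" and min: "\<And>X. closed X \<Longrightarrow> X \<subseteq> W \<Longrightarrow> X = W"
    using finite_has_minimal2[of "{X. closed X}" "tgt G ` P"] by (metis mem_Collect_eq)
  show ?thesis
  proof (rule that[of W nx])
    show "W \<noteq> {}" using W by (simp add: closed_def)
    show "W \<subseteq> verts G" using W P finite_graphD(5)[OF G] unfolding closed_def by blast
    show "nx v \<in> P \<and> src G (nx v) = v" if "v \<in> W" for v
      using that nx W by (auto simp: closed_def)
    \<comment> \<open>The image of \<open>W\<close> is again closed, so minimality makes the
      successor map onto; on a finite set it is then a permutation.\<close>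
    show "(\<lambda>v. tgt G (nx v)) ` W = W"
      by (rule min) (use W in \<open>auto simp: closed_def\<close>)
    show "X = W" if "X \<subseteq> W" "X \<noteq> {}" "\<And>v. v \<in> X \<Longrightarrow> tgt G (nx v) \<in> X" for X
      using that W by (intro min) (auto simp: closed_def)
  qed
qed

text \<open>No cancellation occurs, because \<open>A\<close> never contains both darts of an edge.
  The test \<open>f \<in> darts G\<close> guards against the arbitrary values of \<open>flip\<close>
  outside the carrier.\<close>

lemma sum_dart_chain_nth:
  assumes G: "finite_graph G" and A: "A \<subseteq> darts G" and flip: "\<forall>d\<in>A. flip G d \<notin> A"
  shows "(\<Sum>d\<in>A. dart_chain G d) $ f = (if f \<in> A then 1 else if flip G f \<in> A \<and> f \<in> darts G then - 1 else 0)"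
proof -
  have fin: "finite A" by simp
  have "(\<Sum>d\<in>A. dart_chain G d) $ f =
    (\<Sum>d\<in>A. (if d = f then 1 else 0) - (if flip G d = f then 1 else 0))"
    by (auto simp: dart_chain_def axis_def intro!: sum.cong)
  also have "\<dots> = (if f \<in> A then 1 else 0) - (\<Sum>d\<in>A. if flip G d = f then 1 else 0)"
    by (simp add: sum_subtractf)
  also have "(\<Sum>d\<in>A. if flip G d = f then 1 else 0) =
      (\<Sum>d\<in>A. if d = flip G f \<and> f \<in> darts G then 1 else 0)"
    using finite_graphD[OF G] A by (intro sum.cong refl) (metis subsetD)
  also have "\<dots> = (if flip G f \<in> A \<and> f \<in> darts G then 1 else 0)"
    by (cases "f \<in> darts G") simp_all
  finally show ?thesis using flip finite_graphD[OF G] by auto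
qed

text \<open>The successor map is onto a finite set, hence injective: every vertex of
  \<open>W\<close> is left once and entered once, and the two contributions to the boundary
  cancel.\<close>

lemma circulation_of_cycle:
  fixes G :: "('v, 'd::finite) graph"
  assumes G: "finite_graph G" and W: "W \<subseteq> verts G"
    and nx: "\<And>v. v \<in> W \<Longrightarrow> nx v \<in> darts G \<and> src G (nx v) = v"
    and perm: "(\<lambda>v. tgt G (nx v)) ` W = W"
  shows "(\<Sum>d\<in>nx ` W. dart_chain G d :: 'a::comm_ring_1 ^ 'd) \<in> H1 G" (is "?z \<in> _")
proof -
  have fin: "finite W" using W G by (auto simp: finite_graph_def intro: finite_subset)
  have inj: "inj_on nx W" by (rule inj_on_inverseI[of _ "src G"]) (use nx in auto)
  have injp: "inj_on (\<lambda>v. tgt G (nx v)) W"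
    using perm fin by (simp add: finite_surj_inj)
  have "?z \<in> chains G"
    by (rule sum_in_chains) (use nx dart_chain_in_chains[OF G] in auto)
  moreover have "boundary G ?z w = 0" for w
  proof -
    have "boundary G ?z w = (\<Sum>d\<in>nx ` W. boundary G (dart_chain G d) w)"
      unfolding boundary_def sum_component by (rule sum.swap)
    also have "\<dots> = (\<Sum>v\<in>W. boundary G (dart_chain G (nx v)) w)"
      by (simp add: sum.reindex[OF inj])
    also have "\<dots> = (\<Sum>v\<in>W. of_bool (w = tgt G (nx v))) - (\<Sum>v\<in>W. of_bool (w = v))"
      by (simp add: boundary_dart_chain[OF G] nx sum_subtractf)
    also have "(\<Sum>v\<in>W. of_bool (w = v)) =
        (\<Sum>v\<in>(\<lambda>v. tgt G (nx v)) ` W. of_bool (w = v))" by (simp only: perm)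
    also have "\<dots> = (\<Sum>v\<in>W. of_bool (w = tgt G (nx v)))"
      by (simp add: sum.reindex[OF injp])
    finally show ?thesis by simp
  qed
  ultimately show ?thesis by (simp add: H1_def)
qed

lemma dart_chain_cong: "flip D = flip G \<Longrightarrow> dart_chain D = dart_chain G"
  by (simp add: dart_chain_def fun_eq_iff)

text \<open>The clauses of the definition of a circuit come from the indicator circulation
  \<open>?z\<close> of the cycle and from minimality. As \<open>?z\<close> is nonzero on every dart,
  no edge separates; as it is positive on the chosen darts, the orientation is totally cyclic;
  minimality gives connectedness and makes every other circulation a multiple of \<open>?z\<close>.
  The hypothesis on \<open>\<phi>\<close> excludes a cycle that runs back along one of its own
  edges.\<close>

lemma circuit_of_cycle:
  fixes G :: "('v, 'd::finite) graph"
  assumes G: "finite_graph G" and W: "W \<subseteq> verts G" "W \<noteq> {}"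
    and nx: "\<And>v. v \<in> W \<Longrightarrow> nx v \<in> darts G \<and> src G (nx v) = v"
    and perm: "(\<lambda>v. tgt G (nx v)) ` W = W"
    and min: "\<And>X. X \<subseteq> W \<Longrightarrow> X \<noteq> {} \<Longrightarrow> (\<And>v. v \<in> X \<Longrightarrow> tgt G (nx v) \<in> X) \<Longrightarrow> X = W"
    and phi: "\<And>d. d \<in> nx ` W \<Longrightarrow> \<phi> {d, flip G d} = d"
  obtains D where "(D, restrict \<phi> (edges D)) \<in> Cir G" "darts D = nx ` W \<union> flip G ` nx ` W"
    "circuit_class (D, restrict \<phi> (edges D)) = (\<Sum>d\<in>nx ` W. dart_chain G d)"
proof -
  let ?A = "nx ` W"
  define D where "D = G\<lparr>verts := W, darts := ?A \<union> flip G ` ?A\<rparr>"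
  define \<psi> where "\<psi> = restrict \<phi> (edges D)"
  have D [simp]: "verts D = W" "darts D = ?A \<union> flip G ` ?A" "flip D = flip G" "src D = src G"
    "tgt D = tgt G" by (simp_all add: D_def)
  have AG: "?A \<subseteq> darts G" using nx by auto
  have tW: "tgt G (nx v) \<in> W" if "v \<in> W" for v using perm that by auto
  have flipA: "flip G d \<notin> ?A" if d: "d \<in> ?A" for d
  proof
    assume "flip G d \<in> ?A"
    then have "\<phi> {flip G d, flip G (flip G d)} = flip G d" by (rule phi)
    moreover have "{flip G d, flip G (flip G d)} = {d, flip G d}"
      using finite_graphD(3)[OF G] AG d by auto
    moreover have "flip G d \<noteq> d" using finite_graphD(2)[OF G] AG d by blast
    ultimately show False using phi[OF d] by simp
  qed
  have fgD: "finite_graph D"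
    unfolding finite_graph_def D
  proof (intro conjI ballI)
    show "finite W" using W G by (auto simp: finite_graph_def intro: finite_subset)
    fix d assume d: "d \<in> ?A \<union> flip G ` ?A"
    then have dG: "d \<in> darts G" using AG finite_graphD(1)[OF G] by auto
    note f = finite_graphD[OF G dG]
    show "flip G d \<in> ?A \<union> flip G ` ?A" using d AG finite_graphD(3)[OF G] by auto
    show "flip G d \<noteq> d" "flip G (flip G d) = d" "src G d = tgt G (flip G d)" using f by auto
    show "src G d \<in> W" "tgt G d \<in> W"
      using d nx tW AG finite_graphD(6,7)[OF G] by auto
  qed
  have sub: "subgraph D G"
    using fgD W AG finite_graphD(1)[OF G] by (auto simp: subgraph_def)
  let ?z = "\<Sum>d\<in>?A. dart_chain G d :: real ^ 'd"
  have dc: "dart_chain D = (dart_chain G :: 'd \<Rightarrow> 'a::comm_ring_1 ^ 'd)" by (rule dart_chain_cong) simp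
  have z: "?z \<in> H1 D"
    using circulation_of_cycle[OF fgD, of W nx] nx perm by (simp add: dc)
  have AD: "?A \<subseteq> darts D" by auto
  have znth: "?z $ f = (if f \<in> ?A then 1 else if flip G f \<in> ?A \<and> f \<in> darts D then - 1 else 0)" for f
  proof -
    have "\<forall>d\<in>?A. flip D d \<notin> ?A" using flipA by simp
    note nth = sum_dart_chain_nth[OF fgD AD this, of f]
    show ?thesis using nth by (simp only: dc D(3))
  qed
  have znz: "?z $ f \<noteq> 0" if "f \<in> darts D" for f
    unfolding znth using that finite_graphD(3)[OF fgD that] finite_graphD(3)[OF G] AG by auto
  have eD: "\<exists>d\<in>?A. e = {d, flip G d}" if e: "e \<in> edges D" for e
  proof -
    obtain d where d: "d \<in> darts D" "e = {d, flip G d}" using e by (auto simp: edges_def)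
    show ?thesis
    proof (cases "d \<in> ?A")
      case False
      then obtain a where "a \<in> ?A" "d = flip G a" using d by auto
      then show ?thesis using d AG finite_graphD(3)[OF G] by (intro bexI[of _ a]) auto
    qed (use d in auto)
  qed
  have psiA: "\<psi> {d, flip G d} = d" if "d \<in> ?A" for d
    using phi[OF that] edge_of_dart[of d D] that unfolding \<psi>_def by (simp add: image_def)
  have psi: "\<psi> \<in> orientations D"
    unfolding orientations_def
  proof (rule PiE_I)
    fix e assume "e \<in> edges D"
    from eD[OF this] psiA show "\<psi> e \<in> e" by fastforce
  qed (simp add: \<psi>_def)
  have psi_image: "\<psi> ` edges D = ?A"
  proof (intro equalityI subsetI)
    fix d assume "d \<in> \<psi> ` edges D"
    then show "d \<in> ?A" using eD psiA by fastforce
  next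
    fix d assume d: "d \<in> ?A"
    then have "{d, flip D d} \<in> edges D" by (intro edge_of_dart) auto
    then show "d \<in> \<psi> ` edges D" using psiA[OF d] by (metis D(3) imageI)
  qed
  have tc: "totally_cyclic D \<psi>"
    by (rule positive_circulation_totally_cyclic[OF fgD z psi]) (use psi_image znth in auto)
  have conn: "connected_graph D"
  proof (rule connected_graphI[OF fgD])
    fix X assume X: "X \<subseteq> verts D" "X \<noteq> {}"
      and cl: "\<And>d. d \<in> darts D \<Longrightarrow> src D d \<in> X \<Longrightarrow> tgt D d \<in> X"
    have "X = W"
    proof (rule min)
      fix v assume "v \<in> X"
      then show "tgt G (nx v) \<in> X" using cl[of "nx v"] X nx by auto
    qed (use X in auto)
    then show "X = verts D" by simp
  qed (use W in simp)
  have sep: "separating_edges D = {}"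
  proof (rule ccontr)
    assume "separating_edges D \<noteq> {}"
    then obtain e where e: "e \<in> separating_edges D" by auto
    then obtain d where d: "d \<in> darts D" "e = {d, flip D d}"
      by (auto simp: separating_edges_def edges_def)
    then show False using e separating_edge_iff[OF fgD d(1)] z znz by blast
  qed
  have "H1 D \<subseteq> span {?z}"
  proof
    fix x :: "real ^ 'd" assume x: "x \<in> H1 D"
    obtain v0 where v0: "v0 \<in> W" using W by auto
    \<comment> \<open>Exactly two darts of \<open>D\<close> end at the successor of
      \<open>v\<close>: the one by which the cycle arrives and the flip of the one by which it
      leaves. Zero boundary there equates the coefficients of consecutive darts.\<close>
    have step: "x $ nx v = x $ nx (tgt G (nx v))" if v: "v \<in> W" for v
    proof -
      let ?w = "tgt G (nx v)"
      have injp: "inj_on (\<lambda>v. tgt G (nx v)) W"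
        using perm fgD by (simp add: finite_surj_inj finite_graph_def)
      have "{d \<in> darts D. tgt D d = ?w} = {nx v, flip G (nx ?w)}"
      proof (intro equalityI subsetI)
        fix d assume d: "d \<in> {d \<in> darts D. tgt D d = ?w}"
        show "d \<in> {nx v, flip G (nx ?w)}"
        proof (cases "d \<in> ?A")
          case True
          then obtain v' where v': "v' \<in> W" "d = nx v'" by auto
          have "v' = v" by (rule inj_onD[OF injp]) (use d v v' in auto)
          then show ?thesis using v' by simp
        next
          case False
          then obtain v' where v': "v' \<in> W" "d = flip G (nx v')" using d by auto
          then have "tgt G d = v'" using nx[of v'] finite_graphD(6)[OF G] by auto
          then show ?thesis using v' d by simp
        qed
      next
        fix d assume "d \<in> {nx v, flip G (nx ?w)}"
        then show "d \<in> {d \<in> darts D. tgt D d = ?w}"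
          using v tW[OF v] nx[OF tW[OF v]] finite_graphD(6)[OF G] by auto
      qed
      then have "boundary D x ?w = (\<Sum>d\<in>{nx v, flip G (nx ?w)}. x $ d)"
        by (simp add: boundary_def)
      moreover have "nx v \<noteq> flip G (nx ?w)" using flipA[of "nx ?w"] tW[OF v] v by (metis imageI)
      moreover have "x $ flip G (nx ?w) = - (x $ nx ?w)"
        using chainsD(1)[OF H1_chains[OF x], of "nx ?w"] tW[OF v] by simp
      moreover have "boundary D x ?w = 0" using x tW[OF v] by (simp add: H1_def)
      ultimately show ?thesis by simp
    qed
    have "{v \<in> W. x $ nx v = x $ nx v0} = W"
      by (rule min) (use v0 step tW in auto)
    then have const: "x $ d = x $ nx v0" if "d \<in> ?A" for d using that by auto
    have "x = (x $ nx v0) *\<^sub>R ?z"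
      unfolding vec_eq_iff
    proof
      fix d
      consider "d \<in> ?A" | "d \<notin> ?A" "d \<in> darts D" | "d \<notin> darts D" by blast
      then show "x $ d = ((x $ nx v0) *\<^sub>R ?z) $ d"
      proof cases
        case 1
        then have "?z $ d = 1" unfolding znth by (rule if_P)
        then show ?thesis using const[OF 1] by simp
      next
        case 2
        then have f: "flip G d \<in> ?A" using finite_graphD(3)[OF G] AG by auto
        have "x $ d = - (x $ flip D d)" using chainsD(1)[OF H1_chains[OF x] 2(2)] by simp
        moreover have "?z $ d = - 1" unfolding znth using 2 f by (simp only: if_False if_True simp_thms)
        ultimately show ?thesis using const[OF f] by simp
      next
        case 3
        then have "?z $ d = 0" unfolding znth using AD by auto
        then show ?thesis using chainsD(2)[OF H1_chains[OF x] 3] by simp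
      qed
    qed
    then show "x \<in> span {?z}" by (metis span_base span_scale insertI1)
  qed
  moreover have "span {?z} \<subseteq> H1 D" using z by (intro span_minimal subspace_H1) simp
  ultimately have "H1 D = span {?z}" by (rule equalityI)
  moreover have "?z \<noteq> 0" using znz W AD by (metis all_not_in_conv image_is_empty subsetD zero_index)
  ultimately have "betti1 D = 1"
    by (simp add: betti1_def dim_insert)
  then have "(D, \<psi>) \<in> Cir G"
    using sub conn sep tc by (simp add: Cir_def cyclic_subgraph_def)
  moreover have "circuit_class (D, \<psi>) = (\<Sum>d\<in>?A. dart_chain G d)"
  proof -
    have "inj_on \<psi> (edges D)"
      by (rule inj_on_inverseI[of _ "\<lambda>d. {d, flip G d}"]) (use eD psiA in fastforce)
    then have "(\<Sum>e\<in>edges D. dart_chain D (\<psi> e) :: int ^ 'd) = (\<Sum>d\<in>\<psi> ` edges D. dart_chain D d)"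
      by (simp add: sum.reindex)
    then show ?thesis by (simp add: circuit_class_def psi_image dc)
  qed
  ultimately show thesis
    using that[of D] unfolding \<psi>_def by simp
qed

text \<open>Chains are indexed by the whole dart type and vanish off the carrier, so extension by
  zero is the identity. The boundary at a vertex outside \<open>D\<close> is zero because no dart of
  \<open>D\<close> ends there.\<close>

lemma H1_subgraph:
  assumes G: "finite_graph G" and "subgraph D G" "c \<in> H1 D"
  shows "c \<in> H1 G"
proof -
  have D: "flip D = flip G" "tgt D = tgt G" "darts D \<subseteq> darts G" "finite_graph D"
    using assms(2) by (auto simp: subgraph_def)
  have c: "c \<in> chains D" using assms(3) by (rule H1_chains)
  have "c $ flip G d = - (c $ d)" if d: "d \<in> darts G" for d
  proof (cases "d \<in> darts D")
    case True
    then show ?thesis using chainsD(1)[OF c] D by metis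
  next
    case False
    then have "flip G d \<notin> darts D"
      using d finite_graphD(1)[OF D(4), of "flip G d"] finite_graphD(3)[OF G d] D(1) by auto
    then show ?thesis using False chainsD(2)[OF c] by simp
  qed
  then have "c \<in> chains G" using chainsD(2)[OF c] D(3) by (auto simp: chains_def)
  moreover have "boundary G c v = 0" for v
  proof -
    have "boundary G c v = (\<Sum>d | d \<in> darts D \<and> tgt D d = v. c $ d)"
      unfolding boundary_def D(2)
      by (rule sum.mono_neutral_right) (use D(3) chainsD(2)[OF c] in auto)
    also have "\<dots> = 0"
    proof (cases "v \<in> verts D")
      case True
      then show ?thesis using assms(3) by (simp add: H1_def boundary_def)
    next
      case False
      then have "{d. d \<in> darts D \<and> tgt D d = v} = {}" using finite_graphD(5)[OF D(4)] by auto
      then show ?thesis by (simp only: sum.empty)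
    qed
    finally show ?thesis .
  qed
  ultimately show ?thesis by (simp add: H1_def)
qed

text \<open>Converse to \<open>circuit_of_cycle\<close>. Total cyclicity lets every chosen dart be
  continued, so the chosen darts contain a directed cycle. As the Betti number is 1, its circulation
  spans \<open>H1 D\<close>; as no edge separates, each chosen dart is nonzero in some circulation
  and therefore lies on the cycle. So the class of the circuit is the circulation of this
  cycle.\<close>

lemma
  fixes G :: "('v, 'd::finite) graph"
  assumes "(D, \<psi>) \<in> Cir G"
  shows circuit_class_eq: "circuit_class (D, \<psi>) = (\<Sum>d\<in>\<psi> ` edges D. dart_chain D d)"
    and circuit_class_H1_subgraph: "circuit_class (D, \<psi>) \<in> H1 D"
proof -
  have sub: "subgraph D G" and conn: "connected_graph D" and sep: "separating_edges D = {}"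
    and b: "betti1 D = 1" and tc: "totally_cyclic D \<psi>"
    using assms by (auto simp: Cir_def cyclic_subgraph_def)
  have D: "finite_graph D" using sub by (simp add: subgraph_def)
  have psi: "\<psi> \<in> orientations D" using tc by (simp add: totally_cyclic_def)
  note dimg = orientation_image_flip[OF D psi]
  let ?P = "\<psi> ` edges D"
  have "inj_on \<psi> (edges D)"
    by (rule inj_on_inverseI[of _ "\<lambda>d. {d, flip D d}"])
      (use edgeD(1)[OF D _ orientations_memD[OF psi]] in blast)
  then show eq: "circuit_class (D, \<psi>) = (\<Sum>d\<in>?P. dart_chain D d)"
    by (simp add: circuit_class_def sum.reindex)
  have P: "?P \<subseteq> darts D" using dimg by auto
  \<comment> \<open>Betti number 1 rules out a single vertex without edges.\<close>
  have "darts D \<noteq> {}"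
  proof
    assume "darts D = {}"
    then have "H1 D \<subseteq> ({0} :: (real ^ 'd) set)" by (auto simp: H1_def chains_def vec_eq_iff)
    then have "betti1 D = 0" unfolding betti1_def by (simp add: dim_eq_0)
    with b show False by simp
  qed
  then have ne: "?P \<noteq> {}" by (auto simp: edges_def)
  have ncut: "no_directed_cut (induced_subgraph D (verts D))
      (restrict \<psi> (edges (induced_subgraph D (verts D))))"
    using tc connected_graphD[OF D conn] by (simp add: totally_cyclic_def)
  have "induced_subgraph D (verts D) = D"
    unfolding induced_subgraph_def using finite_graphD(4,5)[OF D] by (cases D) auto
  then have ncut: "no_directed_cut D (restrict \<psi> (edges D))" using ncut by simp
  have out: "\<exists>d'\<in>?P. src D d' = tgt D d" if d: "d \<in> ?P" for d
  proof (cases "src D d = tgt D d")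
    case False
    \<comment> \<open>The cut towards the single vertex \<open>tgt D d\<close> is not directed, so
      some chosen dart leaves that vertex.\<close>
    let ?X = "verts D - {tgt D d}"
    have X: "?X \<noteq> {}" "?X \<subset> verts D"
      using False finite_graphD(4,5)[OF D] d P by auto
    obtain e f where e: "e \<in> edges D" and f: "f \<in> e" "src D f \<in> ?X" "tgt D f \<in> verts D - ?X"
      and no: "\<not> (src D (\<psi> e) \<in> ?X \<and> tgt D (\<psi> e) \<in> verts D - ?X)"
      using ncut X unfolding no_directed_cut_def by (metis restrict_apply')
    have "\<psi> e \<in> e" by (rule orientations_memD[OF psi e])
    moreover have "e = {f, flip D f}" "f \<in> darts D" using edgeD[OF D e f(1)] by auto
    moreover have "\<psi> e \<noteq> f" using no f by auto
    ultimately have "\<psi> e = flip D f" by auto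
    then have "src D (\<psi> e) = tgt D d"
      using f finite_graphD(7)[OF D \<open>f \<in> darts D\<close>] by auto
    then show ?thesis using e by blast
  qed (use that in blast)
  obtain W nx where W: "W \<noteq> {}" "W \<subseteq> verts D" "\<And>v. v \<in> W \<Longrightarrow> nx v \<in> ?P \<and> src D (nx v) = v"
    "(\<lambda>v. tgt D (nx v)) ` W = W"
    using directed_cycle_exists[OF D P ne out] by metis
  let ?A = "nx ` W"
  have A: "?A \<subseteq> ?P" using W by auto
  have H: "(\<Sum>d\<in>?A. dart_chain D d :: 'a::comm_ring_1 ^ 'd) \<in> H1 D"
    by (rule circulation_of_cycle[OF D W(2) _ W(4)]) (use W(3) P in auto)
  let ?z = "\<Sum>d\<in>?A. dart_chain D d :: real ^ 'd"
  have znth: "?z $ f = (if f \<in> ?A then 1 else if flip D f \<in> ?A \<and> f \<in> darts D then - 1 else 0)" for f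
  proof (rule sum_dart_chain_nth[OF D])
    show "?A \<subseteq> darts D" using A P by blast
    show "\<forall>d\<in>?A. flip D d \<notin> ?A" using dimg(3) A by blast
  qed
  have "?z \<noteq> 0" using znth W(1) by (metis all_not_in_conv image_is_empty zero_index zero_neq_one)
  then have "dim {?z} = 1" by (simp add: dim_insert)
  then have span: "H1 D \<subseteq> span {?z}"
    using dim_eq_span[of "{?z}" "H1 D"] H b span_superset unfolding betti1_def by auto
  have "d \<in> ?A" if d: "d \<in> ?P" for d
  proof -
    have dD: "d \<in> darts D" using d P by auto
    then obtain x :: "real ^ 'd" where x: "x \<in> H1 D" "x $ d \<noteq> 0"
      using separating_edge_iff[OF D dD] sep by auto
    then obtain k where "x = k *\<^sub>R ?z" using span by (auto simp: span_singleton)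
    then have "?z $ d \<noteq> 0" using x(2) by auto
    moreover have "flip D d \<notin> ?A" using dimg(3)[OF d] A by auto
    ultimately show ?thesis unfolding znth by (auto split: if_splits)
  qed
  then have "?A = ?P" using A by auto
  then show "circuit_class (D, \<psi>) \<in> H1 D" using H eq by simp
qed

section \<open>Positive darts and cones\<close>

text \<open>For a circulation this set is the full sign vector, because the darts with negative
  coefficient are the flips of its elements. The coefficient type is general since lattice points
  and real points are compared.\<close>

definition pos_darts :: "'a::linordered_idom ^ 'd \<Rightarrow> 'd set" where
  "pos_darts c = {d. 0 < c $ d}"

text \<open>Encodes an index as a set of darts, to be compared with \<open>pos_darts\<close>. For an
  index in \<open>OP G\<close> nothing is lost: an edge lies in \<open>T\<close> exactly when
  neither of its darts occurs.\<close>

definition oriented_darts :: "('v, 'd) graph \<Rightarrow> 'd set set \<times> ('d set \<Rightarrow> 'd) \<Rightarrow> 'd set" where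
  "oriented_darts G = (\<lambda>(T, \<phi>). \<phi> ` (edges G - T))"

lemma pos_darts_to_real [simp]: "pos_darts (to_real c) = pos_darts c"
  by (simp add: pos_darts_def)

lemma pos_darts_0 [simp]: "pos_darts 0 = {}"
  by (simp add: pos_darts_def)

context
  fixes G :: "('v, 'd::finite) graph"
  assumes G: "finite_graph G"
begin

lemma pos_dartsD:
  assumes "c \<in> chains G" "d \<in> pos_darts c"
  shows "d \<in> darts G" "flip G d \<notin> pos_darts c"
proof -
  show d: "d \<in> darts G" using assms chainsD(2)[OF assms(1), of d] by (auto simp: pos_darts_def)
  show "flip G d \<notin> pos_darts c" using assms chainsD(1)[OF assms(1) d] by (simp add: pos_darts_def)
qed

lemma pos_darts_flip:
  assumes "c \<in> chains G" "d \<in> darts G"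
  shows "flip G d \<in> pos_darts c \<longleftrightarrow> c $ d < 0"
  using chainsD(1)[OF assms] by (simp add: pos_darts_def)

lemma neg_dart:
  assumes "c \<in> chains G" "c $ d < 0"
  shows "d \<in> darts G" "flip G d \<in> pos_darts c"
proof -
  show "d \<in> darts G" using chainsD(2)[OF assms(1), of d] assms(2) by auto
  then show "flip G d \<in> pos_darts c" using pos_darts_flip assms by blast
qed

lemma OP_iff:
  "(T, \<phi>) \<in> OP G \<longleftrightarrow> T \<subseteq> edges G \<and> totally_cyclic (delete_edges G T) \<phi>"
  by (simp add: OP_def)

lemma OP_orientation:
  assumes "(T, \<phi>) \<in> OP G"
  shows "T \<subseteq> edges G" "finite_graph (delete_edges G T)" "\<phi> \<in> orientations (delete_edges G T)"
    "edges (delete_edges G T) = edges G - T"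
  using assms finite_graph_delete[OF G] edges_delete[OF G]
  by (auto simp: OP_iff totally_cyclic_def)

lemma oriented_dartsD:
  assumes "(T, \<phi>) \<in> OP G" "d \<in> oriented_darts G (T, \<phi>)"
  shows "d \<in> darts G" "{d, flip G d} \<in> edges G - T" "\<phi> {d, flip G d} = d"
    "flip G d \<notin> oriented_darts G (T, \<phi>)"
proof -
  note o = OP_orientation[OF assms(1)]
  have f: "flip (delete_edges G T) = flip G" by (simp add: delete_edges_def)
  have d: "d \<in> \<phi> ` edges (delete_edges G T)"
    using assms(2) by (simp add: oriented_darts_def o)
  note od = orientation_image_flip[OF o(2,3) d]
  show "d \<in> darts G" using od(1) by (simp add: delete_edges_def)
  show "{d, flip G d} \<in> edges G - T" using edge_of_dart[OF od(1)] by (simp add: f o)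
  show "\<phi> {d, flip G d} = d" using od(2) by (simp add: f)
  show "flip G d \<notin> oriented_darts G (T, \<phi>)" using od(3) by (simp add: f oriented_darts_def o)
qed

text \<open>A nonnegative coefficient at \<open>\<phi> e\<close> means that the flip of
  \<open>\<phi> e\<close> is not positive, and a zero coefficient on an edge of \<open>T\<close>
  means that neither of its darts is.\<close>

lemma cone_of_iff:
  assumes i: "(T, \<phi>) \<in> OP G" and w: "w \<in> H1 G"
  shows "w \<in> cone_of G (T, \<phi>) \<longleftrightarrow> pos_darts w \<subseteq> oriented_darts G (T, \<phi>)"
proof -
  note o = OP_orientation[OF i] and ch = H1_chains[OF w]
  have phi: "\<phi> e \<in> e" if "e \<in> edges G - T" for e
    using orientations_memD[OF o(3)] that o(4) by auto
  have form: "chain_form w (dart_chain G d) = w $ d" if "d \<in> e" "e \<in> edges G" for d e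
    using chain_form_dart[OF G _ ch] edgeD[OF G that(2,1)] by auto
  have "w \<in> cone_of G (T, \<phi>) \<longleftrightarrow>
      (\<forall>e\<in>edges G - T. w $ \<phi> e \<ge> 0) \<and> (\<forall>e\<in>T. \<forall>d\<in>e. w $ d = 0)"
  proof -
    have "chain_form w (dart_chain G (\<phi> e)) = w $ \<phi> e" if "e \<in> edges G - T" for e
      using form[OF phi[OF that]] that by simp
    moreover have "chain_form w (dart_chain G d) = w $ d" if "e \<in> T" "d \<in> e" for d e
      using form[OF that(2)] that(1) o(1) by blast
    ultimately show ?thesis unfolding cone_of_def using w by simp
  qed
  also have "\<dots> \<longleftrightarrow> pos_darts w \<subseteq> oriented_darts G (T, \<phi>)"
  proof (intro iffI subsetI conjI ballI; (elim conjE)?)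
    fix d assume pos: "\<forall>e\<in>edges G - T. 0 \<le> w $ \<phi> e" "\<forall>e\<in>T. \<forall>d\<in>e. w $ d = 0"
      and d: "d \<in> pos_darts w"
    let ?e = "{d, flip G d}"
    have dG: "d \<in> darts G" using pos_dartsD[OF ch d] by simp
    have "?e \<in> edges G" by (rule edge_of_dart[OF dG])
    moreover have "?e \<notin> T" using pos d by (auto simp: pos_darts_def)
    ultimately have e: "?e \<in> edges G - T" by simp
    moreover have "\<phi> ?e \<noteq> flip G d"
      using bspec[OF pos(1) e] d chainsD(1)[OF ch dG] by (auto simp: pos_darts_def)
    ultimately have "d = \<phi> ?e" using phi[OF e] by auto
    then show "d \<in> oriented_darts G (T, \<phi>)" using e by (auto simp: oriented_darts_def)
  next
    fix e assume sub: "pos_darts w \<subseteq> oriented_darts G (T, \<phi>)" and e: "e \<in> edges G - T"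
    have mem: "\<phi> e \<in> oriented_darts G (T, \<phi>)" using e by (auto simp: oriented_darts_def)
    show "0 \<le> w $ \<phi> e"
    proof (rule ccontr)
      assume "\<not> 0 \<le> w $ \<phi> e"
      then have "flip G (\<phi> e) \<in> pos_darts w" using neg_dart[OF ch] by simp
      then show False using sub oriented_dartsD(4)[OF i mem] by auto
    qed
  next
    fix e d assume sub: "pos_darts w \<subseteq> oriented_darts G (T, \<phi>)" and e: "e \<in> T" and d: "d \<in> e"
    have ed: "e = {d, flip G d}" "d \<in> darts G" using edgeD[OF G _ d] e o(1) by auto
    have "d \<notin> pos_darts w" using sub oriented_dartsD(2)[OF i, of d] e ed by auto
    moreover have "flip G d \<notin> pos_darts w"
      using sub oriented_dartsD(2)[OF i, of "flip G d"] e ed finite_graphD(3)[OF G ed(2)]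
      by (auto simp: insert_commute)
    ultimately show "w $ d = 0"
      using pos_darts_flip[OF ch ed(2)] by (simp add: pos_darts_def)
  qed
  finally show ?thesis .
qed

text \<open>An edge is missing from an index when neither of its darts is chosen, so fewer darts
  mean a larger \<open>T\<close> and a restricted orientation; off the edges, orientations agree by
  extensionality. With \<open>cone_of_iff\<close>, a smaller index has a smaller cone.\<close>

lemma OP_le_iff:
  assumes i: "i \<in> OP G" and j: "j \<in> OP G"
  shows "OP_le G i j \<longleftrightarrow> oriented_darts G i \<subseteq> oriented_darts G j"
proof -
  obtain T \<phi> T' \<phi>' where ij: "i = (T, \<phi>)" "j = (T', \<phi>')" by (metis surj_pair)
  note oi = OP_orientation[OF i[unfolded ij]] and oj = OP_orientation[OF j[unfolded ij]]
  have phi: "\<phi> e \<in> e" if "e \<in> edges G - T" for e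
    using orientations_memD[OF oi(3)] that oi(4) by auto
  show ?thesis
  proof
    assume "OP_le G i j"
    then have "T' \<subseteq> T" "\<phi> = restrict \<phi>' (edges G - T)"
      by (auto simp: OP_le_def ij oi(4))
    then have "\<phi> e = \<phi>' e \<and> e \<in> edges G - T'" if "e \<in> edges G - T" for e using that by auto
    then show "oriented_darts G i \<subseteq> oriented_darts G j"
      by (auto simp: oriented_darts_def ij)
  next
    assume sub: "oriented_darts G i \<subseteq> oriented_darts G j"
    have *: "e \<notin> T' \<and> \<phi> e = \<phi>' e" if e: "e \<in> edges G - T" for e
    proof -
      have "\<phi> e \<in> oriented_darts G j" using sub e by (auto simp: oriented_darts_def ij)
      from oriented_dartsD[OF j[unfolded ij] this[unfolded ij]]
      have "{\<phi> e, flip G (\<phi> e)} \<notin> T'" "\<phi>' {\<phi> e, flip G (\<phi> e)} = \<phi> e" by auto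
      moreover have "e = {\<phi> e, flip G (\<phi> e)}" using edgeD(1)[OF G _ phi[OF e]] e by auto
      ultimately show ?thesis by simp
    qed
    have "\<phi> = restrict \<phi>' (edges G - T)"
    proof
      fix e show "\<phi> e = restrict \<phi>' (edges G - T) e"
        using * oi(3) by (cases "e \<in> edges G - T") (auto simp: orientations_def oi(4) PiE_def extensional_def)
    qed
    then show "OP_le G i j" using * oj(1) by (auto simp: OP_le_def ij oi(4))
  qed
qed

text \<open>After deletion of the edges where \<open>w\<close> vanishes, \<open>w\<close> is still a
  circulation and is positive on the orientation by its signs, so
  \<open>positive_circulation_totally_cyclic\<close> applies.\<close>

lemma sign_index:
  fixes w :: "real ^ 'd"
  assumes w: "w \<in> H1 G"
  obtains \<phi> where "({e \<in> edges G. \<forall>d\<in>e. w $ d = 0}, \<phi>) \<in> OP G"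
    "oriented_darts G ({e \<in> edges G. \<forall>d\<in>e. w $ d = 0}, \<phi>) = pos_darts w"
proof -
  let ?T = "{e \<in> edges G. \<forall>d\<in>e. w $ d = 0}"
  let ?G' = "delete_edges G ?T"
  have T: "?T \<subseteq> edges G" by auto
  have G': "finite_graph ?G'" by (rule finite_graph_delete[OF G T])
  have eG': "edges ?G' = edges G - ?T" by (rule edges_delete[OF G T])
  note ch = H1_chains[OF w]
  define \<phi> where "\<phi> = (\<lambda>e\<in>edges ?G'. SOME d. d \<in> e \<and> d \<in> pos_darts w)"
  have phi: "\<phi> e \<in> e" "\<phi> e \<in> pos_darts w" if e: "e \<in> edges ?G'" for e
  proof -
    have eG: "e \<in> edges G" using e eG' by auto
    then obtain d where d: "d \<in> e" "w $ d \<noteq> 0" using e eG' by auto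
    have "d \<in> pos_darts w \<or> flip G d \<in> pos_darts w"
      using d(2) neg_dart(2)[OF ch, of d] by (cases "0 < w $ d") (auto simp: pos_darts_def)
    then have "\<exists>d. d \<in> e \<and> d \<in> pos_darts w" using d edgeD(3)[OF G eG] by blast
    from someI_ex[OF this] show "\<phi> e \<in> e" "\<phi> e \<in> pos_darts w" using e by (auto simp: \<phi>_def)
  qed
  have or: "\<phi> \<in> orientations ?G'"
    using phi by (auto simp: orientations_def \<phi>_def)
  have dG': "darts ?G' = {d \<in> darts G. {d, flip G d} \<notin> ?T}" by (rule darts_delete[OF G T])
  have maps: "flip ?G' = flip G" "tgt ?G' = tgt G" "verts ?G' = verts G"
    by (simp_all add: delete_edges_def)
  have wz: "w $ d = 0" if "d \<notin> darts ?G'" for d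
  proof (cases "d \<in> darts G")
    case True
    then show ?thesis using that unfolding dG' by auto
  qed (rule chainsD(2)[OF ch])
  have "w \<in> chains ?G'"
    unfolding chains_def maps
  proof (intro CollectI conjI ballI allI impI wz)
    show "w $ flip G d = - (w $ d)" if "d \<in> darts ?G'" for d
      using that unfolding dG' by (intro chainsD(1)[OF ch]) simp
  qed
  moreover have "boundary ?G' w v = boundary G w v" for v
    unfolding boundary_def maps
  proof (rule sum.mono_neutral_left)
    show "{d \<in> darts ?G'. tgt G d = v} \<subseteq> {d \<in> darts G. tgt G d = v}" unfolding dG' by blast
  qed (use wz in auto)
  ultimately have w': "w \<in> H1 ?G'" using w by (simp add: H1_def maps)
  have "totally_cyclic ?G' \<phi>"
    by (rule positive_circulation_totally_cyclic[OF G' w' or])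
      (use phi in \<open>auto simp: pos_darts_def\<close>)
  then have i: "(?T, \<phi>) \<in> OP G" by (simp add: OP_iff)
  have "oriented_darts G (?T, \<phi>) \<subseteq> pos_darts w"
    using phi unfolding oriented_darts_def eG' by auto
  moreover have "pos_darts w \<subseteq> oriented_darts G (?T, \<phi>)"
  proof -
    have "w $ \<phi> e \<ge> 0" if "e \<in> edges G - ?T" for e
      using phi(2)[of e] that eG' by (auto simp: pos_darts_def)
    moreover have form: "chain_form w (dart_chain G d) = w $ d" if "d \<in> e" "e \<in> edges G" for d e
      using chain_form_dart[OF G _ ch] edgeD[OF G that(2,1)] by auto
    moreover have "chain_form w (dart_chain G (\<phi> e)) = w $ \<phi> e" if "e \<in> edges G - ?T" for e
      using form[OF phi(1)[of e]] that eG' by blast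
    ultimately have "w \<in> cone_of G (?T, \<phi>)"
      using w unfolding cone_of_def by simp
    then show ?thesis using cone_of_iff[OF i w] by simp
  qed
  ultimately show ?thesis using that i by blast
qed

section \<open>The cographic fan\<close>

text \<open>The darts whose coordinate hyperplanes form the arrangement; by
  \<open>separating_edge_iff\<close>, the darts of the nonseparating edges.\<close>

definition live :: "'d \<Rightarrow> bool" where
  "live d \<longleftrightarrow> d \<in> darts G \<and> (\<exists>x \<in> H1 G :: (real ^ 'd) set. x $ d \<noteq> 0)"

lemma liveI: "(x :: real ^ 'd) \<in> H1 G \<Longrightarrow> x $ d \<noteq> 0 \<Longrightarrow> live d"
  using chainsD(2)[OF H1_chains, of x G d] by (auto simp: live_def)

text \<open>One dart at a time: where a live coefficient vanishes, add a small multiple of a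
  circulation that does not vanish there. Strict positivity survives a small change, and tracking
  positive darts is enough, since a negative coefficient is a positive one at the flip.\<close>

lemma generic_perturbation:
  fixes w :: "real ^ 'd"
  assumes w: "w \<in> H1 G"
  shows "\<exists>w' \<in> H1 G :: (real ^ 'd) set. pos_darts w \<subseteq> pos_darts w' \<and> (\<forall>d. live d \<longrightarrow> w' $ d \<noteq> 0)"
proof -
  have "\<exists>w' \<in> H1 G :: (real ^ 'd) set. pos_darts w \<subseteq> pos_darts w' \<and> (\<forall>d\<in>L. live d \<longrightarrow> w' $ d \<noteq> 0)"
    if "finite L" for L
    using that
  proof induction
    case empty
    then show ?case using w by auto
  next
    case (insert d L)
    then obtain w' :: "real ^ 'd" where w': "w' \<in> H1 G" "pos_darts w \<subseteq> pos_darts w'"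
      "\<forall>d\<in>L. live d \<longrightarrow> w' $ d \<noteq> 0" by auto
    show ?case
    proof (cases "live d \<and> w' $ d = 0")
      case False
      then show ?thesis using w' by auto
    next
      case True
      then obtain x :: "real ^ 'd" where x: "x \<in> H1 G" "x $ d \<noteq> 0" by (auto simp: live_def)
      have "eventually (\<lambda>\<epsilon>. 0 < w' $ f \<longrightarrow> 0 < w' $ f + \<epsilon> * x $ f) (at_right 0)" for f
      proof (cases "0 < w' $ f")
        case True
        have "((\<lambda>\<epsilon>. w' $ f + \<epsilon> * x $ f) \<longlongrightarrow> w' $ f + 0 * x $ f) (at_right 0)"
          by (intro tendsto_intros)
        then show ?thesis using True
          by (auto dest: order_tendstoD(1)[where a = 0] elim: eventually_mono)
      qed simp
      \<comment> \<open>A single \<open>\<epsilon>\<close> serves all darts because their type is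
        finite.\<close>
      then have "eventually (\<lambda>\<epsilon>. \<forall>f. 0 < w' $ f \<longrightarrow> 0 < w' $ f + \<epsilon> * x $ f) (at_right 0)"
        by (rule eventually_all_finite)
      moreover have "eventually (\<lambda>\<epsilon>::real. 0 < \<epsilon>) (at_right 0)"
        by (rule eventually_at_right_less)
      ultimately have "eventually (\<lambda>\<epsilon>. 0 < \<epsilon> \<and> (\<forall>f. 0 < w' $ f \<longrightarrow> 0 < w' $ f + \<epsilon> * x $ f)) (at_right 0)"
        by eventually_elim auto
      then obtain \<epsilon> :: real where eps: "0 < \<epsilon>" "\<forall>f. 0 < w' $ f \<longrightarrow> 0 < w' $ f + \<epsilon> * x $ f"
        using eventually_happens'[OF trivial_limit_at_right_real, of _ "0 :: real"] by blast
      let ?w = "w' + \<epsilon> *s x"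
      have H: "?w \<in> H1 G" by (intro H1_add H1_scale w' x)
      have sub: "pos_darts w' \<subseteq> pos_darts ?w" using eps by (auto simp: pos_darts_def)
      have "?w $ f \<noteq> 0" if "f \<in> insert d L" "live f" for f
      proof (cases "w' $ f = 0")
        case True
        then have "f = d" using that w' by auto
        then show ?thesis using True x eps by simp
      next
        case False
        then have "f \<in> pos_darts w' \<or> flip G f \<in> pos_darts w'" and f: "f \<in> darts G"
          using neg_dart(2)[OF H1_chains[OF w'(1)], of f] that
          by (cases "0 < w' $ f"; auto simp: pos_darts_def live_def)+
        then show ?thesis using sub pos_darts_flip[OF H1_chains[OF H] f] by (auto simp: pos_darts_def)
      qed
      then show ?thesis using H sub w' by (intro bexI[of _ ?w]) auto
    qed
  qed
  from this[of UNIV] show ?thesis by auto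
qed

text \<open>A point off all hyperplanes vanishes exactly on the edges where every circulation
  vanishes, and these are the separating ones.\<close>

lemma separating_index:
  fixes c :: "int ^ 'd"
  assumes c: "c \<in> H1 G"
  obtains \<phi> where "(separating_edges G, \<phi>) \<in> OP G"
    "pos_darts c \<subseteq> oriented_darts G (separating_edges G, \<phi>)"
proof -
  have "to_real c \<in> H1 G" using c by simp
  then obtain w :: "real ^ 'd" where w: "w \<in> H1 G" "pos_darts (to_real c) \<subseteq> pos_darts w"
    "\<forall>d. live d \<longrightarrow> w $ d \<noteq> 0"
    using generic_perturbation by blast
  have "{e \<in> edges G. \<forall>d\<in>e. w $ d = 0} = separating_edges G"
  proof (intro equalityI subsetI)
    fix e assume e: "e \<in> {e \<in> edges G. \<forall>d\<in>e. w $ d = 0}"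
    then obtain d where d: "d \<in> darts G" "e = {d, flip G d}" by (auto simp: edges_def)
    then have "\<not> live d" using w(3) e by auto
    then show "e \<in> separating_edges G"
      using separating_edge_iff[OF G d(1)] d by (auto simp: live_def)
  next
    fix e assume e: "e \<in> separating_edges G"
    then obtain d where d: "d \<in> darts G" "e = {d, flip G d}" by (auto simp: edges_def separating_edges_def)
    then have "w $ d = 0" using separating_edge_iff[OF G d(1)] e w(1) by auto
    then show "e \<in> {e \<in> edges G. \<forall>d\<in>e. w $ d = 0}"
      using d edge_of_dart[OF d(1)] chainsD(1)[OF H1_chains[OF w(1)] d(1)] by auto
  qed
  with sign_index[OF w(1)] w(2) that show ?thesis by (metis pos_darts_to_real)
qed

text \<open>For \<open>w\<close> off all hyperplanes this is the connected component of \<open>w\<close>, by \<open>chamber_component\<close>.\<close>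

definition chamber :: "real ^ 'd \<Rightarrow> (real ^ 'd) set" where
  "chamber w = {v \<in> H1 G. \<forall>d. live d \<longrightarrow> 0 < v $ d * w $ d}"

lemma off_arrangement:
  "H1 G - \<Union>(cographic_arrangement G) = {v \<in> H1 G. \<forall>d. live d \<longrightarrow> v $ d \<noteq> 0}"
proof -
  have form: "chain_form v (dart_chain G d) = v $ d" if "d \<in> darts G" "v \<in> H1 G" for v d
    using chain_form_dart[OF G that(1) H1_chains[OF that(2)]] .
  have "\<Union>(cographic_arrangement G) = {v \<in> H1 G. \<exists>d. live d \<and> v $ d = 0}"
  proof (intro equalityI subsetI)
    fix v :: "real ^ 'd" assume "v \<in> \<Union>(cographic_arrangement G)"
    then obtain d x where "d \<in> darts G" "v \<in> H1 G" "chain_form v (dart_chain G d) = 0"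
      "x \<in> H1 G" "chain_form x (dart_chain G d) \<noteq> 0"
      unfolding cographic_arrangement_def by blast
    then show "v \<in> {v \<in> H1 G. \<exists>d. live d \<and> v $ d = 0}"
      using form unfolding live_def by auto
  next
    fix v :: "real ^ 'd" assume "v \<in> {v \<in> H1 G. \<exists>d. live d \<and> v $ d = 0}"
    then obtain d and x :: "real ^ 'd" where
      d: "d \<in> darts G" "v \<in> H1 G" "v $ d = 0" "x \<in> H1 G" "x $ d \<noteq> 0"
      unfolding live_def by auto
    then have "chain_form v (dart_chain G d) = 0" "\<exists>x\<in>H1 G. chain_form x (dart_chain G d) \<noteq> 0"
      using form by auto
    with d(1,2) show "v \<in> \<Union>(cographic_arrangement G)"
      unfolding cographic_arrangement_def by blast
  qed
  then show ?thesis by auto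
qed

lemma convex_chamber: "convex (chamber w)"
proof (rule convexI)
  fix x y :: "real ^ 'd" and u v :: real
  assume xy: "x \<in> chamber w" "y \<in> chamber w" and uv: "0 \<le> u" "0 \<le> v" "u + v = 1"
  have "u *\<^sub>R x + v *\<^sub>R y \<in> H1 G"
    using xy subspace_H1[of G] by (auto simp: chamber_def intro: subspace_add subspace_scale)
  moreover have "0 < (u *\<^sub>R x + v *\<^sub>R y) $ d * w $ d" if "live d" for d
  proof -
    have p: "0 < x $ d * w $ d" "0 < y $ d * w $ d" using xy that by (auto simp: chamber_def)
    have "0 < u * (x $ d * w $ d) + v * (y $ d * w $ d)"
    proof (cases "u = 0")
      case True
      then show ?thesis using p uv by simp
    next
      case False
      then have "0 < u * (x $ d * w $ d)" using p(1) uv by (metis mult_pos_pos order_less_le)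
      moreover have "0 \<le> v * (y $ d * w $ d)" using p(2) uv by (metis mult_nonneg_nonneg less_imp_le)
      ultimately show ?thesis by linarith
    qed
    then show ?thesis by (simp add: algebra_simps)
  qed
  ultimately show "u *\<^sub>R x + v *\<^sub>R y \<in> chamber w" by (simp add: chamber_def)
qed

text \<open>A chamber is convex, hence connected. Conversely, the product of the coordinates at
  \<open>d\<close> of a point and of \<open>w\<close> is continuous and has no zero on the
  component, so it keeps the sign it has at \<open>w\<close>.\<close>

lemma chamber_component:
  assumes w: "w \<in> {v \<in> H1 G. \<forall>d. live d \<longrightarrow> v $ d \<noteq> 0}" (is "_ \<in> ?S")
  shows "connected_component_set ?S w = chamber w"
proof
  have wc: "w \<in> chamber w" using w by (auto simp: chamber_def) (metis not_real_square_gt_zero)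
  have sub: "chamber w \<subseteq> ?S" by (auto simp: chamber_def)
  show "chamber w \<subseteq> connected_component_set ?S w"
    by (rule connected_component_maximal[OF wc convex_connected[OF convex_chamber] sub])
  show "connected_component_set ?S w \<subseteq> chamber w"
  proof
    fix x assume x: "x \<in> connected_component_set ?S w"
    let ?C = "connected_component_set ?S w"
    have CS: "?C \<subseteq> ?S" by (rule connected_component_subset)
    have wC: "w \<in> ?C" using w by (simp add: connected_component_refl_eq)
    have "0 < x $ d * w $ d" if d: "live d" for d
    proof (rule ccontr)
      assume n: "\<not> 0 < x $ d * w $ d"
      let ?f = "\<lambda>v :: real ^ 'd. v $ d * w $ d"
      have "connected (?f ` ?C)"
        by (intro connected_continuous_image connected_connected_component continuous_intros)
      moreover have "?f x \<in> ?f ` ?C" "?f w \<in> ?f ` ?C" using x wC by blast+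
      moreover have "?f x \<le> 0" "0 \<le> ?f w" using n by auto
      ultimately have "0 \<in> ?f ` ?C" by (rule connectedD_interval)
      then obtain v where "v \<in> ?C" "v $ d * w $ d = 0" by auto
      then show False using CS d w by auto
    qed
    then show "x \<in> chamber w" using x CS by (auto simp: chamber_def)
  qed
qed

text \<open>On the closure of a chamber, and hence on its faces, no coordinate takes both signs.
  Conversely, if \<open>c\<close> and \<open>c'\<close> have no opposite signs, a generic
  \<open>w\<close> that extends the signs of \<open>c + c'\<close> agrees weakly with both, so both
  lie in the closure of its chamber, which is a face of itself.\<close>

lemma common_cone_iff:
  fixes c c' :: "int ^ 'd"
  assumes c: "c \<in> H1 G" "c' \<in> H1 G"
  shows "common_cone G c c' \<longleftrightarrow> (\<forall>d\<in>pos_darts c. flip G d \<notin> pos_darts c')"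
proof
  assume "common_cone G c c'"
  then obtain F U where F: "F face_of closure U"
    and U: "U \<in> components (H1 G - \<Union>(cographic_arrangement G))"
    and cF: "to_real c \<in> F" "to_real c' \<in> F"
    unfolding common_cone_def cographic_fan_def by blast
  obtain w where w: "w \<in> {v \<in> H1 G. \<forall>d. live d \<longrightarrow> v $ d \<noteq> 0}" and Uw: "U = chamber w"
    using U chamber_component unfolding off_arrangement components_def by auto
  have sgn: "0 \<le> x $ d * w $ d" if x: "x \<in> F" and d: "live d" for x d
  proof -
    have "closure U \<subseteq> {v. 0 \<le> v $ d * w $ d}"
    proof (rule closure_minimal)
      show "U \<subseteq> {v. 0 \<le> v $ d * w $ d}"
        using d unfolding Uw chamber_def by (auto intro: order.strict_implies_order)
      show "closed {v. 0 \<le> v $ d * w $ d}" by (intro closed_Collect_le continuous_intros)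
    qed
    then show ?thesis using x face_of_imp_subset[OF F] by auto
  qed
  show "\<forall>d\<in>pos_darts c. flip G d \<notin> pos_darts c'"
  proof (intro ballI notI)
    fix d assume d: "d \<in> pos_darts c" and f: "flip G d \<in> pos_darts c'"
    have dG: "d \<in> darts G" using pos_dartsD[OF H1_chains[OF c(1)] d] by simp
    have p: "0 < c $ d" "c' $ d < 0"
      using d f pos_darts_flip[OF H1_chains[OF c(2)] dG] by (auto simp: pos_darts_def)
    have l: "live d" by (rule liveI[of "to_real c"]) (use c p in auto)
    then have "w $ d \<noteq> 0" using w by auto
    then show False
      using sgn[OF cF(1) l] sgn[OF cF(2) l] p by (auto simp: zero_le_mult_iff)
  qed
next
  assume conf: "\<forall>d\<in>pos_darts c. flip G d \<notin> pos_darts c'"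
  have dir: "0 \<le> b $ d" if a: "a \<in> H1 G" and b: "b \<in> H1 G" and d: "0 < a $ d"
      and ab: "\<forall>d\<in>pos_darts a. flip G d \<notin> pos_darts b" for a b :: "int ^ 'd" and d
  proof (rule ccontr)
    assume "\<not> 0 \<le> b $ d"
    then have "flip G d \<in> pos_darts b" using neg_dart[OF H1_chains[OF b]] by simp
    then show False using ab d by (auto simp: pos_darts_def)
  qed
  have conf': "\<forall>d\<in>pos_darts c'. flip G d \<notin> pos_darts c"
    using conf pos_dartsD(1)[OF H1_chains[OF c(2)]] finite_graphD(3)[OF G] by metis
  have "to_real (c + c') \<in> H1 G" using H1_add[OF c] by simp
  then obtain w :: "real ^ 'd" where w: "w \<in> H1 G" "pos_darts (to_real (c + c')) \<subseteq> pos_darts w"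
    "\<forall>d. live d \<longrightarrow> w $ d \<noteq> 0"
    using generic_perturbation by blast
  have wS: "w \<in> {v \<in> H1 G. \<forall>d. live d \<longrightarrow> v $ d \<noteq> 0}" using w by auto
  have cl: "to_real a \<in> closure (chamber w)"
    if a: "a \<in> H1 G" and apos: "pos_darts a \<subseteq> pos_darts w" for a
  proof -
    \<comment> \<open>Approaches \<open>a\<close> from inside the chamber: no coordinate of
      \<open>a\<close> is opposite in sign to \<open>w\<close>, so the term in \<open>w\<close>
      gives every live coordinate strictly the sign of \<open>w\<close>.\<close>
    let ?x = "\<lambda>n. to_real a + inverse (real (Suc n)) *s w"
    have nn: "0 \<le> to_real a $ d * w $ d" for d
    proof (cases "a $ d < 0")
      case True
      then have "flip G d \<in> pos_darts w" "d \<in> darts G"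
        using neg_dart[OF H1_chains[OF a]] apos by auto
      then have "w $ d < 0" using pos_darts_flip[OF H1_chains[OF w(1)]] by simp
      then show ?thesis using True by (simp add: mult_nonpos_nonpos)
    next
      case False
      then have "a $ d = 0 \<or> 0 < a $ d" by auto
      then have "a $ d = 0 \<or> 0 < w $ d" using apos by (auto simp: pos_darts_def)
      then show ?thesis using False by auto
    qed
    have "?x n \<in> chamber w" for n
    proof -
      have "?x n \<in> H1 G" by (intro H1_add H1_scale w) (use a in simp)
      moreover have "0 < ?x n $ d * w $ d" if "live d" for d
      proof -
        have "0 < w $ d * w $ d"
          using w(3) that not_real_square_gt_zero by blast
        then have "0 < inverse (real (Suc n)) * (w $ d * w $ d)"
          by (rule mult_pos_pos[rotated]) simp
        then show ?thesis using nn[of d] by (simp add: algebra_simps)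
      qed
      ultimately show ?thesis by (simp add: chamber_def)
    qed
    moreover have "?x \<longlonglongrightarrow> to_real a + 0 *s w"
      unfolding scalar_mult_eq_scaleR
      by (intro tendsto_intros LIMSEQ_inverse_real_of_nat)
    then have "?x \<longlonglongrightarrow> to_real a" by simp
    ultimately show ?thesis unfolding closure_sequential by (intro exI[of _ ?x]) simp
  qed
  have "pos_darts c \<subseteq> pos_darts (c + c')" "pos_darts c' \<subseteq> pos_darts (c + c')"
    using dir[OF c _ conf] dir[OF c(2,1) _ conf'] by (fastforce simp: pos_darts_def)+
  then have "to_real c \<in> closure (chamber w)" "to_real c' \<in> closure (chamber w)"
    using cl c w(2) by auto
  moreover have "closure (chamber w) \<in> cographic_fan G"
  proof -
    have "chamber w \<in> components (H1 G - \<Union>(cographic_arrangement G))"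
      unfolding off_arrangement components_def
      by (rule image_eqI[of _ _ w], rule chamber_component[OF wS, symmetric], rule wS)
    moreover have "closure (chamber w) face_of closure (chamber w)"
      by (intro face_of_refl convex_closure convex_chamber)
    moreover have "closure (chamber w) \<noteq> {}"
      using \<open>to_real c \<in> closure (chamber w)\<close> by (metis empty_iff)
    ultimately show ?thesis
      unfolding cographic_fan_def by (intro CollectI conjI bexI)
  qed
  ultimately show "common_cone G c c'" unfolding common_cone_def by blast
qed

end

context
  fixes G :: "('v, 'd::finite) graph"
  assumes G: "finite_graph G"
begin

section \<open>Circuits as elements of the lattice\<close>

lemma Cir_subgraph:
  assumes "(D, \<psi>) \<in> Cir G"
  shows "subgraph D G" "finite_graph D" "\<psi> \<in> orientations D" "flip D = flip G" "darts D \<subseteq> darts G"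
    "edges D \<subseteq> edges G"
  using assms by (auto simp: Cir_def cyclic_subgraph_def subgraph_def totally_cyclic_def edges_def)

lemma circuit_class_nth:
  assumes "(D, \<psi>) \<in> Cir G"
  shows "circuit_class (D, \<psi>) $ d = (if d \<in> \<psi> ` edges D then 1
    else if flip G d \<in> \<psi> ` edges D \<and> d \<in> darts D then - 1 else 0)"
proof -
  note D = Cir_subgraph[OF assms]
  have "\<psi> ` edges D \<subseteq> darts D" "\<forall>d\<in>\<psi> ` edges D. flip D d \<notin> \<psi> ` edges D"
    using orientation_image_flip(1,3)[OF D(2,3)] by blast+
  from sum_dart_chain_nth[OF D(2) this] show ?thesis
    by (simp only: circuit_class_eq[OF assms] D(4))
qed

lemma circuit_class_pos:
  assumes "(D, \<psi>) \<in> Cir G"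
  shows "pos_darts (circuit_class (D, \<psi>)) = \<psi> ` edges D"
  using circuit_class_nth[OF assms] by (auto simp: pos_darts_def split: if_splits)

lemma circuit_class_H1: "\<gamma> \<in> Cir G \<Longrightarrow> circuit_class \<gamma> \<in> H1 G"
  using circuit_class_H1_subgraph H1_subgraph[OF G] Cir_subgraph(1) by (cases \<gamma>) blast

text \<open>Discordance means that a common edge is traversed in both directions, so a dart of one
  circuit is the flip of a dart of the other. This is the failure of the sign criterion in
  \<open>common_cone_iff\<close>, and the reason why exactly the discordant pairs have product zero
  in the cographic ring.\<close>

lemma concordant_iff:
  assumes "\<gamma> \<in> Cir G" "\<gamma>' \<in> Cir G"
  shows "concordant \<gamma> \<gamma>' \<longleftrightarrow> common_cone G (circuit_class \<gamma>) (circuit_class \<gamma>')"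
proof -
  obtain D \<psi> D' \<psi>' where g: "\<gamma> = (D, \<psi>)" "\<gamma>' = (D', \<psi>')" by (metis surj_pair)
  note c = Cir_subgraph[OF assms(1)[unfolded g]] and c' = Cir_subgraph[OF assms(2)[unfolded g]]
  have "concordant \<gamma> \<gamma>' \<longleftrightarrow> (\<forall>d\<in>\<psi> ` edges D. flip G d \<notin> \<psi>' ` edges D')"
  proof
    assume conc: "concordant \<gamma> \<gamma>'"
    show "\<forall>d\<in>\<psi> ` edges D. flip G d \<notin> \<psi>' ` edges D'"
    proof (intro ballI notI)
      fix d assume d: "d \<in> \<psi> ` edges D" and f: "flip G d \<in> \<psi>' ` edges D'"
      note o = orientation_image_flip[OF c(2,3) d] and o' = orientation_image_flip[OF c'(2,3) f]
      have dG: "d \<in> darts G" using o(1) c(5) by blast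
      have "{d, flip G d} \<in> edges D \<inter> edges D'"
        using edge_of_dart[OF o(1)] edge_of_dart[OF o'(1)] finite_graphD(3)[OF G dG]
        by (simp add: c(4) c'(4) insert_commute)
      then have "\<psi> {d, flip G d} = \<psi>' {d, flip G d}"
        using conc by (auto simp: concordant_def g)
      then show False
        using o(2) o'(2) finite_graphD(2,3)[OF G dG] by (simp add: c(4) c'(4) insert_commute)
    qed
  next
    assume h: "\<forall>d\<in>\<psi> ` edges D. flip G d \<notin> \<psi>' ` edges D'"
    show "concordant \<gamma> \<gamma>'"
      unfolding concordant_def g prod.case
    proof
      fix e assume e: "e \<in> edges D \<inter> edges D'"
      then have m: "\<psi> e \<in> e" "\<psi>' e \<in> e"
        using orientations_memD[OF c(3)] orientations_memD[OF c'(3)] by auto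
      have "e = {\<psi> e, flip G (\<psi> e)}" using edgeD(1)[OF c(2) _ m(1)] e c(4) by auto
      moreover have "\<psi>' e \<noteq> flip G (\<psi> e)" using h e by (metis IntD1 IntD2 imageI)
      ultimately show "\<psi> e = \<psi>' e" using m(2) by (metis insertE singletonD)
    qed
  qed
  then show ?thesis
    using common_cone_iff[OF G circuit_class_H1[OF assms(1)] circuit_class_H1[OF assms(2)]]
      circuit_class_pos assms by (simp add: g)
qed

text \<open>Brings the circuits of an index into the same form as the lattice points of its cone, so
  that a circuit belongs to the index exactly when its class lies in the cone.\<close>

lemma Cir_of_iff:
  assumes i: "i \<in> OP G"
  shows "\<gamma> \<in> Cir_of G i \<longleftrightarrow> \<gamma> \<in> Cir G \<and> pos_darts (circuit_class \<gamma>) \<subseteq> oriented_darts G i"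
proof -
  obtain T \<phi> D \<psi> where g: "i = (T, \<phi>)" "\<gamma> = (D, \<psi>)" by (metis surj_pair)
  note i' = i[unfolded g] note o = OP_orientation[OF G i']
  have dd: "darts (delete_edges G T) = darts G - \<Union>T" by (simp add: delete_edges_def)
  have sub: "subgraph D (delete_edges G T) \<longleftrightarrow> subgraph D G \<and> darts D \<inter> \<Union>T = {}"
    by (auto simp: subgraph_def delete_edges_def)
  have mem: "\<gamma> \<in> Cir_of G i \<longleftrightarrow> (D, \<psi>) \<in> Cir G \<and> darts D \<inter> \<Union>T = {} \<and> \<psi> = restrict \<phi> (edges D)"
    by (auto simp: Cir_of_def Cir_def cyclic_subgraph_def sub g)
  show ?thesis
  proof
    assume "\<gamma> \<in> Cir_of G i"
    then have D: "(D, \<psi>) \<in> Cir G" "darts D \<inter> \<Union>T = {}" "\<psi> = restrict \<phi> (edges D)" using mem by auto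
    have "e \<in> edges G - T" if e: "e \<in> edges D" for e
      using e D(2) Cir_subgraph(6)[OF D(1)] by (auto simp: edges_def)
    then have "\<psi> ` edges D \<subseteq> oriented_darts G i" using D(3) by (auto simp: oriented_darts_def g)
    then show "\<gamma> \<in> Cir G \<and> pos_darts (circuit_class \<gamma>) \<subseteq> oriented_darts G i"
      using D(1) circuit_class_pos g by simp
  next
    assume "\<gamma> \<in> Cir G \<and> pos_darts (circuit_class \<gamma>) \<subseteq> oriented_darts G i"
    then have D: "(D, \<psi>) \<in> Cir G" and P: "\<psi> ` edges D \<subseteq> oriented_darts G (T, \<phi>)"
      using circuit_class_pos g by auto
    note c = Cir_subgraph[OF D]
    have e: "e \<notin> T \<and> \<psi> e = \<phi> e" if e: "e \<in> edges D" for e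
    proof -
      have "\<psi> e \<in> oriented_darts G (T, \<phi>)" using P e by auto
      from oriented_dartsD(2,3)[OF G i' this]
      have "{\<psi> e, flip G (\<psi> e)} \<notin> T" "\<phi> {\<psi> e, flip G (\<psi> e)} = \<psi> e" by auto
      moreover have "e = {\<psi> e, flip G (\<psi> e)}"
        using edgeD(1)[OF c(2) e orientations_memD[OF c(3) e]] c(4) by simp
      ultimately show ?thesis by simp
    qed
    have "darts D \<inter> \<Union>T = {}"
    proof (rule ccontr)
      assume "darts D \<inter> \<Union>T \<noteq> {}"
      then obtain d t where d: "d \<in> darts D" "t \<in> T" "d \<in> t" by auto
      then have "t = {d, flip G d}" using edgeD(1)[OF G _ d(3)] o(1) by auto
      then show False using e[OF edge_of_dart[OF d(1)]] d(2) c(4) by simp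
    qed
    moreover have "\<psi> = restrict \<phi> (edges D)"
    proof
      fix x show "\<psi> x = restrict \<phi> (edges D) x"
        using e c(3) by (cases "x \<in> edges D") (auto simp: orientations_def PiE_def extensional_def)
    qed
    ultimately show "\<gamma> \<in> Cir_of G i" using mem D by simp
  qed
qed

lemma circuit_below:
  fixes c :: "int ^ 'd"
  assumes c: "c \<in> H1 G" and ne: "c \<noteq> 0"
  obtains \<gamma> where "\<gamma> \<in> Cir G" "pos_darts (circuit_class \<gamma>) \<noteq> {}"
    "pos_darts (circuit_class \<gamma>) \<subseteq> pos_darts c"
proof -
  let ?P = "pos_darts c"
  note ch = H1_chains[OF c]
  have P: "?P \<subseteq> darts G" using pos_dartsD(1)[OF G ch] by blast
  have Pne: "?P \<noteq> {}"
  proof -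
    obtain d where "c $ d \<noteq> 0" using ne by (auto simp: vec_eq_iff)
    then show ?thesis using neg_dart(2)[OF G ch, of d] by (cases "0 < c $ d") (auto simp: pos_darts_def)
  qed
  have out: "\<exists>d'\<in>?P. src G d' = tgt G d" if d: "d \<in> ?P" for d
  proof (rule ccontr)
    assume no: "\<not> (\<exists>d'\<in>?P. src G d' = tgt G d)"
    have dG: "d \<in> darts G" using d P by auto
    \<comment> \<open>If no positive dart leaves the vertex, no incoming dart has a negative
      coefficient, while that of \<open>d\<close> is positive; this contradicts zero
      boundary.\<close>
    have "0 \<le> c $ f" if f: "f \<in> {f \<in> darts G. tgt G f = tgt G d}" for f
    proof (rule ccontr)
      assume "\<not> 0 \<le> c $ f"
      then have "flip G f \<in> ?P" using neg_dart(2)[OF G ch] by simp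
      moreover have "src G (flip G f) = tgt G d" using finite_graphD(7)[OF G] f by auto
      ultimately show False using no by blast
    qed
    then have "0 < (\<Sum>f | f \<in> darts G \<and> tgt G f = tgt G d. c $ f)"
      by (intro sum_pos2[of _ d]) (use d dG in \<open>auto simp: pos_darts_def\<close>)
    moreover have "boundary G c (tgt G d) = 0"
      using c finite_graphD(5)[OF G dG] by (auto simp: H1_def)
    ultimately show False by (simp add: boundary_def)
  qed
  obtain W nx where W: "W \<noteq> {}" "W \<subseteq> verts G" "\<And>v. v \<in> W \<Longrightarrow> nx v \<in> ?P \<and> src G (nx v) = v"
    "(\<lambda>v. tgt G (nx v)) ` W = W"
    "\<And>X. X \<subseteq> W \<Longrightarrow> X \<noteq> {} \<Longrightarrow> (\<And>v. v \<in> X \<Longrightarrow> tgt G (nx v) \<in> X) \<Longrightarrow> X = W"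
    using directed_cycle_exists[OF G P Pne out] by metis
  \<comment> \<open>Every edge of the cycle has exactly one positive dart, so on these edges the
    choice is forced and satisfies the hypothesis of \<open>circuit_of_cycle\<close>.\<close>
  define \<phi> where "\<phi> e = (SOME d. d \<in> e \<and> d \<in> ?P)" for e
  have phi: "\<phi> {d, flip G d} = d" if "d \<in> nx ` W" for d
  proof -
    have d: "d \<in> ?P" using that W(3) by auto
    show ?thesis unfolding \<phi>_def
      by (rule some_equality) (use d pos_dartsD(2)[OF G ch d] in auto)
  qed
  have nx: "nx v \<in> darts G \<and> src G (nx v) = v" if "v \<in> W" for v using W(3)[OF that] P by auto
  obtain D where D: "(D, restrict \<phi> (edges D)) \<in> Cir G"
    "circuit_class (D, restrict \<phi> (edges D)) = (\<Sum>d\<in>nx ` W. dart_chain G d)"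
    by (rule circuit_of_cycle[OF G W(2,1) nx W(4,5) phi])
  have nA: "nx ` W \<subseteq> darts G" "\<forall>d\<in>nx ` W. flip G d \<notin> nx ` W"
  proof -
    show "nx ` W \<subseteq> darts G" using nx by blast
    show "\<forall>d\<in>nx ` W. flip G d \<notin> nx ` W"
    proof (intro ballI notI)
      fix d assume "d \<in> nx ` W" "flip G d \<in> nx ` W"
      then have "d \<in> ?P" "flip G d \<in> ?P" using W(3) by auto
      then show False using pos_dartsD(2)[OF G ch] by simp
    qed
  qed
  have "pos_darts (circuit_class (D, restrict \<phi> (edges D))) = nx ` W"
  proof -
    have "(\<Sum>d\<in>nx ` W. dart_chain G d :: int ^ 'd) $ f =
        (if f \<in> nx ` W then 1 else if flip G f \<in> nx ` W \<and> f \<in> darts G then - 1 else 0)" for f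
      by (rule sum_dart_chain_nth[OF G nA])
    then show ?thesis unfolding D(2) pos_darts_def by (simp only:) auto
  qed
  then show ?thesis using that[OF D(1)] W(1,3) by auto
qed

text \<open>Subtract circuits contained in the positive darts. A circuit class has coefficients 0, 1
  and -1 and \<open>c\<close> has integral ones, so no sign is overshot and the sum of the positive
  coefficients drops.\<close>

lemma conformal_decomposition:
  fixes c :: "int ^ 'd"
  assumes "c \<in> H1 G"
  shows "\<exists>m :: ('v, 'd) circuit \<Rightarrow>\<^sub>0 nat. Poly_Mapping.keys m \<subseteq> Cir G \<and>
    (\<forall>\<gamma>\<in>Poly_Mapping.keys m. pos_darts (circuit_class \<gamma>) \<subseteq> pos_darts c) \<and>
    (\<Sum>\<gamma>\<in>Poly_Mapping.keys m. int (Poly_Mapping.lookup m \<gamma>) *s circuit_class \<gamma>) = c"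
  using assms
proof (induction "\<Sum>d\<in>UNIV. nat (c $ d)" arbitrary: c rule: less_induct)
  case less
  show ?case
  proof (cases "c = 0")
    case True
    then show ?thesis by (intro exI[of _ 0]) simp
  next
    case False
    obtain \<gamma> where g: "\<gamma> \<in> Cir G" "pos_darts (circuit_class \<gamma>) \<noteq> {}"
      "pos_darts (circuit_class \<gamma>) \<subseteq> pos_darts c"
      by (rule circuit_below[OF less.prems False])
    let ?z = "circuit_class \<gamma>"
    note ch = H1_chains[OF less.prems] and zch = H1_chains[OF circuit_class_H1[OF g(1)]]
    have z1: "?z $ d = 1" if "d \<in> pos_darts ?z" for d
      using that circuit_class_nth[of "fst \<gamma>" "snd \<gamma>" d] g(1)
      by (auto simp: pos_darts_def split: if_splits)
    \<comment> \<open>Where the circuit is negative, \<open>c\<close> is a negative integer, so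
      adding 1 cannot make it positive; the remainder gains no positive dart.\<close>
    have le: "0 \<le> ?z $ d \<or> c $ d < 0 \<and> ?z $ d = - 1" for d
    proof (cases "0 \<le> ?z $ d")
      case False
      then have n: "d \<in> darts G" "flip G d \<in> pos_darts ?z" using neg_dart[OF G zch] by auto
      then have "?z $ d = - 1" using z1[OF n(2)] chainsD(1)[OF zch n(1)] by simp
      moreover have "c $ d < 0" using n g(3) pos_darts_flip[OF G ch n(1)] by auto
      ultimately show ?thesis by simp
    qed simp
    have pos_sub: "pos_darts (c - ?z) \<subseteq> pos_darts c"
    proof
      fix d assume "d \<in> pos_darts (c - ?z)"
      then show "d \<in> pos_darts c" using le[of d] by (auto simp: pos_darts_def)
    qed
    have "(\<Sum>d\<in>UNIV. nat ((c - ?z) $ d)) < (\<Sum>d\<in>UNIV. nat (c $ d))"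
    proof (rule sum_strict_mono_ex1)
      show "\<forall>d\<in>UNIV. nat ((c - ?z) $ d) \<le> nat (c $ d)"
      proof
        fix d show "nat ((c - ?z) $ d) \<le> nat (c $ d)" using le[of d] by auto
      qed
      obtain d where d: "d \<in> pos_darts ?z" using g(2) by auto
      then have "nat ((c - ?z) $ d) < nat (c $ d)"
        using z1[OF d] subsetD[OF g(3) d] by (simp add: pos_darts_def)
      then show "\<exists>d\<in>UNIV. nat ((c - ?z) $ d) < nat (c $ d)" by blast
    qed simp
    from less.hyps[OF this H1_minus[OF less.prems circuit_class_H1[OF g(1)]]]
    obtain m :: "('v, 'd) circuit \<Rightarrow>\<^sub>0 nat" where m: "Poly_Mapping.keys m \<subseteq> Cir G"
      "\<forall>\<gamma>\<in>Poly_Mapping.keys m. pos_darts (circuit_class \<gamma>) \<subseteq> pos_darts (c - ?z)"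
      "(\<Sum>\<gamma>\<in>Poly_Mapping.keys m. int (Poly_Mapping.lookup m \<gamma>) *s circuit_class \<gamma>) = c - ?z" by blast
    let ?m = "m + Poly_Mapping.single \<gamma> 1"
    have k: "Poly_Mapping.keys ?m = insert \<gamma> (Poly_Mapping.keys m)"
      by (auto simp: in_keys_iff lookup_add lookup_single when_def split: if_splits)
    have "(\<Sum>\<delta>\<in>Poly_Mapping.keys ?m. int (Poly_Mapping.lookup ?m \<delta>) *s circuit_class \<delta>) =
      (\<Sum>\<delta>\<in>insert \<gamma> (Poly_Mapping.keys m). int (Poly_Mapping.lookup m \<delta>) *s circuit_class \<delta>)
      + (\<Sum>\<delta>\<in>insert \<gamma> (Poly_Mapping.keys m). if \<delta> = \<gamma> then circuit_class \<delta> else 0)"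
      unfolding k sum.distrib[symmetric]
      by (intro sum.cong refl) (auto simp: lookup_add lookup_single when_def vec_eq_iff algebra_simps)
    also have "(\<Sum>\<delta>\<in>insert \<gamma> (Poly_Mapping.keys m). int (Poly_Mapping.lookup m \<delta>) *s circuit_class \<delta>) = c - ?z"
      unfolding m(3)[symmetric] by (rule sum.mono_neutral_right) (auto simp: in_keys_iff)
    finally have "(\<Sum>\<delta>\<in>Poly_Mapping.keys ?m. int (Poly_Mapping.lookup ?m \<delta>) *s circuit_class \<delta>) = c" by simp
    moreover have "Poly_Mapping.keys ?m \<subseteq> Cir G"
      unfolding k using m(1) g(1) by simp
    moreover have "\<forall>\<gamma>\<in>Poly_Mapping.keys ?m. pos_darts (circuit_class \<gamma>) \<subseteq> pos_darts c"
      unfolding k using m(2) g(3) pos_sub by blast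
    ultimately show ?thesis by blast
  qed
qed

end

section \<open>Monomial maps\<close>

text \<open>The cone projections and the evaluations of polynomials at circuit classes all have this
  shape.\<close>

definition monomial_map :: "('m \<Rightarrow> bool) \<Rightarrow> ('m \<Rightarrow> 'n) \<Rightarrow> ('m \<Rightarrow>\<^sub>0 'k) \<Rightarrow> 'n \<Rightarrow>\<^sub>0 'k::comm_ring_1" where
  "monomial_map Q f p = (\<Sum>m\<in>Poly_Mapping.keys p.
     if Q m then Poly_Mapping.single (f m) (Poly_Mapping.lookup p m) else 0)"

lemma poly_mapping_expand:
  "p = (\<Sum>m\<in>Poly_Mapping.keys p. Poly_Mapping.single m (Poly_Mapping.lookup p m))"
  for p :: "'m \<Rightarrow>\<^sub>0 'k::comm_monoid_add"
  by (rule poly_mapping_eqI) (auto simp: lookup_sum lookup_single when_def in_keys_iff sum.delta)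

lemma monomial_map_0 [simp]: "monomial_map Q f 0 = 0"
  by (simp add: monomial_map_def)

lemma monomial_map_add: "monomial_map Q f (p + q) = monomial_map Q f p + monomial_map Q f q"
  unfolding monomial_map_def
  by (rule setsum_keys_plus_distrib) (auto simp: single_add)

lemma monomial_map_sum: "monomial_map Q f (sum g A) = (\<Sum>x\<in>A. monomial_map Q f (g x))"
  by (induction A rule: infinite_finite_induct) (simp_all add: monomial_map_add)

lemma monomial_map_single:
  "monomial_map Q f (Poly_Mapping.single m a) = (if Q m then Poly_Mapping.single (f m) a else 0)"
  by (cases "a = 0") (simp_all add: monomial_map_def)

lemma monomial_map_comp:
  "monomial_map Q f (monomial_map Q' f' p) = monomial_map (\<lambda>m. Q' m \<and> Q (f' m)) (f \<circ> f') p"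
  unfolding monomial_map_def[of Q' f'] monomial_map_def[of _ "f \<circ> f'"] monomial_map_sum
  by (intro sum.cong refl) (auto simp: monomial_map_single)

lemma monomial_map_cong:
  assumes "\<And>m. m \<in> Poly_Mapping.keys p \<Longrightarrow> Q m = Q' m"
  shows "monomial_map Q f p = monomial_map Q' f p"
  unfolding monomial_map_def by (intro sum.cong refl) (simp add: assms)

lemma lookup_monomial_map_id:
  "Poly_Mapping.lookup (monomial_map Q id p) m = (if Q m then Poly_Mapping.lookup p m else 0)"
proof -
  have "Poly_Mapping.lookup (monomial_map Q id p) m =
      (\<Sum>n\<in>Poly_Mapping.keys p. if n = m then (if Q m then Poly_Mapping.lookup p m else 0) else 0)"
    unfolding monomial_map_def lookup_sum
    by (intro sum.cong refl) (auto simp: lookup_single when_def)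
  then show ?thesis by (auto simp: in_keys_iff)
qed

lemma keys_monomial_map:
  "Poly_Mapping.keys (monomial_map Q f p) \<subseteq> f ` {m \<in> Poly_Mapping.keys p. Q m}"
  unfolding monomial_map_def
  by (rule order_trans[OF Poly_Mapping.keys_sum]) (auto split: if_splits)

lemma mult_expand:
  fixes p q :: "'m::comm_monoid_add \<Rightarrow>\<^sub>0 'k::comm_ring_1"
  shows "p * q = (\<Sum>m\<in>Poly_Mapping.keys p. \<Sum>m'\<in>Poly_Mapping.keys q.
    Poly_Mapping.single (m + m') (Poly_Mapping.lookup p m * Poly_Mapping.lookup q m'))"
  by (subst poly_mapping_expand[of p], subst poly_mapping_expand[of q])
    (simp add: sum_product mult_single)

text \<open>The hypothesis on \<open>Q\<close> makes the excluded exponents absorbing under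
  addition, so their monomials span an ideal and killing them respects products.\<close>

lemma monomial_map_mult:
  fixes p q :: "'m::comm_monoid_add \<Rightarrow>\<^sub>0 'k::comm_ring_1" and f :: "'m \<Rightarrow> 'n::comm_monoid_add"
  assumes "\<And>m m'. Q (m + m') \<longleftrightarrow> Q m \<and> Q m'" "\<And>m m'. f (m + m') = f m + f m'"
  shows "monomial_map Q f (p * q) = monomial_map Q f p * monomial_map Q f q"
  unfolding mult_expand[of p q] monomial_map_sum
  unfolding monomial_map_def[of Q f p] monomial_map_def[of Q f q] sum_product
  by (intro sum.cong refl) (auto simp: monomial_map_single assms mult_single)

lemma map_scale_single:
  "Poly_Mapping.map ((*) (r::'k::comm_ring_1)) (Poly_Mapping.single m a) = Poly_Mapping.single m (r * a)"
  by (rule poly_mapping_eqI) (simp add: Poly_Mapping.map.rep_eq lookup_single when_def)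

lemma lookup_map_scale:
  "Poly_Mapping.lookup (Poly_Mapping.map ((*) (r::'k::comm_ring_1)) p) m = r * Poly_Mapping.lookup p m"
  by (simp add: Poly_Mapping.map.rep_eq when_def)

lemma map_scale_add:
  "Poly_Mapping.map ((*) (r::'k::comm_ring_1)) (p + q) =
    Poly_Mapping.map ((*) r) p + Poly_Mapping.map ((*) r) q"
  by (rule poly_mapping_eqI) (simp add: lookup_map_scale lookup_add algebra_simps)

lemma map_scale_sum:
  "Poly_Mapping.map ((*) (r::'k::comm_ring_1)) (sum g A) = (\<Sum>x\<in>A. Poly_Mapping.map ((*) r) (g x))"
  by (induction A rule: infinite_finite_induct)
    (simp_all add: map_scale_add poly_mapping_eqI lookup_map_scale)

lemma keys_map_scale: "Poly_Mapping.keys (Poly_Mapping.map ((*) (r::'k::comm_ring_1)) p) \<subseteq> Poly_Mapping.keys p"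
  by (auto simp: in_keys_iff lookup_map_scale)

lemma monomial_map_scale:
  fixes p :: "'m \<Rightarrow>\<^sub>0 'k::comm_ring_1" and f :: "'m \<Rightarrow> 'n"
  shows "monomial_map Q f (Poly_Mapping.map ((*) r) p) = Poly_Mapping.map ((*) r) (monomial_map Q f p)"
proof -
  have "Poly_Mapping.map ((*) r) p = (\<Sum>m\<in>Poly_Mapping.keys p.
      Poly_Mapping.single m (r * Poly_Mapping.lookup p m))"
    by (subst poly_mapping_expand[of p]) (simp only: map_scale_sum map_scale_single)
  moreover have "Poly_Mapping.map ((*) r) 0 = (0 :: 'n \<Rightarrow>\<^sub>0 'k)"
    by (rule poly_mapping_eqI) (simp add: lookup_map_scale)
  ultimately show ?thesis
    unfolding monomial_map_def[of Q f p]
    by (simp add: monomial_map_sum map_scale_sum monomial_map_single map_scale_single if_distrib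
      cong: if_cong)
qed

section \<open>Algebras whose operations come from a type class\<close>

lemma cring_of_comm_ring_1:
  fixes A :: "('k, 'a::comm_ring_1) module"
  assumes ops: "mult A = (*)" "one A = 1" "zero A = 0" "add A = (+)"
    and closed: "0 \<in> carrier A" "1 \<in> carrier A"
      "\<And>x y. x \<in> carrier A \<Longrightarrow> y \<in> carrier A \<Longrightarrow> x + y \<in> carrier A"
      "\<And>x y. x \<in> carrier A \<Longrightarrow> y \<in> carrier A \<Longrightarrow> x * y \<in> carrier A"
      "\<And>x. x \<in> carrier A \<Longrightarrow> - x \<in> carrier A"
  shows "cring A"
proof (rule cringI)
  show "abelian_group A"
  proof (rule abelian_groupI)
    fix x assume "x \<in> carrier A"
    then show "\<exists>y\<in>carrier A. y \<oplus>\<^bsub>A\<^esub> x = \<zero>\<^bsub>A\<^esub>"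
      using closed(5) by (intro bexI[of _ "- x"]) (simp_all add: ops)
  qed (auto simp: ops closed ac_simps)
  show "comm_monoid A"
    by (rule comm_monoidI) (auto simp: ops closed ac_simps)
qed (simp add: ops algebra_simps)

lemma finsum_eq_sum:
  fixes A :: "('k, 'a::comm_monoid_add) module"
  assumes "abelian_monoid A" "add A = (+)" "zero A = 0" "\<And>x. x \<in> S \<Longrightarrow> f x \<in> carrier A"
  shows "finsum A f S = sum f S"
  using assms(4)
proof (induction S rule: infinite_finite_induct)
  case (insert x S)
  interpret abelian_monoid A by fact
  show ?case using insert by (subst finsum_insert) (auto simp: assms(2))
qed (simp_all add: assms(3) abelian_monoid.finsum_empty[OF assms(1)]
  abelian_monoid.finsum_infinite[OF assms(1)])

text \<open>Serves both evaluations at circuit classes: \<open>Q\<close> is pairwise concordance for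
  the cographic ring, where the other monomials have image zero, and constantly true for a semigroup
  ring.\<close>

lemma poly_eval_eq_monomial_map:
  fixes A :: "('k::field, 'n \<Rightarrow>\<^sub>0 'k) module"
  assumes A: "abelian_monoid A" "add A = (+)" "zero A = 0" "smult A = (\<lambda>r. Poly_Mapping.map ((*) r))"
    and eval: "\<And>m. m \<in> Poly_Mapping.keys p \<Longrightarrow>
      (\<Otimes>\<^bsub>A\<^esub>x\<in>Poly_Mapping.keys m. f x [^]\<^bsub>A\<^esub> Poly_Mapping.lookup m x) =
        (if Q m then Poly_Mapping.single (g m) 1 else 0)"
    and closed: "\<And>m r. m \<in> Poly_Mapping.keys p \<Longrightarrow> Q m \<Longrightarrow> Poly_Mapping.single (g m) r \<in> carrier A"
  shows "poly_eval A f p = monomial_map Q g p"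
proof -
  have z: "Poly_Mapping.map ((*) r) 0 = (0 :: 'n \<Rightarrow>\<^sub>0 'k)" for r
    by (rule poly_mapping_eqI) (simp add: lookup_map_scale)
  have zero: "0 \<in> carrier A" using abelian_monoid.zero_closed[OF A(1)] by (simp add: A(3))
  have summand: "Poly_Mapping.lookup p m \<odot>\<^bsub>A\<^esub>
      (\<Otimes>\<^bsub>A\<^esub>x\<in>Poly_Mapping.keys m. f x [^]\<^bsub>A\<^esub> Poly_Mapping.lookup m x) =
      (if Q m then Poly_Mapping.single (g m) (Poly_Mapping.lookup p m) else 0)"
    if "m \<in> Poly_Mapping.keys p" for m
    using eval[OF that] by (simp add: A(4) map_scale_single z)
  have "poly_eval A f p = (\<Sum>m\<in>Poly_Mapping.keys p. Poly_Mapping.lookup p m \<odot>\<^bsub>A\<^esub>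
      (\<Otimes>\<^bsub>A\<^esub>x\<in>Poly_Mapping.keys m. f x [^]\<^bsub>A\<^esub> Poly_Mapping.lookup m x))"
    unfolding poly_eval_def
    by (rule finsum_eq_sum[OF A(1-3)]) (auto simp: summand zero closed)
  also have "\<dots> = monomial_map Q g p"
    unfolding monomial_map_def by (intro sum.cong refl summand)
  finally show ?thesis .
qed

lemma poly_algebra_cring: "cring (poly_algebra S :: ('k::field, ('x \<Rightarrow>\<^sub>0 nat) \<Rightarrow>\<^sub>0 'k) module)"
proof (rule cring_of_comm_ring_1)
  fix p q :: "('x \<Rightarrow>\<^sub>0 nat) \<Rightarrow>\<^sub>0 'k"
  assume pq: "p \<in> carrier (poly_algebra S)" "q \<in> carrier (poly_algebra S)"
  show "p + q \<in> carrier (poly_algebra S)"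
    using pq Poly_Mapping.keys_add[of p q] by (fastforce simp: poly_algebra_def)
  show "p * q \<in> carrier (poly_algebra S)"
  proof -
    have "Poly_Mapping.keys m \<subseteq> S" if m: "m \<in> Poly_Mapping.keys (p * q)" for m
    proof -
      obtain a b where "m = a + b" "a \<in> Poly_Mapping.keys p" "b \<in> Poly_Mapping.keys q"
        using m keys_mult[of p q] by blast
      then show ?thesis using pq Poly_Mapping.keys_add[of a b] by (fastforce simp: poly_algebra_def)
    qed
    then show ?thesis by (simp add: poly_algebra_def)
  qed
next
  fix p :: "('x \<Rightarrow>\<^sub>0 nat) \<Rightarrow>\<^sub>0 'k"
  assume "p \<in> carrier (poly_algebra S)"
  then show "- p \<in> carrier (poly_algebra S)" by (auto simp: poly_algebra_def in_keys_iff)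
qed (simp_all add: poly_algebra_def)

lemma common_cone_sym: "common_cone G c c' \<longleftrightarrow> common_cone G c' c"
  by (auto simp: common_cone_def)

lemma pos_darts_scale: "0 < n \<Longrightarrow> pos_darts (int n *s c) = pos_darts c"
  by (auto simp: pos_darts_def zero_less_mult_iff)

lemma cone_proj_eq:
  "cone_proj G i p = monomial_map (\<lambda>c. to_real c \<in> cone_of G i) id p"
  unfolding cone_proj_def monomial_map_def by (simp add: sum.inter_filter cong: if_cong)

lemma cographic_ring_carrier: "p \<in> carrier (cographic_ring G) \<longleftrightarrow> Poly_Mapping.keys p \<subseteq> H1 G"
  by (simp add: cographic_ring_def)

lemma keys_add_H1: "Poly_Mapping.keys p \<subseteq> H1 G \<Longrightarrow> Poly_Mapping.keys q \<subseteq> H1 G \<Longrightarrow>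
    Poly_Mapping.keys (p + q) \<subseteq> H1 G"
  by (rule order_trans[OF Poly_Mapping.keys_add]) simp

text \<open>The exponent of the image of the monomial with exponent vector \<open>m\<close>,
  whenever that image is nonzero.\<close>

definition circuit_sum :: "(('v, 'd) circuit \<Rightarrow>\<^sub>0 nat) \<Rightarrow> int ^ 'd" where
  "circuit_sum m = (\<Sum>\<gamma>\<in>Poly_Mapping.keys m. int (Poly_Mapping.lookup m \<gamma>) *s circuit_class \<gamma>)"

definition pairwise_concordant :: "('v, 'd) circuit set \<Rightarrow> bool" where
  "pairwise_concordant A \<longleftrightarrow> (\<forall>\<gamma>\<in>A. \<forall>\<gamma>'\<in>A. concordant \<gamma> \<gamma>')"

lemma circuit_sum_add: "circuit_sum (m + m') = circuit_sum m + circuit_sum m'"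
  unfolding circuit_sum_def
  by (rule setsum_keys_plus_distrib) (auto simp: vec_eq_iff algebra_simps)

context
  fixes G :: "('v, 'd::finite) graph"
  assumes G: "finite_graph G"
begin

section \<open>Cones and sums of circulations\<close>

lemma lattice_cone_iff:
  assumes "i \<in> OP G" "c \<in> H1 G"
  shows "to_real c \<in> cone_of G i \<longleftrightarrow> pos_darts c \<subseteq> oriented_darts G i"
  using cone_of_iff[OF G, of "fst i" "snd i" "to_real c"] assms by simp

text \<open>In a common cone no two coefficients have opposite signs, so nothing cancels. Membership
  of a sum in a cone can therefore be tested on the summands.\<close>

lemma pos_darts_add:
  assumes c: "c \<in> H1 G" "c' \<in> H1 G" and cc: "common_cone G c c'"
  shows "pos_darts (c + c') = pos_darts c \<union> pos_darts c'"
proof -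
  have dir: "0 \<le> b $ d" if "a \<in> H1 G" "b \<in> H1 G" "0 < a $ d" "common_cone G a b"
    for a b :: "int ^ 'd" and d
  proof (rule ccontr)
    assume "\<not> 0 \<le> b $ d"
    then have "flip G d \<in> pos_darts b" using neg_dart[OF G H1_chains[OF that(2)]] by simp
    then show False using that common_cone_iff[OF G] by (auto simp: pos_darts_def)
  qed
  have cc': "common_cone G c' c" using cc common_cone_sym by blast
  show ?thesis
  proof (intro equalityI subsetI)
    fix d assume "d \<in> pos_darts c \<union> pos_darts c'"
    then show "d \<in> pos_darts (c + c')"
      using dir[OF c, of d] dir[OF c(2,1), of d] cc cc' by (fastforce simp: pos_darts_def)
  next
    fix d assume "d \<in> pos_darts (c + c')"
    then have "0 < c $ d \<or> 0 < c' $ d" by (auto simp: pos_darts_def)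
    then show "d \<in> pos_darts c \<union> pos_darts c'" by (auto simp: pos_darts_def)
  qed
qed

lemma common_cone_of_index:
  assumes i: "i \<in> OP G" and c: "c \<in> H1 G" "c' \<in> H1 G"
    and sub: "pos_darts c \<subseteq> oriented_darts G i" "pos_darts c' \<subseteq> oriented_darts G i"
  shows "common_cone G c c'"
  unfolding common_cone_iff[OF G c]
proof (intro ballI notI)
  fix d assume "d \<in> pos_darts c" "flip G d \<in> pos_darts c'"
  then have "d \<in> oriented_darts G i" "flip G d \<in> oriented_darts G i" using sub by blast+
  then show False using oriented_dartsD(4)[OF G, of "fst i" "snd i" d] i by simp
qed

text \<open>All inequalities of the cone are strict at \<open>c\<close>, so every index whose cone
  contains \<open>c\<close> lies above this one.\<close>

lemma exact_index:
  fixes c :: "int ^ 'd"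
  assumes c: "c \<in> H1 G"
  obtains i where "i \<in> OP G" "oriented_darts G i = pos_darts c"
proof -
  have "to_real c \<in> H1 G" using c by simp
  then obtain \<phi> where "({e \<in> edges G. \<forall>d\<in>e. to_real c $ d = 0}, \<phi>) \<in> OP G"
    "oriented_darts G ({e \<in> edges G. \<forall>d\<in>e. to_real c $ d = 0}, \<phi>) = pos_darts (to_real c)"
    using sign_index[OF G] by blast
  then show ?thesis using that by (simp only: pos_darts_to_real)
qed

lemma common_cone_self:
  assumes "c \<in> H1 G"
  shows "common_cone G c c"
proof -
  obtain i where "i \<in> OP G" "oriented_darts G i = pos_darts c" by (rule exact_index[OF assms])
  then show ?thesis using common_cone_of_index[OF _ assms assms] by simp
qed

lemma common_cone_pos_cong:
  assumes "c \<in> H1 G" "c' \<in> H1 G" "b \<in> H1 G" "b' \<in> H1 G"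
    and "pos_darts c = pos_darts b" "pos_darts c' = pos_darts b'"
  shows "common_cone G c c' \<longleftrightarrow> common_cone G b b'"
  using assms common_cone_iff[OF G] by simp

section \<open>The cographic ring\<close>

lemma cographic_mult_closed:
  assumes "Poly_Mapping.keys p \<subseteq> H1 G" "Poly_Mapping.keys q \<subseteq> H1 G"
  shows "Poly_Mapping.keys (p \<otimes>\<^bsub>cographic_ring G\<^esub> q) \<subseteq> H1 G"
proof -
  have "Poly_Mapping.keys (if common_cone G c c'
      then Poly_Mapping.single (c + c') (Poly_Mapping.lookup p c * Poly_Mapping.lookup q c') else 0) \<subseteq> H1 G"
    if "c \<in> Poly_Mapping.keys p" "c' \<in> Poly_Mapping.keys q" for c c'
    using that assms by (auto simp: H1_add subset_iff)
  then show ?thesis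
    unfolding cographic_ring_def monoid.simps
    by (intro order_trans[OF Poly_Mapping.keys_sum] UN_least)
qed

text \<open>Two points of the cone share a cone of the fan, so products inside it are never
  truncated. Conversely, without cancellation a sum lies in the cone only if both summands do, so no
  product enters it from outside.\<close>

lemma cone_proj_mult:
  assumes i: "i \<in> OP G" and pq: "Poly_Mapping.keys p \<subseteq> H1 G" "Poly_Mapping.keys q \<subseteq> H1 G"
  shows "cone_proj G i (p \<otimes>\<^bsub>cographic_ring G\<^esub> q) = cone_proj G i p * cone_proj G i q"
proof -
  have *: "(common_cone G c c' \<and> to_real (c + c') \<in> cone_of G i) \<longleftrightarrow>
      to_real c \<in> cone_of G i \<and> to_real c' \<in> cone_of G i"
    if "c \<in> H1 G" "c' \<in> H1 G" for c c'
    using common_cone_of_index[OF i that] pos_darts_add[OF that]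
    by (auto simp: lattice_cone_iff[OF i] that H1_add)
  show ?thesis
    unfolding cographic_ring_def monoid.simps cone_proj_eq monomial_map_sum
    unfolding monomial_map_def[of _ id p] monomial_map_def[of _ id q] sum_product
    by (intro sum.cong refl)
      (use * pq in \<open>auto simp: monomial_map_single if_distrib mult_single subset_iff\<close>)
qed

text \<open>The cone projections are jointly injective, because every lattice point lies in a cone.
  The ring laws of \<open>cographic_ring G\<close> are thereby inherited from those of the semigroup rings.\<close>

lemma cone_proj_eqI:
  assumes pq: "Poly_Mapping.keys p \<subseteq> H1 G" "Poly_Mapping.keys q \<subseteq> H1 G"
    and eq: "\<And>i. i \<in> OP G \<Longrightarrow> cone_proj G i p = cone_proj G i q"
  shows "p = q"
proof (rule poly_mapping_eqI)
  fix c
  show "Poly_Mapping.lookup p c = Poly_Mapping.lookup q c"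
  proof (cases "c \<in> H1 G")
    case True
    obtain i where i: "i \<in> OP G" "oriented_darts G i = pos_darts c" by (rule exact_index[OF True])
    then have "to_real c \<in> cone_of G i" using lattice_cone_iff True by simp
    then show ?thesis
      using arg_cong[OF eq[OF i(1)], of "\<lambda>r. Poly_Mapping.lookup r c"]
      by (simp add: cone_proj_eq lookup_monomial_map_id)
  next
    case False
    then show ?thesis using pq by (metis in_keys_iff subsetD)
  qed
qed

lemma cone_proj_one: "i \<in> OP G \<Longrightarrow> cone_proj G i (Xpow 0) = 1"
  unfolding cone_proj_eq Xpow_def monomial_map_single by (simp add: lattice_cone_iff)

lemma cographic_cring: "cring (cographic_ring G :: ('k::field, (int ^ 'd) \<Rightarrow>\<^sub>0 'k) module)"
proof (rule cringI)
  let ?R = "cographic_ring G :: ('k, (int ^ 'd) \<Rightarrow>\<^sub>0 'k) module"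
  have [simp]: "add ?R = (+)" "zero ?R = 0" "one ?R = Xpow 0" by (simp_all add: cographic_ring_def)
  note [simp] = cographic_ring_carrier keys_add_H1 cographic_mult_closed cone_proj_mult cone_proj_one
  have pa: "cone_proj G i (p + q) = cone_proj G i p + cone_proj G i q" for i and p q :: "(int ^ 'd) \<Rightarrow>\<^sub>0 'k"
    by (simp add: cone_proj_eq monomial_map_add)
  have X0: "Poly_Mapping.keys (Xpow 0 :: (int ^ 'd) \<Rightarrow>\<^sub>0 'k) \<subseteq> H1 G" by (simp add: Xpow_def)
  show "abelian_group ?R"
  proof (rule abelian_groupI)
    fix x assume "x \<in> carrier ?R"
    then show "\<exists>y\<in>carrier ?R. y \<oplus>\<^bsub>?R\<^esub> x = \<zero>\<^bsub>?R\<^esub>"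
      by (intro bexI[of _ "- x"]) simp_all
  qed (auto simp: ac_simps)
  show "comm_monoid ?R"
    by (rule comm_monoidI) (simp_all add: X0, (rule cone_proj_eqI; simp add: X0 ac_simps)+)
  fix x y z assume "x \<in> carrier ?R" "y \<in> carrier ?R" "z \<in> carrier ?R"
  then show "(x \<oplus>\<^bsub>?R\<^esub> y) \<otimes>\<^bsub>?R\<^esub> z = x \<otimes>\<^bsub>?R\<^esub> z \<oplus>\<^bsub>?R\<^esub> y \<otimes>\<^bsub>?R\<^esub> z"
    by - (rule cone_proj_eqI, simp_all add: pa distrib_right)
qed

lemma lattice_cone_mem: "i \<in> OP G \<Longrightarrow>
    c \<in> lattice_cone G i \<longleftrightarrow> c \<in> H1 G \<and> pos_darts c \<subseteq> oriented_darts G i"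
  unfolding lattice_cone_def using lattice_cone_iff by blast

lemma lattice_cone_add:
  assumes i: "i \<in> OP G" and "c \<in> lattice_cone G i" "c' \<in> lattice_cone G i"
  shows "c + c' \<in> lattice_cone G i"
  using assms common_cone_of_index[OF i] pos_darts_add by (simp add: lattice_cone_mem H1_add)

lemma semigroup_ring_cring:
  assumes i: "i \<in> OP G"
  shows "cring (semigroup_ring G i :: ('k::field, (int ^ 'd) \<Rightarrow>\<^sub>0 'k) module)"
proof (rule cring_of_comm_ring_1)
  fix p q :: "(int ^ 'd) \<Rightarrow>\<^sub>0 'k"
  assume pq: "p \<in> carrier (semigroup_ring G i)" "q \<in> carrier (semigroup_ring G i)"
  show "p + q \<in> carrier (semigroup_ring G i)"
    using pq Poly_Mapping.keys_add[of p q] by (auto simp: semigroup_ring_def)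
  show "p * q \<in> carrier (semigroup_ring G i)"
  proof -
    have "c \<in> lattice_cone G i" if c: "c \<in> Poly_Mapping.keys (p * q)" for c
    proof -
      obtain a b where "c = a + b" "a \<in> Poly_Mapping.keys p" "b \<in> Poly_Mapping.keys q"
        using c keys_mult[of p q] by blast
      then show ?thesis using pq lattice_cone_add[OF i, of a b] by (auto simp: semigroup_ring_def)
    qed
    then show ?thesis by (auto simp: semigroup_ring_def)
  qed
qed (auto simp: semigroup_ring_def lattice_cone_mem[OF i])

section \<open>Evaluation at circuit classes\<close>

lemma circuit_sum_H1: "Poly_Mapping.keys m \<subseteq> Cir G \<Longrightarrow> circuit_sum m \<in> H1 G"
  unfolding circuit_sum_def by (intro H1_sum H1_scale circuit_class_H1[OF G]) auto

lemma Xpow_mult: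
  assumes "c \<in> H1 G" "c' \<in> H1 G"
  shows "Xpow c \<otimes>\<^bsub>cographic_ring G\<^esub> Xpow c' =
    (if common_cone G c c' then Xpow (c + c') else 0 :: (int ^ 'd) \<Rightarrow>\<^sub>0 'k::field)"
  by (simp add: cographic_ring_def Xpow_def)

lemma Xpow_nat_pow:
  assumes c: "c \<in> H1 G"
  shows "Xpow c [^]\<^bsub>(cographic_ring G :: ('k::field, _) module)\<^esub> n = Xpow (int n *s c)"
proof (induction n)
  case 0
  then show ?case by (simp add: cographic_ring_def)
next
  case (Suc n)
  \<comment> \<open>The zero multiple has no positive darts and is treated apart; a positive
    multiple has those of \<open>c\<close>.\<close>
  have "common_cone G (int n *s c) c"
  proof (cases "n = 0")
    case True
    then show ?thesis using common_cone_iff[OF G] c by simp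
  next
    case False
    then show ?thesis
      using common_cone_pos_cong[OF H1_scale[OF c] c c c] common_cone_self[OF c]
      by (simp add: pos_darts_scale)
  qed
  moreover have "c + int n *s c = int (Suc n) *s c" by (simp add: vec_eq_iff algebra_simps)
  ultimately show ?case using Suc by (simp add: Xpow_mult H1_scale c add.commute)
qed

text \<open>A circuit concordant with each circuit of \<open>A\<close> shares a cone with their
  whole sum, because the positive darts of that sum are the union over \<open>A\<close>. So
  \<open>pos_darts_add\<close> applies at every step of the induction.\<close>

lemma pos_darts_weighted_sum:
  assumes "finite A" "A \<subseteq> Cir G" "pairwise_concordant A" "\<And>\<gamma>. \<gamma> \<in> A \<Longrightarrow> 0 < n \<gamma>"
  shows "pos_darts (\<Sum>\<gamma>\<in>A. int (n \<gamma>) *s circuit_class \<gamma>) = (\<Union>\<gamma>\<in>A. pos_darts (circuit_class \<gamma>))"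
  using assms
proof (induction A)
  case (insert \<gamma> A)
  let ?a = "int (n \<gamma>) *s circuit_class \<gamma>" and ?b = "\<Sum>\<gamma>\<in>A. int (n \<gamma>) *s circuit_class \<gamma>"
  have IH: "pos_darts ?b = (\<Union>\<gamma>\<in>A. pos_darts (circuit_class \<gamma>))"
    using insert by (simp add: pairwise_concordant_def)
  have H: "?a \<in> H1 G" "?b \<in> H1 G"
    using insert.prems(1) by (auto intro!: H1_sum H1_scale circuit_class_H1[OF G])
  have pa: "pos_darts ?a = pos_darts (circuit_class \<gamma>)" using insert.prems by (simp add: pos_darts_scale)
  have "common_cone G (circuit_class \<gamma>) (circuit_class \<delta>)" if "\<delta> \<in> A" for \<delta>
    using that insert.prems concordant_iff[OF G, of \<gamma> \<delta>] by (auto simp: pairwise_concordant_def)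
  then have "flip G d \<notin> pos_darts (circuit_class \<delta>)"
    if "d \<in> pos_darts (circuit_class \<gamma>)" "\<delta> \<in> A" for d \<delta>
    using that insert.prems(1) common_cone_iff[OF G circuit_class_H1[OF G] circuit_class_H1[OF G]]
    by blast
  then have "common_cone G ?a ?b"
    unfolding common_cone_iff[OF G H] pa IH by blast
  then show ?case using insert pos_darts_add[OF H] pa IH by simp
qed simp

text \<open>Positive multiples keep their signs, and the signs of a concordant sum are the union of
  those of its terms. Sharing a cone with the partial sum thus means concordance with each factor,
  and a single discordant pair kills the product.\<close>

lemma finprod_cographic:
  assumes "finite A" "A \<subseteq> Cir G" "\<And>\<gamma>. \<gamma> \<in> A \<Longrightarrow> 0 < n \<gamma>"
  shows "(\<Otimes>\<^bsub>(cographic_ring G :: ('k::field, _) module)\<^esub>\<gamma>\<in>A.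
      Xpow (circuit_class \<gamma>) [^]\<^bsub>(cographic_ring G :: ('k, _) module)\<^esub> n \<gamma>) =
    (if pairwise_concordant A then Xpow (\<Sum>\<gamma>\<in>A. int (n \<gamma>) *s circuit_class \<gamma>) else 0)"
  using assms
proof (induction A)
  let ?R = "cographic_ring G :: ('k, (int ^ 'd) \<Rightarrow>\<^sub>0 'k) module"
  interpret R: cring ?R by (rule cographic_cring)
  case empty
  show ?case by (simp add: pairwise_concordant_def) (simp add: cographic_ring_def)
next
  let ?R = "cographic_ring G :: ('k, (int ^ 'd) \<Rightarrow>\<^sub>0 'k) module"
  interpret R: cring ?R by (rule cographic_cring)
  have z: "zero ?R = 0" by (simp add: cographic_ring_def)
  case (insert \<gamma> A)
  let ?a = "int (n \<gamma>) *s circuit_class \<gamma>" and ?b = "\<Sum>\<gamma>\<in>A. int (n \<gamma>) *s circuit_class \<gamma>"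
  have H: "?a \<in> H1 G" "?b \<in> H1 G"
    using insert.prems(1) by (auto intro!: H1_sum H1_scale circuit_class_H1[OF G])
  have X: "Xpow c \<in> carrier ?R" if "c \<in> H1 G" for c using that by (simp add: cographic_ring_def Xpow_def)
  have pw: "Xpow (circuit_class \<delta>) [^]\<^bsub>?R\<^esub> n \<delta> = Xpow (int (n \<delta>) *s circuit_class \<delta>)"
    if "\<delta> \<in> insert \<gamma> A" for \<delta>
    using that insert.prems(1) Xpow_nat_pow[OF circuit_class_H1[OF G]] by blast
  have cl: "Xpow (circuit_class \<delta>) [^]\<^bsub>?R\<^esub> n \<delta> \<in> carrier ?R" if "\<delta> \<in> insert \<gamma> A" for \<delta>
    unfolding pw[OF that] using that insert.prems(1) by (auto intro!: X H1_scale circuit_class_H1[OF G])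
  have IH: "(\<Otimes>\<^bsub>?R\<^esub>\<gamma>\<in>A. Xpow (circuit_class \<gamma>) [^]\<^bsub>?R\<^esub> n \<gamma>) =
      (if pairwise_concordant A then Xpow ?b else 0)"
    using insert by simp
  have "(\<Otimes>\<^bsub>?R\<^esub>\<gamma>\<in>insert \<gamma> A. Xpow (circuit_class \<gamma>) [^]\<^bsub>?R\<^esub> n \<gamma>) =
      Xpow ?a \<otimes>\<^bsub>?R\<^esub> (if pairwise_concordant A then Xpow ?b else 0)"
    unfolding IH[symmetric]
  proof (subst R.finprod_insert)
    show "(\<lambda>\<gamma>. Xpow (circuit_class \<gamma>) [^]\<^bsub>?R\<^esub> n \<gamma>) \<in> A \<rightarrow> carrier ?R"
      using cl by blast
    show "Xpow (circuit_class \<gamma>) [^]\<^bsub>?R\<^esub> n \<gamma> \<in> carrier ?R" using cl by blast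
  qed (use insert.hyps pw[of \<gamma>] in simp_all)
  also have "\<dots> = (if pairwise_concordant (insert \<gamma> A) then Xpow (?a + ?b) else 0)"
  proof (cases "pairwise_concordant A")
    case False
    then have "\<not> pairwise_concordant (insert \<gamma> A)" by (auto simp: pairwise_concordant_def)
    then show ?thesis using False R.r_null[OF X[OF H(1)]] by (simp add: z)
  next
    case True
    have g: "\<gamma> \<in> Cir G" "A \<subseteq> Cir G" using insert.prems by auto
    note cH = circuit_class_H1[OF G]
    have cc: "concordant \<gamma> \<delta> \<longleftrightarrow> (\<forall>d\<in>pos_darts (circuit_class \<gamma>). flip G d \<notin> pos_darts (circuit_class \<delta>))"
      if "\<delta> \<in> A" for \<delta>
      using concordant_iff[OF G g(1), of \<delta>] common_cone_iff[OF G cH[OF g(1)] cH[of \<delta>]] that g(2) by auto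
    have sym: "concordant \<gamma> \<delta> \<Longrightarrow> concordant \<delta> \<gamma>" for \<delta>
      by (cases \<gamma>; cases \<delta>) (auto simp: concordant_def)
    have refl: "concordant \<gamma> \<gamma>" by (cases \<gamma>) (auto simp: concordant_def)
    have pa: "pos_darts ?a = pos_darts (circuit_class \<gamma>)" using insert.prems by (simp add: pos_darts_scale)
    have pb: "pos_darts ?b = (\<Union>\<gamma>\<in>A. pos_darts (circuit_class \<gamma>))"
      by (rule pos_darts_weighted_sum[OF insert.hyps(1) g(2) True]) (use insert.prems in auto)
    have "common_cone G ?a ?b \<longleftrightarrow> (\<forall>\<delta>\<in>A. concordant \<gamma> \<delta>)"
      unfolding common_cone_iff[OF G H] pa pb using cc by auto
    also have "\<dots> \<longleftrightarrow> pairwise_concordant (insert \<gamma> A)"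
      unfolding pairwise_concordant_def using True[unfolded pairwise_concordant_def] sym refl
      by (metis insert_iff)
    finally show ?thesis using True by (simp add: Xpow_mult H)
  qed
  finally show ?case using insert.hyps by simp
qed

lemma poly_eval_cographic:
  assumes p: "p \<in> carrier (poly_algebra (Cir G) :: ('k::field, _) module)"
  shows "poly_eval (cographic_ring G :: ('k, _) module) (\<lambda>\<gamma>. Xpow (circuit_class \<gamma>)) p =
    monomial_map (\<lambda>m. pairwise_concordant (Poly_Mapping.keys m)) circuit_sum p"
proof (rule poly_eval_eq_monomial_map)
  show "abelian_monoid (cographic_ring G :: ('k, _) module)"
    using cographic_cring cring.axioms(1) ring.is_abelian_group abelian_group.axioms(1) by blast
  fix m assume "m \<in> Poly_Mapping.keys p"
  then have m: "Poly_Mapping.keys m \<subseteq> Cir G" using p by (simp add: poly_algebra_def)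
  show "(\<Otimes>\<^bsub>(cographic_ring G :: ('k, _) module)\<^esub>x\<in>Poly_Mapping.keys m.
      Xpow (circuit_class x) [^]\<^bsub>(cographic_ring G :: ('k, _) module)\<^esub> Poly_Mapping.lookup m x) =
      (if pairwise_concordant (Poly_Mapping.keys m) then Poly_Mapping.single (circuit_sum m) 1 else 0)"
    by (subst finprod_cographic) (use m in \<open>auto simp: in_keys_iff circuit_sum_def Xpow_def\<close>)
  show "Poly_Mapping.single (circuit_sum m) r \<in> carrier (cographic_ring G :: ('k, _) module)" for r
    using circuit_sum_H1[OF m] by (simp add: cographic_ring_def)
qed (simp_all add: cographic_ring_def)

lemma poly_eval_semigroup_ring:
  assumes i: "i \<in> OP G" and p: "p \<in> carrier (poly_algebra (Cir_of G i) :: ('k::field, _) module)"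
  shows "poly_eval (semigroup_ring G i :: ('k, _) module) (\<lambda>\<gamma>. Xpow (circuit_class \<gamma>)) p =
    monomial_map (\<lambda>m. True) circuit_sum p"
proof (rule poly_eval_eq_monomial_map)
  let ?S = "semigroup_ring G i :: ('k, (int ^ 'd) \<Rightarrow>\<^sub>0 'k) module"
  interpret S: cring ?S by (rule semigroup_ring_cring[OF i])
  show "abelian_monoid ?S" by (rule S.abelian_monoid_axioms)
  fix m assume "m \<in> Poly_Mapping.keys p"
  then have m: "Poly_Mapping.keys m \<subseteq> Cir_of G i" using p by (simp add: poly_algebra_def)
  have pow: "Xpow c [^]\<^bsub>?S\<^esub> n = Xpow (int n *s c)" for c and n :: nat
  proof (induction n)
    case 0
    then show ?case by (simp add: semigroup_ring_def Xpow_def)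
  next
    case (Suc n)
    have "c + int n *s c = int (Suc n) *s c" by (simp add: vec_eq_iff algebra_simps)
    then show ?case using Suc by (simp add: semigroup_ring_def Xpow_def mult_single add.commute)
  qed
  have lat: "int n *s circuit_class \<gamma> \<in> lattice_cone G i" if "\<gamma> \<in> Cir_of G i" for \<gamma> n
    using that circuit_class_H1[OF G]
    by (cases "n = 0") (auto simp: lattice_cone_mem[OF i] Cir_of_iff[OF G i] H1_scale pos_darts_scale)
  have "(\<Otimes>\<^bsub>?S\<^esub>\<gamma>\<in>A. Xpow (circuit_class \<gamma>) [^]\<^bsub>?S\<^esub> n \<gamma>) =
      Xpow (\<Sum>\<gamma>\<in>A. int (n \<gamma>) *s circuit_class \<gamma>)"
    if "finite A" "A \<subseteq> Cir_of G i" for A and n :: "('v, 'd) circuit \<Rightarrow> nat"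
    using that
  proof (induction A)
    case empty
    show ?case by simp (simp add: semigroup_ring_def Xpow_def)
  next
    case (insert \<gamma> A)
    have "Xpow (circuit_class \<delta>) [^]\<^bsub>?S\<^esub> n \<delta> \<in> carrier ?S" if "\<delta> \<in> insert \<gamma> A" for \<delta>
    proof -
      have "\<delta> \<in> Cir_of G i" using that insert.prems by auto
      from lat[OF this] show ?thesis unfolding pow by (simp add: semigroup_ring_def Xpow_def)
    qed
    then show ?case
      using insert by (subst S.finprod_insert) (auto simp: pow, simp add: semigroup_ring_def Xpow_def mult_single)
  qed
  then show "(\<Otimes>\<^bsub>?S\<^esub>x\<in>Poly_Mapping.keys m. Xpow (circuit_class x) [^]\<^bsub>?S\<^esub> Poly_Mapping.lookup m x) =
      (if True then Poly_Mapping.single (circuit_sum m) 1 else 0)"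
    using m by (simp add: circuit_sum_def Xpow_def)
  have "(\<Sum>\<gamma>\<in>A. int (n \<gamma>) *s circuit_class \<gamma>) \<in> lattice_cone G i"
    if "finite A" "A \<subseteq> Cir_of G i" for A and n :: "('v, 'd) circuit \<Rightarrow> nat"
  proof -
    have "0 \<in> lattice_cone G i" by (simp add: lattice_cone_mem[OF i])
    with that show ?thesis by (induction A) (auto intro: lattice_cone_add[OF i] lat)
  qed
  then show "Poly_Mapping.single (circuit_sum m) r \<in> carrier ?S" for r
    using m by (simp add: circuit_sum_def semigroup_ring_def)
qed (simp_all add: semigroup_ring_def)

end

section \<open>The homomorphism from the polynomial ring on circuits to the cographic ring\<close>

lemma poly_algebra_keys:
  "p \<in> carrier (poly_algebra S) \<Longrightarrow> m \<in> Poly_Mapping.keys p \<Longrightarrow> Poly_Mapping.keys m \<subseteq> S"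
  by (simp add: poly_algebra_def)

context
  fixes G :: "('v, 'd::finite) graph"
  assumes G: "finite_graph G"
begin

lemma OP_index_pairwise_concordant:
  assumes i: "i \<in> OP G" and A: "A \<subseteq> Cir_of G i"
  shows "pairwise_concordant A"
  unfolding pairwise_concordant_def
proof (intro ballI)
  fix \<gamma> \<delta> assume "\<gamma> \<in> A" "\<delta> \<in> A"
  then have g: "\<gamma> \<in> Cir G" "pos_darts (circuit_class \<gamma>) \<subseteq> oriented_darts G i"
    "\<delta> \<in> Cir G" "pos_darts (circuit_class \<delta>) \<subseteq> oriented_darts G i"
    using A Cir_of_iff[OF G i] by blast+
  show "concordant \<gamma> \<delta>"
    using common_cone_of_index[OF G i circuit_class_H1[OF G g(1)] circuit_class_H1[OF G g(3)] g(2,4)]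
    by (simp add: concordant_iff[OF G g(1,3)])
qed

lemma pos_darts_circuit_sum:
  assumes "Poly_Mapping.keys m \<subseteq> Cir G" "pairwise_concordant (Poly_Mapping.keys m)"
  shows "pos_darts (circuit_sum m) = (\<Union>\<gamma>\<in>Poly_Mapping.keys m. pos_darts (circuit_class \<gamma>))"
  unfolding circuit_sum_def
  by (rule pos_darts_weighted_sum[OF G _ assms]) (simp_all add: in_keys_iff)

text \<open>The positive darts of a concordant sum are the union over its circuits, and the circuits
  of one index are automatically concordant. This translates a condition on the image of a monomial
  into one on its variables.\<close>

lemma circuit_sum_in_cone_iff:
  assumes i: "i \<in> OP G" and m: "Poly_Mapping.keys m \<subseteq> Cir G"
  shows "pairwise_concordant (Poly_Mapping.keys m) \<and> pos_darts (circuit_sum m) \<subseteq> oriented_darts G i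
    \<longleftrightarrow> Poly_Mapping.keys m \<subseteq> Cir_of G i"
proof
  assume "pairwise_concordant (Poly_Mapping.keys m) \<and> pos_darts (circuit_sum m) \<subseteq> oriented_darts G i"
  then show "Poly_Mapping.keys m \<subseteq> Cir_of G i"
    using pos_darts_circuit_sum[OF m] m Cir_of_iff[OF G i] by blast
next
  assume sub: "Poly_Mapping.keys m \<subseteq> Cir_of G i"
  then have "pairwise_concordant (Poly_Mapping.keys m)" by (rule OP_index_pairwise_concordant[OF i])
  moreover have "pos_darts (circuit_class \<gamma>) \<subseteq> oriented_darts G i" if "\<gamma> \<in> Poly_Mapping.keys m" for \<gamma>
    using that sub Cir_of_iff[OF G i] by blast
  ultimately show "pairwise_concordant (Poly_Mapping.keys m) \<and> pos_darts (circuit_sum m) \<subseteq> oriented_darts G i"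
    using pos_darts_circuit_sum[OF m] by (metis UN_least)
qed

abbreviation concordant_eval :: "((('v, 'd) circuit \<Rightarrow>\<^sub>0 nat) \<Rightarrow>\<^sub>0 'k::field) \<Rightarrow> (int ^ 'd) \<Rightarrow>\<^sub>0 'k" where
  "concordant_eval \<equiv> monomial_map (\<lambda>m. pairwise_concordant (Poly_Mapping.keys m)) circuit_sum"

lemma cone_proj_concordant_eval:
  assumes i: "i \<in> OP G" and p: "p \<in> carrier (poly_algebra (Cir G))"
  shows "cone_proj G i (concordant_eval p) =
    monomial_map (\<lambda>m. Poly_Mapping.keys m \<subseteq> Cir_of G i) circuit_sum p"
  unfolding cone_proj_eq monomial_map_comp id_comp
proof (rule monomial_map_cong)
  fix m assume "m \<in> Poly_Mapping.keys p"
  then have m: "Poly_Mapping.keys m \<subseteq> Cir G" by (rule poly_algebra_keys[OF p])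
  show "(pairwise_concordant (Poly_Mapping.keys m) \<and> to_real (circuit_sum m) \<in> cone_of G i) =
      (Poly_Mapping.keys m \<subseteq> Cir_of G i)"
    using circuit_sum_in_cone_iff[OF i m] lattice_cone_iff[OF G i circuit_sum_H1[OF G m]] by simp
qed

lemma concordant_eval_carrier:
  assumes p: "p \<in> carrier (poly_algebra (Cir G))"
  shows "Poly_Mapping.keys (concordant_eval p) \<subseteq> H1 G"
proof (rule order_trans[OF keys_monomial_map])
  show "circuit_sum ` {m \<in> Poly_Mapping.keys p. pairwise_concordant (Poly_Mapping.keys m)} \<subseteq> H1 G"
    using circuit_sum_H1[OF G poly_algebra_keys[OF p]] by blast
qed

text \<open>Pairwise concordance of a product is not a condition on the two factors separately, so
  \<open>monomial_map_mult\<close> does not apply directly. After projection to a cone the condition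
  becomes \<open>Poly_Mapping.keys m \<subseteq> Cir_of G i\<close>, which does split, and the
  projections are jointly injective.\<close>

lemma concordant_eval_mult:
  assumes p: "p \<in> carrier (poly_algebra (Cir G) :: ('k::field, _) module)"
    and q: "q \<in> carrier (poly_algebra (Cir G) :: ('k, _) module)"
  shows "concordant_eval (p * q) = concordant_eval p \<otimes>\<^bsub>cographic_ring G\<^esub> concordant_eval q"
proof (rule cone_proj_eqI[OF G])
  interpret P: cring "poly_algebra (Cir G) :: ('k, (('v, 'd) circuit \<Rightarrow>\<^sub>0 nat) \<Rightarrow>\<^sub>0 'k) module"
    by (rule poly_algebra_cring)
  have pq: "p * q \<in> carrier (poly_algebra (Cir G))"
    using P.m_closed[OF p q] by (simp add: poly_algebra_def)
  show "Poly_Mapping.keys (concordant_eval (p * q)) \<subseteq> H1 G" by (rule concordant_eval_carrier[OF pq])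
  show "Poly_Mapping.keys (concordant_eval p \<otimes>\<^bsub>cographic_ring G\<^esub> concordant_eval q) \<subseteq> H1 G"
    by (intro cographic_mult_closed[OF G] concordant_eval_carrier p q)
  fix i assume i: "i \<in> OP G"
  have "Poly_Mapping.keys (m + m') = Poly_Mapping.keys m \<union> Poly_Mapping.keys m'"
    for m m' :: "('v, 'd) circuit \<Rightarrow>\<^sub>0 nat"
    by (auto simp: in_keys_iff lookup_add)
  then have "cone_proj G i (concordant_eval (p * q)) = cone_proj G i (concordant_eval p) * cone_proj G i (concordant_eval q)"
    unfolding cone_proj_concordant_eval[OF i pq] cone_proj_concordant_eval[OF i p] cone_proj_concordant_eval[OF i q]
    by (intro monomial_map_mult) (simp_all add: circuit_sum_add)
  then show "cone_proj G i (concordant_eval (p * q)) =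
      cone_proj G i (concordant_eval p \<otimes>\<^bsub>cographic_ring G\<^esub> concordant_eval q)"
    by (simp add: cone_proj_mult[OF G i concordant_eval_carrier[OF p] concordant_eval_carrier[OF q]])
qed

lemma poly_eval_alg_hom:
  "poly_eval (cographic_ring G) (\<lambda>\<gamma>. Xpow (circuit_class \<gamma>)) \<in>
    alg_hom (poly_algebra (Cir G)) (cographic_ring G :: ('k::field, (int ^ 'd) \<Rightarrow>\<^sub>0 'k) module)"
    (is "?\<pi> \<in> alg_hom ?P ?R")
proof -
  interpret P: cring ?P by (rule poly_algebra_cring)
  have ops: "mult ?P = (*)" "add ?P = (+)" "one ?P = 1" "smult ?P = (\<lambda>r. Poly_Mapping.map ((*) r))"
    "add ?R = (+)" "one ?R = Xpow 0" "smult ?R = (\<lambda>r. Poly_Mapping.map ((*) r))"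
    by (simp_all add: poly_algebra_def cographic_ring_def)
  have pi: "?\<pi> p = concordant_eval p" if "p \<in> carrier ?P" for p
    by (rule poly_eval_cographic[OF G that])
  have "?\<pi> \<in> ring_hom ?P ?R"
  proof (rule ring_hom_memI)
    fix p q assume p: "p \<in> carrier ?P" and q: "q \<in> carrier ?P"
    show "?\<pi> p \<in> carrier ?R"
      unfolding pi[OF p] using concordant_eval_carrier[OF p] by (simp add: cographic_ring_def)
    show "?\<pi> (p \<otimes>\<^bsub>?P\<^esub> q) = ?\<pi> p \<otimes>\<^bsub>?R\<^esub> ?\<pi> q"
      unfolding pi[OF p] pi[OF q] pi[OF P.m_closed[OF p q]] using concordant_eval_mult[OF p q]
      by (simp add: ops)
    show "?\<pi> (p \<oplus>\<^bsub>?P\<^esub> q) = ?\<pi> p \<oplus>\<^bsub>?R\<^esub> ?\<pi> q"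
      unfolding pi[OF p] pi[OF q] pi[OF P.a_closed[OF p q]] by (simp add: ops monomial_map_add)
  next
    have "concordant_eval (Poly_Mapping.single 0 1 :: _ \<Rightarrow>\<^sub>0 'k) = Xpow 0"
      unfolding monomial_map_single by (simp add: pairwise_concordant_def circuit_sum_def Xpow_def)
    then show "?\<pi> \<one>\<^bsub>?P\<^esub> = \<one>\<^bsub>?R\<^esub>"
      unfolding pi[OF P.one_closed] by (simp add: ops)
  qed
  moreover have "?\<pi> (r \<odot>\<^bsub>?P\<^esub> p) = r \<odot>\<^bsub>?R\<^esub> ?\<pi> p" if p: "p \<in> carrier ?P" for r p
  proof -
    have "Poly_Mapping.map ((*) r) p \<in> carrier ?P"
      using p keys_map_scale[of r p] by (auto simp: poly_algebra_def)
    then show ?thesis unfolding pi[OF p] ops by (simp add: pi monomial_map_scale)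
  qed
  ultimately show ?thesis by (simp add: alg_hom_def)
qed

lemma poly_eval_Var:
  assumes "\<gamma> \<in> Cir G"
  shows "poly_eval (cographic_ring G) (\<lambda>\<gamma>. Xpow (circuit_class \<gamma>)) (Var \<gamma>) =
    (Xpow (circuit_class \<gamma>) :: (int ^ 'd) \<Rightarrow>\<^sub>0 'k::field)"
proof -
  have c: "(Var \<gamma> :: _ \<Rightarrow>\<^sub>0 'k) \<in> carrier (poly_algebra (Cir G))"
    using assms by (simp add: Var_def poly_algebra_def)
  have "concordant \<gamma> \<gamma>" by (cases \<gamma>) (simp add: concordant_def)
  then show ?thesis
    using poly_eval_cographic[OF G c] unfolding Var_def monomial_map_single
    by (simp add: pairwise_concordant_def circuit_sum_def Xpow_def)
qed

text \<open>The circuits of a conformal decomposition of \<open>c\<close> all belong to the index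
  given by \<open>exact_index\<close>, so they are pairwise concordant and their monomial survives,
  with image \<open>Xpow c\<close>.\<close>

lemma poly_eval_surj:
  "poly_eval (cographic_ring G) (\<lambda>\<gamma>. Xpow (circuit_class \<gamma>)) ` carrier (poly_algebra (Cir G)) =
    carrier (cographic_ring G :: ('k::field, (int ^ 'd) \<Rightarrow>\<^sub>0 'k) module)"
    (is "?\<pi> ` carrier ?P = carrier ?R")
proof
  show "?\<pi> ` carrier ?P \<subseteq> carrier ?R"
  proof -
    have "?\<pi> \<in> alg_hom ?P ?R" by (rule poly_eval_alg_hom)
    then have "?\<pi> \<in> ring_hom ?P ?R" by (simp add: alg_hom_def)
    then show ?thesis by (auto intro: ring_hom_closed)
  qed
  show "carrier ?R \<subseteq> ?\<pi> ` carrier ?P"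
  proof
    fix q assume q: "q \<in> carrier ?R"
    have "\<exists>m. c \<in> H1 G \<longrightarrow> Poly_Mapping.keys m \<subseteq> Cir G \<and>
        pairwise_concordant (Poly_Mapping.keys m) \<and> circuit_sum m = c" for c
    proof (cases "c \<in> H1 G")
      case True
      obtain m :: "('v, 'd) circuit \<Rightarrow>\<^sub>0 nat" where m: "Poly_Mapping.keys m \<subseteq> Cir G"
        "\<forall>\<gamma>\<in>Poly_Mapping.keys m. pos_darts (circuit_class \<gamma>) \<subseteq> pos_darts c" "circuit_sum m = c"
        using conformal_decomposition[OF G True] unfolding circuit_sum_def by blast
      obtain i where i: "i \<in> OP G" "oriented_darts G i = pos_darts c"
        by (rule exact_index[OF G True])
      have "Poly_Mapping.keys m \<subseteq> Cir_of G i" using m i Cir_of_iff[OF G i(1)] by blast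
      then show ?thesis using OP_index_pairwise_concordant[OF i(1)] m by blast
    qed simp
    then obtain f where f: "\<And>c. c \<in> H1 G \<Longrightarrow> Poly_Mapping.keys (f c) \<subseteq> Cir G"
      "\<And>c. c \<in> H1 G \<Longrightarrow> pairwise_concordant (Poly_Mapping.keys (f c))"
      "\<And>c. c \<in> H1 G \<Longrightarrow> circuit_sum (f c) = c" by metis
    let ?p = "\<Sum>c\<in>Poly_Mapping.keys q. Poly_Mapping.single (f c) (Poly_Mapping.lookup q c)"
    have H: "c \<in> H1 G" if "c \<in> Poly_Mapping.keys q" for c
      using q that by (auto simp: cographic_ring_def)
    have "Poly_Mapping.keys ?p \<subseteq> f ` Poly_Mapping.keys q"
      by (rule order_trans[OF Poly_Mapping.keys_sum]) auto
    then have "Poly_Mapping.keys m \<subseteq> Cir G" if "m \<in> Poly_Mapping.keys ?p" for m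
      using that f(1)[OF H] by blast
    then have p: "?p \<in> carrier ?P" by (simp add: poly_algebra_def)
    have "?\<pi> ?p = (\<Sum>c\<in>Poly_Mapping.keys q. Poly_Mapping.single c (Poly_Mapping.lookup q c))"
      unfolding poly_eval_cographic[OF G p] monomial_map_sum monomial_map_single
      by (intro sum.cong refl) (simp add: f H)
    also have "\<dots> = q" by (rule poly_mapping_expand[symmetric])
    finally show "q \<in> ?\<pi> ` carrier ?P" using p by (rule image_eqI[OF sym])
  qed
qed

section \<open>The inverse limit\<close>

lemma cone_proj_semigroup_ring:
  assumes i: "i \<in> OP G" and p: "Poly_Mapping.keys p \<subseteq> H1 G"
  shows "Poly_Mapping.keys (cone_proj G i p) \<subseteq> lattice_cone G i"
  unfolding cone_proj_eq
  by (rule order_trans[OF keys_monomial_map]) (use p in \<open>auto simp: lattice_cone_def\<close>)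

text \<open>The inverse takes the coefficient of a lattice point at its exact index. Any other index
  whose cone contains the point lies above it, so compatibility of the family forces the same
  coefficient there.\<close>

lemma cographic_ring_limit:
  "(\<lambda>p. \<lambda>i\<in>OP G. cone_proj G i p) \<in> alg_iso (cographic_ring G :: ('k::field, _) module)
    (inverse_limit (OP G) (OP_le G) (semigroup_ring G) (\<lambda>j i. cone_proj G i))"
    (is "?h \<in> alg_iso ?R ?L")
proof -
  have S: "mult (semigroup_ring G i) = (*)" "add (semigroup_ring G i) = (+)" "one (semigroup_ring G i) = 1"
    "smult (semigroup_ring G i) = (\<lambda>r. Poly_Mapping.map ((*) r))"
    for i by (simp_all add: semigroup_ring_def)
  have L: "mult ?L = (\<lambda>x y. \<lambda>i\<in>OP G. x i * y i)" "add ?L = (\<lambda>x y. \<lambda>i\<in>OP G. x i + y i)"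
    "one ?L = (\<lambda>i\<in>OP G. 1)" "smult ?L = (\<lambda>r x. \<lambda>i\<in>OP G. Poly_Mapping.map ((*) r) (x i))"
    by (simp_all add: inverse_limit_def S)
  have Lc: "x \<in> carrier ?L \<longleftrightarrow> x \<in> (\<Pi>\<^sub>E i\<in>OP G. carrier (semigroup_ring G i)) \<and>
    (\<forall>i\<in>OP G. \<forall>j\<in>OP G. OP_le G i j \<longrightarrow> cone_proj G i (x j) = x i)" for x
    by (simp add: inverse_limit_def)
  have Rc: "p \<in> carrier ?R \<longleftrightarrow> Poly_Mapping.keys p \<subseteq> H1 G" for p
    by (rule cographic_ring_carrier)
  have ops: "add ?R = (+)" "one ?R = Xpow 0" "smult ?R = (\<lambda>r. Poly_Mapping.map ((*) r))"
    by (simp_all add: cographic_ring_def)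
  have closed: "?h p \<in> carrier ?L" if p: "p \<in> carrier ?R" for p
    unfolding Lc
  proof (intro conjI ballI impI)
    show "?h p \<in> (\<Pi>\<^sub>E i\<in>OP G. carrier (semigroup_ring G i))"
      using cone_proj_semigroup_ring p by (auto simp: Rc semigroup_ring_def)
    fix i j assume i: "i \<in> OP G" and j: "j \<in> OP G" and le: "OP_le G i j"
    have "to_real c \<in> cone_of G i \<Longrightarrow> to_real c \<in> cone_of G j" if "c \<in> H1 G" for c
      using le OP_le_iff[OF G i j] lattice_cone_iff[OF G _ that] i j by auto
    then have "cone_proj G i (cone_proj G j p) = cone_proj G i p"
      unfolding cone_proj_eq monomial_map_comp id_comp
      by (intro monomial_map_cong) (use p in \<open>auto simp: Rc\<close>)
    then show "cone_proj G i (?h p j) = ?h p i" using i j by simp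
  qed
  have "?h \<in> ring_hom ?R ?L"
  proof (rule ring_hom_memI)
    fix p q assume p: "p \<in> carrier ?R" and q: "q \<in> carrier ?R"
    show "?h p \<in> carrier ?L" by (rule closed[OF p])
    show "?h (p \<otimes>\<^bsub>?R\<^esub> q) = ?h p \<otimes>\<^bsub>?L\<^esub> ?h q"
      using p q unfolding L Rc by (intro restrict_ext) (simp add: cone_proj_mult[OF G])
    show "?h (p \<oplus>\<^bsub>?R\<^esub> q) = ?h p \<oplus>\<^bsub>?L\<^esub> ?h q"
      unfolding L ops by (intro restrict_ext) (simp add: cone_proj_eq monomial_map_add)
  next
    show "?h \<one>\<^bsub>?R\<^esub> = \<one>\<^bsub>?L\<^esub>"
      unfolding L ops by (intro restrict_ext) (simp add: cone_proj_one[OF G])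
  qed
  moreover have "?h (r \<odot>\<^bsub>?R\<^esub> p) = r \<odot>\<^bsub>?L\<^esub> ?h p" for r p
    unfolding L ops by (intro restrict_ext) (simp add: cone_proj_eq monomial_map_scale)
  moreover have "bij_betw ?h (carrier ?R) (carrier ?L)"
  proof (rule bij_betw_imageI)
    show "inj_on ?h (carrier ?R)"
    proof (rule inj_onI)
      fix p q assume pq: "p \<in> carrier ?R" "q \<in> carrier ?R" and eq: "?h p = ?h q"
      show "p = q"
      proof (rule cone_proj_eqI[OF G])
        fix i assume "i \<in> OP G"
        then show "cone_proj G i p = cone_proj G i q" using fun_cong[OF eq, of i] by simp
      qed (use pq Rc in blast)+
    qed
    show "?h ` carrier ?R = carrier ?L"
    proof
      show "?h ` carrier ?R \<subseteq> carrier ?L" using closed by blast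
      show "carrier ?L \<subseteq> ?h ` carrier ?R"
      proof
        fix x assume x: "x \<in> carrier ?L"
        have "\<exists>i. c \<in> H1 G \<longrightarrow> i \<in> OP G \<and> oriented_darts G i = pos_darts c" for c :: "int ^ 'd"
          using exact_index[OF G] by blast
        then obtain idx where idx: "\<And>c :: int ^ 'd. c \<in> H1 G \<Longrightarrow>
            idx c \<in> OP G \<and> oriented_darts G (idx c) = pos_darts c" by metis
        have kx: "Poly_Mapping.keys (x i) \<subseteq> lattice_cone G i" if "i \<in> OP G" for i
          using x that unfolding Lc by (auto simp: semigroup_ring_def PiE_iff)
        \<comment> \<open>There are only finitely many indices, so the exponents occurring in the
          family form a finite set and \<open>p\<close> is a genuine finite sum.\<close>
        let ?K = "\<Union>i\<in>OP G. Poly_Mapping.keys (x i)"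
        have fin: "finite ?K" by simp
        have K: "?K \<subseteq> H1 G" using kx by (auto simp: lattice_cone_def)
        define p where "p = (\<Sum>c\<in>?K. Poly_Mapping.single c (Poly_Mapping.lookup (x (idx c)) c))"
        have lp: "Poly_Mapping.lookup p c = (if c \<in> ?K then Poly_Mapping.lookup (x (idx c)) c else 0)" for c
          unfolding p_def lookup_sum using fin by (simp add: lookup_single when_def)
        have p: "p \<in> carrier ?R" using K by (auto simp: Rc in_keys_iff lp split: if_splits)
        have "cone_proj G j p = x j" if j: "j \<in> OP G" for j
        proof (rule poly_mapping_eqI)
          fix c
          have l: "Poly_Mapping.lookup (cone_proj G j p) c =
              (if to_real c \<in> cone_of G j then Poly_Mapping.lookup p c else 0)"
            by (simp add: cone_proj_eq lookup_monomial_map_id)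
          show "Poly_Mapping.lookup (cone_proj G j p) c = Poly_Mapping.lookup (x j) c"
          proof (cases "c \<in> lattice_cone G j")
            case False
            then have "Poly_Mapping.lookup (x j) c = 0" using kx[OF j] by (meson in_keys_iff subsetD)
            moreover have "to_real c \<notin> cone_of G j \<or> c \<notin> ?K"
              using False K by (auto simp: lattice_cone_def)
            ultimately show ?thesis unfolding l lp by auto
          next
            case True
            then have c: "c \<in> H1 G" "to_real c \<in> cone_of G j" "pos_darts c \<subseteq> oriented_darts G j"
              using lattice_cone_mem[OF G j] by (auto simp: lattice_cone_def)
            note ic = idx[OF c(1)]
            have "OP_le G (idx c) j" using OP_le_iff[OF G _ j] ic c(3) by blast
            then have "x (idx c) = cone_proj G (idx c) (x j)" using x ic j unfolding Lc by metis
            moreover have "to_real c \<in> cone_of G (idx c)"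
              using lattice_cone_iff[OF G _ c(1)] ic by blast
            ultimately have eq: "Poly_Mapping.lookup (x (idx c)) c = Poly_Mapping.lookup (x j) c"
              by (simp add: cone_proj_eq lookup_monomial_map_id)
            show ?thesis
            proof (cases "c \<in> ?K")
              case True
              then show ?thesis unfolding l lp eq using c(2) by simp
            next
              case False
              then have "Poly_Mapping.lookup (x j) c = 0" using j by (auto simp: in_keys_iff)
              then show ?thesis unfolding l lp using False by auto
            qed
          qed
        qed
        then have "?h p = x"
          using x unfolding Lc by (intro ext) (auto simp: PiE_iff extensional_def)
        then show "x \<in> ?h ` carrier ?R" using p by blast
      qed
    qed
  qed
  ultimately show ?thesis by (simp add: alg_iso_def alg_hom_def)
qed

end

section \<open>The kernel\<close>

text \<open>Subtraction of exponents is truncated at zero; it is exact here because \<open>x\<close>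
  and \<open>y\<close> are distinct and both occur in \<open>m\<close>.\<close>

lemma single_pair_factor:
  fixes m :: "'x \<Rightarrow>\<^sub>0 nat" and a :: "'k::field"
  assumes "x \<in> Poly_Mapping.keys m" "y \<in> Poly_Mapping.keys m" "x \<noteq> y"
  obtains n where "Poly_Mapping.single m a = Poly_Mapping.single n a * (Var x * Var y)"
    "Poly_Mapping.keys n \<subseteq> Poly_Mapping.keys m"
proof -
  let ?n = "m - (Poly_Mapping.single x 1 + Poly_Mapping.single y 1)"
  have "m = ?n + (Poly_Mapping.single x 1 + Poly_Mapping.single y 1)"
    by (rule poly_mapping_eqI)
      (use assms in \<open>auto simp: lookup_add lookup_minus lookup_single when_def in_keys_iff\<close>)
  then have "Poly_Mapping.single m a = Poly_Mapping.single ?n a * (Var x * Var y)"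
    by (simp add: Var_def mult_single)
  moreover have "Poly_Mapping.keys ?n \<subseteq> Poly_Mapping.keys m"
    by (auto simp: in_keys_iff lookup_minus)
  ultimately show ?thesis by (rule that)
qed

lemma ideal_sum_mem:
  fixes P :: "('k, 'a::comm_monoid_add) module"
  assumes "ideal I P" "add P = (+)" "zero P = 0" "\<And>x. x \<in> S \<Longrightarrow> f x \<in> I"
  shows "sum f S \<in> I"
proof -
  note sub = ideal.axioms(1)[OF assms(1)]
  have "0 \<in> I" "\<And>a b. a \<in> I \<Longrightarrow> b \<in> I \<Longrightarrow> a + b \<in> I"
    using additive_subgroup.zero_closed[OF sub] additive_subgroup.a_closed[OF sub]
    by (simp_all add: assms(2,3))
  then show ?thesis using assms(4) by (induction S rule: infinite_finite_induct) auto
qed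

context
  fixes G :: "('v, 'd::finite) graph"
  assumes G: "finite_graph G"
begin

lemma toric_ideal_iff:
  assumes i: "i \<in> OP G"
  shows "p \<in> (toric_ideal G i :: (_ \<Rightarrow>\<^sub>0 'k::field) set) \<longleftrightarrow>
    p \<in> carrier (poly_algebra (Cir_of G i)) \<and> monomial_map (\<lambda>m. True) circuit_sum p = 0"
  unfolding toric_ideal_def a_kernel_def'
  using poly_eval_semigroup_ring[OF G i, of p] by (auto simp: semigroup_ring_def)

lemma kernel_iff:
  "p \<in> a_kernel (poly_algebra (Cir G)) (cographic_ring G :: ('k::field, _) module)
      (poly_eval (cographic_ring G) (\<lambda>\<gamma>. Xpow (circuit_class \<gamma>))) \<longleftrightarrow>
    p \<in> carrier (poly_algebra (Cir G)) \<and>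
    monomial_map (\<lambda>m. pairwise_concordant (Poly_Mapping.keys m)) circuit_sum p = 0"
  unfolding a_kernel_def'
  using poly_eval_cographic[OF G, of p] by (auto simp: cographic_ring_def)

lemma poly_eval_ring_hom_ring:
  "ring_hom_ring (poly_algebra (Cir G)) (cographic_ring G :: ('k::field, (int ^ 'd) \<Rightarrow>\<^sub>0 'k) module)
    (poly_eval (cographic_ring G) (\<lambda>\<gamma>. Xpow (circuit_class \<gamma>)))"
proof (rule ring_hom_ringI2)
  show "ring (poly_algebra (Cir G) :: ('k, _) module)"
    using poly_algebra_cring by (rule cring.axioms(1))
  show "ring (cographic_ring G :: ('k, _) module)"
    using cographic_cring[OF G] by (rule cring.axioms(1))
  have "poly_eval (cographic_ring G) (\<lambda>\<gamma>. Xpow (circuit_class \<gamma>)) \<in>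
      alg_hom (poly_algebra (Cir G)) (cographic_ring G :: ('k, _) module)"
    by (rule poly_eval_alg_hom[OF G])
  then show "poly_eval (cographic_ring G) (\<lambda>\<gamma>. Xpow (circuit_class \<gamma>)) \<in>
      ring_hom (poly_algebra (Cir G)) (cographic_ring G :: ('k, _) module)"
    by (simp add: alg_hom_def)
qed

text \<open>Modulo the discordant monomials a polynomial is a combination of monomials with pairwise
  concordant circuits. Those whose image is the same lattice point \<open>c\<close> all live on any index whose
  cone contains \<open>c\<close>, so grouping the monomials by such an index splits an element of the kernel
  into elements of toric ideals.\<close>

lemma kernel_eq:
  assumes J: "J \<subseteq> OP G"
    and cover: "\<And>c :: int ^ 'd. c \<in> H1 G \<Longrightarrow> \<exists>i\<in>J. pos_darts c \<subseteq> oriented_darts G i"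
  shows "a_kernel (poly_algebra (Cir G)) (cographic_ring G :: ('k::field, (int ^ 'd) \<Rightarrow>\<^sub>0 'k) module)
      (poly_eval (cographic_ring G) (\<lambda>\<gamma>. Xpow (circuit_class \<gamma>))) =
    discordant_ideal G <+>\<^bsub>(poly_algebra (Cir G) :: ('k, (('v, 'd) circuit \<Rightarrow>\<^sub>0 nat) \<Rightarrow>\<^sub>0 'k) module)\<^esub>
      toric_ideal_sum G J"
    (is "?I = ?D <+>\<^bsub>?P\<^esub> ?T")
proof -
  let ?conc = "\<lambda>m :: ('v, 'd) circuit \<Rightarrow>\<^sub>0 nat. pairwise_concordant (Poly_Mapping.keys m)"
  interpret P: cring ?P by (rule poly_algebra_cring)
  have ops: "add ?P = (+)" "mult ?P = (*)" "zero ?P = 0" by (simp_all add: poly_algebra_def)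
  have I: "ideal ?I ?P"
    by (rule ring_hom_ring.kernel_is_ideal[OF poly_eval_ring_hom_ring])
  let ?V = "{Var \<gamma> * Var \<gamma>' | \<gamma> \<gamma>'. \<gamma> \<in> Cir G \<and> \<gamma>' \<in> Cir G \<and> \<not> concordant \<gamma> \<gamma>'} ::
    ((('v, 'd) circuit \<Rightarrow>\<^sub>0 nat) \<Rightarrow>\<^sub>0 'k) set"
  have Var: "Var \<gamma> \<in> carrier ?P" if "\<gamma> \<in> Cir G" for \<gamma>
    using that by (simp add: Var_def poly_algebra_def)
  have V: "?V \<subseteq> carrier ?P" using P.m_closed[OF Var Var] by (auto simp: ops)
  have D: "ideal ?D ?P" unfolding discordant_ideal_def by (rule P.genideal_ideal[OF V])
  have toric_carrier: "toric_ideal G i \<subseteq> carrier ?P" if i: "i \<in> OP G" for i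
    using Cir_of_iff[OF G i] by (fastforce simp: toric_ideal_iff[OF i] poly_algebra_def)
  have T: "ideal (genideal ?P (toric_ideal G i)) ?P" if "i \<in> OP G" for i
    by (rule P.genideal_ideal[OF toric_carrier[OF that]])
  have T_eq: "?T = {sum x J | x. \<forall>i\<in>J. x i \<in> genideal ?P (toric_ideal G i)}"
  proof -
    have "finsum ?P x J = sum x J" if "\<forall>i\<in>J. x i \<in> genideal ?P (toric_ideal G i)" for x
    proof (rule finsum_eq_sum[OF P.abelian_monoid_axioms ops(1,3)])
      fix i assume i: "i \<in> J"
      then have "i \<in> OP G" using J by blast
      then show "x i \<in> carrier ?P" using ideal.Icarr[OF T] that i by metis
    qed
    then show ?thesis unfolding toric_ideal_sum_def ideal_sum_def
      by (intro Collect_cong ex_cong1 rev_conj_cong refl) simp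
  qed
  have "?D \<subseteq> ?I"
    unfolding discordant_ideal_def
  proof (rule P.genideal_minimal[OF I], rule subsetI)
    fix p assume "p \<in> ?V"
    then obtain \<gamma> \<gamma>' where g: "p = Var \<gamma> * Var \<gamma>'" "\<gamma> \<in> Cir G" "\<gamma>' \<in> Cir G" "\<not> concordant \<gamma> \<gamma>'"
      by blast
    have "p \<in> carrier ?P" using V \<open>p \<in> ?V\<close> by blast
    moreover have "p = Poly_Mapping.single (Poly_Mapping.single \<gamma> 1 + Poly_Mapping.single \<gamma>' 1) 1"
      by (simp add: g(1) Var_def mult_single)
    moreover have "\<gamma> \<in> Poly_Mapping.keys (Poly_Mapping.single \<gamma> 1 + Poly_Mapping.single \<gamma>' (1::nat))"
      "\<gamma>' \<in> Poly_Mapping.keys (Poly_Mapping.single \<gamma> 1 + Poly_Mapping.single \<gamma>' (1::nat))"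
      by (simp_all add: in_keys_iff lookup_add)
    then have "\<not> ?conc (Poly_Mapping.single \<gamma> 1 + Poly_Mapping.single \<gamma>' 1)"
      using g(4) unfolding pairwise_concordant_def by blast
    ultimately show "p \<in> ?I" unfolding kernel_iff by (simp add: monomial_map_single)
  qed
  moreover have "?T \<subseteq> ?I"
  proof -
    have "genideal ?P (toric_ideal G i) \<subseteq> ?I" if i: "i \<in> OP G" for i
    proof (rule P.genideal_minimal[OF I], rule subsetI)
      fix p assume p: "p \<in> (toric_ideal G i :: (_ \<Rightarrow>\<^sub>0 'k) set)"
      then have p': "p \<in> carrier (poly_algebra (Cir_of G i))" "monomial_map (\<lambda>m. True) circuit_sum p = 0"
        by (simp_all add: toric_ideal_iff[OF i])
      \<comment> \<open>Circuits of a single index are pairwise concordant, so no monomial is killed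
        and the two evaluations coincide.\<close>
      have "monomial_map ?conc circuit_sum p = monomial_map (\<lambda>m. True) circuit_sum p"
        by (rule monomial_map_cong)
          (simp add: OP_index_pairwise_concordant[OF G i poly_algebra_keys[OF p'(1)]])
      then show "p \<in> ?I" unfolding kernel_iff using p'(2) p toric_carrier[OF i] by auto
    qed
    then have "sum x J \<in> ?I" if "\<forall>i\<in>J. x i \<in> genideal ?P (toric_ideal G i)" for x
      by (intro ideal_sum_mem[OF I ops(1,3)]) (use that J in blast)
    then show ?thesis unfolding T_eq by blast
  qed
  moreover have "?I \<subseteq> ?D <+>\<^bsub>?P\<^esub> ?T"
  proof
    fix p assume "p \<in> ?I"
    then have p: "p \<in> carrier ?P" and p0: "monomial_map ?conc circuit_sum p = 0"
      using kernel_iff by blast+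
    have mC: "Poly_Mapping.keys m \<subseteq> Cir G" if "m \<in> Poly_Mapping.keys p" for m
      by (rule poly_algebra_keys[OF p that])
    have "\<exists>i. c \<in> H1 G \<longrightarrow> i \<in> J \<and> pos_darts c \<subseteq> oriented_darts G i" for c :: "int ^ 'd"
      using cover by blast
    then obtain idx where idx: "\<And>c :: int ^ 'd. c \<in> H1 G \<Longrightarrow> idx c \<in> J \<and> pos_darts c \<subseteq> oriented_darts G (idx c)"
      using cover by metis
    define q where "q = monomial_map (\<lambda>m. \<not> ?conc m) id p"
    define x where "x i = monomial_map (\<lambda>m. ?conc m \<and> idx (circuit_sum m) = i) id p" for i
    have "q \<in> ?D"
      unfolding q_def monomial_map_def
    proof (rule ideal_sum_mem[OF D ops(1,3)])
      fix m assume m: "m \<in> Poly_Mapping.keys p"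
      let ?a = "Poly_Mapping.lookup p m"
      show "(if \<not> ?conc m then Poly_Mapping.single (id m) ?a else 0) \<in> ?D"
      proof (cases "?conc m")
        case True
        then show ?thesis
          using additive_subgroup.zero_closed[OF ideal.axioms(1)[OF D]] by (simp add: ops)
      next
        case False
        then obtain \<gamma> \<gamma>' where g: "\<gamma> \<in> Poly_Mapping.keys m" "\<gamma>' \<in> Poly_Mapping.keys m"
          "\<not> concordant \<gamma> \<gamma>'" unfolding pairwise_concordant_def by blast
        have "concordant \<gamma> \<gamma>" by (cases \<gamma>) (simp add: concordant_def)
        then have "\<gamma> \<noteq> \<gamma>'" using g(3) by blast
        then obtain n where n: "Poly_Mapping.single m ?a = Poly_Mapping.single n ?a * (Var \<gamma> * Var \<gamma>')"
          "Poly_Mapping.keys n \<subseteq> Poly_Mapping.keys m"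
          using single_pair_factor[OF g(1,2)] by metis
        have "Var \<gamma> * Var \<gamma>' \<in> ?V" using g mC[OF m] by blast
        then have "Var \<gamma> * Var \<gamma>' \<in> ?D"
          unfolding discordant_ideal_def using P.genideal_self[OF V] by blast
        moreover have "Poly_Mapping.single n ?a \<in> carrier ?P"
          using n(2) mC[OF m] by (auto simp: poly_algebra_def)
        ultimately have "Poly_Mapping.single n ?a * (Var \<gamma> * Var \<gamma>') \<in> ?D"
          using ideal.I_l_closed[OF D] by (simp add: ops)
        then show ?thesis using False n(1) by simp
      qed
    qed
    moreover have "sum x J \<in> ?T"
    proof -
      have "x i \<in> toric_ideal G i" if i: "i \<in> J" for i
      proof -
        have iO: "i \<in> OP G" using i J by blast
        have "Poly_Mapping.keys m \<subseteq> Cir_of G i"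
          if "m \<in> Poly_Mapping.keys p" "?conc m" "idx (circuit_sum m) = i" for m
          using circuit_sum_in_cone_iff[OF G iO mC[OF that(1)]] that(2,3)
            idx[OF circuit_sum_H1[OF G mC[OF that(1)]]] by simp
        moreover have "Poly_Mapping.keys (x i) \<subseteq>
            {m \<in> Poly_Mapping.keys p. ?conc m \<and> idx (circuit_sum m) = i}"
          unfolding x_def by (rule order_trans[OF keys_monomial_map]) simp
        ultimately have "x i \<in> carrier (poly_algebra (Cir_of G i))"
          by (auto simp: poly_algebra_def)
        \<comment> \<open>Since \<open>idx\<close> is applied to the image point only, all monomials
          with a common image lie in the same piece. The evaluation of \<open>x i\<close> is
          therefore a part of the evaluation of \<open>p\<close>, which is zero.\<close>
        moreover have "monomial_map (\<lambda>m. True) circuit_sum (x i) =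
            monomial_map (\<lambda>c. idx c = i) id (monomial_map ?conc circuit_sum p)"
          unfolding x_def monomial_map_comp id_comp comp_id by simp
        then have "monomial_map (\<lambda>m. True) circuit_sum (x i) = 0" by (simp add: p0)
        ultimately show ?thesis by (simp add: toric_ideal_iff[OF iO])
      qed
      then have "\<forall>i\<in>J. x i \<in> genideal ?P (toric_ideal G i)"
        using P.genideal_self[OF toric_carrier] J by blast
      then show ?thesis unfolding T_eq by blast
    qed
    moreover have "p = q + sum x J"
    proof (rule poly_mapping_eqI)
      fix m
      have "(\<Sum>i\<in>J. Poly_Mapping.lookup (x i) m) = (if ?conc m then Poly_Mapping.lookup p m else 0)"
      proof (cases "m \<in> Poly_Mapping.keys p \<and> ?conc m")
        case True
        then have "idx (circuit_sum m) \<in> J" using idx circuit_sum_H1[OF G mC] by blast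
        moreover have "finite J" by simp
        ultimately show ?thesis using True by (simp add: x_def lookup_monomial_map_id)
      next
        case False
        then show ?thesis by (auto simp: x_def lookup_monomial_map_id in_keys_iff intro!: sum.neutral)
      qed
      then show "Poly_Mapping.lookup p m = Poly_Mapping.lookup (q + sum x J) m"
        by (simp add: lookup_add lookup_sum q_def lookup_monomial_map_id)
    qed
    ultimately show "p \<in> ?D <+>\<^bsub>?P\<^esub> ?T" unfolding set_add_def' ops by blast
  qed
  moreover have "a + b \<in> ?I" if "a \<in> ?I" "b \<in> ?I" for a b
    using additive_subgroup.a_closed[OF ideal.axioms(1)[OF I] that] by (simp add: ops)
  ultimately show ?thesis unfolding set_add_def' ops by blast
qed

text \<open>As rings this is the first isomorphism theorem; what remains is compatibility with the
  scalars of the quotient, which are defined by unions of cosets.\<close>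

lemma quotient_iso:
  "(\<lambda>X. the_elem (poly_eval (cographic_ring G) (\<lambda>\<gamma>. Xpow (circuit_class \<gamma>)) ` X)) \<in> alg_iso
    (quotient_algebra (poly_algebra (Cir G)) (a_kernel (poly_algebra (Cir G)) (cographic_ring G)
      (poly_eval (cographic_ring G) (\<lambda>\<gamma>. Xpow (circuit_class \<gamma>)))))
    (cographic_ring G :: ('k::field, (int ^ 'd) \<Rightarrow>\<^sub>0 'k) module)"
    (is "?h \<in> alg_iso (quotient_algebra ?P ?I) ?R")
proof -
  let ?\<pi> = "poly_eval ?R (\<lambda>\<gamma>. Xpow (circuit_class \<gamma>))"
  interpret pi: ring_hom_ring ?P ?R ?\<pi> by (rule poly_eval_ring_hom_ring)
  interpret I: ideal ?I ?P by (rule pi.kernel_is_ideal)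
  let ?Q = "quotient_algebra ?P ?I"
  have Q: "carrier ?Q = carrier (?P Quot ?I)" "mult ?Q = mult (?P Quot ?I)" "add ?Q = add (?P Quot ?I)"
    "one ?Q = one (?P Quot ?I)" "smult ?Q = (\<lambda>r X. \<Union>x\<in>X. ?I +>\<^bsub>?P\<^esub> (r \<odot>\<^bsub>?P\<^esub> x))"
    by (simp_all add: quotient_algebra_def ring.extend_def module.fields_def)
  have "?h \<in> ring_iso (?P Quot ?I) ?R"
    by (rule pi.FactRing_iso_set[OF poly_eval_surj[OF G]])
  then have iso: "?h \<in> ring_hom ?Q ?R" "bij_betw ?h (carrier ?Q) (carrier ?R)"
    by (simp_all add: ring_iso_def ring_hom_def Q)
  have coset: "?\<pi> y = ?\<pi> a" if a: "a \<in> carrier ?P" and y: "y \<in> ?I +>\<^bsub>?P\<^esub> a" for a y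
  proof -
    obtain b where b: "b \<in> ?I" "y = b \<oplus>\<^bsub>?P\<^esub> a" using y unfolding a_r_coset_def' by blast
    then have "b \<in> carrier ?P" "?\<pi> b = \<zero>\<^bsub>?R\<^esub>" unfolding a_kernel_def' by blast+
    then show ?thesis using a b(2) by simp
  qed
  have "?\<pi> \<in> alg_hom ?P ?R" by (rule poly_eval_alg_hom[OF G])
  then have smult: "?\<pi> (r \<odot>\<^bsub>?P\<^esub> a) = r \<odot>\<^bsub>?R\<^esub> ?\<pi> a" if "a \<in> carrier ?P" for r a
    using that by (simp add: alg_hom_def)
  have sc: "r \<odot>\<^bsub>?P\<^esub> a \<in> carrier ?P" if "a \<in> carrier ?P" for r a
    using that keys_map_scale[of r a] by (auto simp: poly_algebra_def)
  have "?h (r \<odot>\<^bsub>?Q\<^esub> X) = r \<odot>\<^bsub>?R\<^esub> ?h X" if X: "X \<in> carrier ?Q" for r X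
  proof -
    obtain a where a: "a \<in> carrier ?P" "X = ?I +>\<^bsub>?P\<^esub> a"
      using X by (auto simp: Q(1) FactRing_def A_RCOSETS_def')
    have self: "b \<in> ?I +>\<^bsub>?P\<^esub> b" if "b \<in> carrier ?P" for b
      by (rule I.a_rcos_self[OF that])
    have Xc: "X \<subseteq> carrier ?P" unfolding a(2) by (rule pi.R.a_r_coset_subset_G[OF I.a_subset a(1)])
    have "?\<pi> ` X = {?\<pi> a}"
      using coset[OF a(1)] self[OF a(1)] unfolding a(2) by blast
    \<comment> \<open>Only the image of the union of cosets is computed; it is a single point, which
      determines \<open>the_elem\<close>.\<close>
    moreover have "?\<pi> ` (r \<odot>\<^bsub>?Q\<^esub> X) = {r \<odot>\<^bsub>?R\<^esub> ?\<pi> a}"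
    proof (intro equalityI subsetI)
      fix z assume "z \<in> ?\<pi> ` (r \<odot>\<^bsub>?Q\<^esub> X)"
      then obtain x y where xy: "x \<in> X" "y \<in> ?I +>\<^bsub>?P\<^esub> (r \<odot>\<^bsub>?P\<^esub> x)" "z = ?\<pi> y"
        unfolding Q(5) by blast
      have x: "x \<in> carrier ?P" using xy(1) Xc by blast
      have "z = r \<odot>\<^bsub>?R\<^esub> ?\<pi> x" using coset[OF sc[OF x] xy(2)] xy(3) smult[OF x] by simp
      then show "z \<in> {r \<odot>\<^bsub>?R\<^esub> ?\<pi> a}" using coset[OF a(1)] xy(1) a(2) by simp
    next
      fix z assume "z \<in> {r \<odot>\<^bsub>?R\<^esub> ?\<pi> a}"
      then have "z = ?\<pi> (r \<odot>\<^bsub>?P\<^esub> a)" using smult[OF a(1)] by simp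
      moreover have "r \<odot>\<^bsub>?P\<^esub> a \<in> r \<odot>\<^bsub>?Q\<^esub> X"
        unfolding Q(5) a(2) using self[OF a(1)] self[OF sc[OF a(1)]] by blast
      ultimately show "z \<in> ?\<pi> ` (r \<odot>\<^bsub>?Q\<^esub> X)" by blast
    qed
    ultimately show ?thesis by simp
  qed
  then show ?thesis using iso by (simp add: alg_iso_def alg_hom_def)
qed

end

theorem mainTheorem6:
  fixes G :: "('v, 'd::finite) graph"
  assumes "finite_graph G"
  shows
    "let R = (cographic_ring G :: ('k::field, (int ^ 'd) \<Rightarrow>\<^sub>0 'k) module);
         P = (poly_algebra (Cir G) :: ('k, (('v, 'd) circuit \<Rightarrow>\<^sub>0 nat) \<Rightarrow>\<^sub>0 'k) module);
         \<pi> = poly_eval R (\<lambda>\<gamma>. Xpow (circuit_class \<gamma>));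
         I = a_kernel P R \<pi>
     in
       (\<lambda>p. \<lambda>i\<in>OP G. cone_proj G i p)
         \<in> alg_iso R (inverse_limit (OP G) (OP_le G) (semigroup_ring G) (\<lambda>j i. cone_proj G i))
     \<and> \<pi> \<in> alg_hom P R
     \<and> (\<forall>\<gamma>\<in>Cir G. \<pi> (Var \<gamma>) = Xpow (circuit_class \<gamma>))
     \<and> \<pi> ` carrier P = carrier R
     \<and> I = discordant_ideal G <+>\<^bsub>P\<^esub> toric_ideal_sum G (OP G)
     \<and> I = discordant_ideal G <+>\<^bsub>P\<^esub>
             toric_ideal_sum G {(T, \<phi>) \<in> OP G. T = separating_edges G}
     \<and> (\<lambda>X. the_elem (\<pi> ` X)) \<in> alg_iso (quotient_algebra P I) R"
proof -
  note G = assms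
  \<comment> \<open>Both descriptions of the kernel come from \<open>kernel_eq\<close>, which asks
    that the cones of the chosen indices cover the lattice: the exact indices do, and so do those of
    the generic points.\<close>
  have all: "\<exists>i\<in>OP G. pos_darts c \<subseteq> oriented_darts G i" if "c \<in> H1 G" for c :: "int ^ 'd"
    using exact_index[OF G that] by (metis order_refl)
  have sep: "\<exists>i\<in>{(T, \<phi>) \<in> OP G. T = separating_edges G}. pos_darts c \<subseteq> oriented_darts G i"
    if c: "c \<in> H1 G" for c :: "int ^ 'd"
  proof -
    obtain \<phi> where "(separating_edges G, \<phi>) \<in> OP G"
      "pos_darts c \<subseteq> oriented_darts G (separating_edges G, \<phi>)"
      by (rule separating_index[OF G c])
    then show ?thesis by (intro bexI[of _ "(separating_edges G, \<phi>)"]) simp_all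
  qed
  show ?thesis
    unfolding Let_def
    by (intro conjI ballI cographic_ring_limit[OF G] poly_eval_alg_hom[OF G] poly_eval_Var[OF G]
      poly_eval_surj[OF G] kernel_eq[OF G order_refl all] kernel_eq[OF G _ sep] quotient_iso[OF G])
      auto
qed



end
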